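(* Let $\alpha\in(0,2\pi]$, let $f:\mathbb{R}^2\to\mathbb{R}$ be a probability density function that is bounded and almost everywhere continuous, and suppose that $f$ has bounded support. Let $(r_n)_{n\ge1}$ be a sequence of positive reals. Let $k\ge2$ and let $T$ be a connected feasible digraph of order $k$. Let $H_{n,T}$ be the number of induced $T$-subgraphs of the random sector digraph $G(\mathcal{X}_n,\mathcal{Y}_n,r_n)$. Suppose $r_n\to0$ and there is a constant $\delta>0$ such that $\liminf_{n\to\infty} n^{2k-1-\delta}r_n^{4(k-1)}>0$. Then $$\lim_{n\to\infty}n^{-k}r_n^{-2(k-1)}H_{n,T}=\mu_T\quad\text{almost surely},$$ where $$\mu_T:=\frac1{k!(2\pi)^k}\int_{[0,2\pi]^k}\int_{(\mathbb{R}^2)^{k}}h_T(0,z_2,\dots,z_k,y_1,\dots,y_k)\,f^k(x)\,\mathrm{d}x\,\mathrm{d}z_2\cdots\mathrm{d}z_k\,\mathrm{d}y_1\cdots\mathrm{d}y_k.$$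
   Context: Sectors: for $x\in\mathbb{R}^2$, $y\in[0,2\pi]$, $r>0$, $S(x,y,r)$ is the sector of the Euclidean disk of radius $r$ centered at $x$, with central angle $\alpha$ and inclination $y$ measured anticlockwise from the horizontal direction, i.e. $S(x,y,r)=\{x+\rho(\cos\phi,\sin\phi):0\le\rho\le r,\ y\le\phi\le y+\alpha\}$. Sector digraph: for distinct points $x_1,\dots,x_m\in\mathbb{R}^2$ and angles $y_1,\dots,y_m$, the digraph $G(\{x_i\},\{y_i\},r)$ has vertex set $\{x_1,\dots,x_m\}$ and an arc $(x_i,x_j)$, $i\ne j$, if and only if $x_j\in S(x_i,y_i,r)$. Random model: $X_1,X_2,\dots$ are i.i.d. random vectors in $\mathbb{R}^2$ with density $f$; $Y_1,Y_2,\dots$ are i.i.d. uniform on $[0,2\pi)$, independent of the $X_i$; $\mathcal{X}_n=\{X_1,\dots,X_n\}$, $\mathcal{Y}_n=\{Y_1,\dots,Y_n\}$. The random sector digraph is $G(\mathcal{X}_n,\mathcal{Y}_n,r_n)$. Subgraphs: $T$ is a fixed digraph on $k$ vertices, connected in the sense that its underlying undirected graph is connected. $T$ is feasible if $P(G(\mathcal{X}_k,\mathcal{Y}_k,r)\cong T)>0$ for some $r>0$. An induced $T$-subgraph is an induced subgraph isomorphic to $T$; the count is over vertex subsets of size $k$. Indicator: $h_T(x_1,\dots,x_k,y_1,\dots,y_k)=1$ if $G(\{x_1,\dots,x_k\},\{y_1,\dots,y_k\},1)\cong T$, and $0$ otherwise. $f^k(x)$ means $(f(x))^k$. *)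

theory Defs
  imports "HOL-Probability.Probability" "Graph_Theory.Graph_Theory"
begin

definition sector :: "real \<Rightarrow> real^2 \<Rightarrow> real \<Rightarrow> real \<Rightarrow> (real^2) set" where
  "sector \<alpha> x y r =
     {x + \<rho> *\<^sub>R vector [cos \<phi>, sin \<phi>] | \<rho> \<phi>. 0 \<le> \<rho> \<and> \<rho> \<le> r \<and> y \<le> \<phi> \<and> \<phi> \<le> y + \<alpha>}"

text \<open>
  The points are indexed by \<^term>\<open>I\<close> so that each can be matched with its angle. The vertices are
  the points themselves; the definition is meant for \<^term>\<open>x\<close> injective on \<^term>\<open>I\<close>. In the
  random model this holds almost surely, because the points have a density.
\<close>

definition sector_digraph ::
  "real \<Rightarrow> 'i set \<Rightarrow> ('i \<Rightarrow> real^2) \<Rightarrow> ('i \<Rightarrow> real) \<Rightarrow> real \<Rightarrow> (real^2, (real^2) \<times> (real^2)) pre_digraph"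
where
  "sector_digraph \<alpha> I x y r =
     \<lparr> verts = x ` I,
       arcs = {(x i, x j) | i j. i \<in> I \<and> j \<in> I \<and> i \<noteq> j \<and> x j \<in> sector \<alpha> (x i) (y i) r},
       tail = fst, head = snd \<rparr>"

definition induced_count :: "('a, 'b) pre_digraph \<Rightarrow> ('c, 'd) pre_digraph \<Rightarrow> nat" where
  "induced_count G T =
     card {W. W \<subseteq> verts G \<and> card W = card (verts T) \<and> digraph_iso (G \<restriction> W) T}"

definition prob_density :: "(real^2 \<Rightarrow> real) \<Rightarrow> bool" where
  "prob_density f \<longleftrightarrow>
     f \<in> borel_measurable borel \<and> (\<forall>x. 0 \<le> f x) \<and> (\<integral>\<^sup>+x. ennreal (f x) \<partial>lborel) = 1"

text \<open>
  Sequences are indexed from \<open>0\<close>: the first \<open>n\<close> points and angles are those with index in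
  \<^term>\<open>{..<n}\<close>. The last assumption says that the \<open>\<sigma>\<close>-algebra generated by all the \<open>X i\<close> is
  independent of the one generated by all the \<open>Y i\<close>; \<^const>\<open>prob_space.indep_var\<close> cannot be used
  for this as it requires both variables to take values in the same type.
\<close>

locale random_sector_model = prob_space M for M :: "'w measure" +
  fixes f :: "real^2 \<Rightarrow> real"
    and X :: "nat \<Rightarrow> 'w \<Rightarrow> real^2"
    and Y :: "nat \<Rightarrow> 'w \<Rightarrow> real"
  assumes X_indep: "indep_vars (\<lambda>_. borel) X UNIV"
    and X_density: "\<And>i. distributed M lborel (X i) (\<lambda>x. ennreal (f x))"
    and Y_indep: "indep_vars (\<lambda>_. borel) Y UNIV"
    and Y_uniform: "\<And>i. distr M lborel (Y i) = uniform_measure lborel {0..<2 * pi}"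
    and XY_indep: "indep_set
          (sets (vimage_algebra (space M) (\<lambda>\<omega> i. X i \<omega>) (Pi\<^sub>M UNIV (\<lambda>_. borel))))
          (sets (vimage_algebra (space M) (\<lambda>\<omega> i. Y i \<omega>) (Pi\<^sub>M UNIV (\<lambda>_. borel))))"

definition random_sector_digraph ::
  "real \<Rightarrow> (nat \<Rightarrow> 'w \<Rightarrow> real^2) \<Rightarrow> (nat \<Rightarrow> 'w \<Rightarrow> real) \<Rightarrow> nat \<Rightarrow> real \<Rightarrow> 'w
    \<Rightarrow> (real^2, (real^2) \<times> (real^2)) pre_digraph"
where
  "random_sector_digraph \<alpha> X Y n r \<omega> =
     sector_digraph \<alpha> {..<n} (\<lambda>i. X i \<omega>) (\<lambda>i. Y i \<omega>) r"

definition feasible ::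
  "'w measure \<Rightarrow> (nat \<Rightarrow> 'w \<Rightarrow> real^2) \<Rightarrow> (nat \<Rightarrow> 'w \<Rightarrow> real) \<Rightarrow> real \<Rightarrow> ('a, 'b) pre_digraph \<Rightarrow> bool"
where
  "feasible M X Y \<alpha> T \<longleftrightarrow>
     (\<exists>r>0. measure M {\<omega> \<in> space M.
                digraph_iso (random_sector_digraph \<alpha> X Y (card (verts T)) r \<omega>) T} > 0)"

definition h_ind :: "real \<Rightarrow> ('a, 'b) pre_digraph \<Rightarrow> (nat \<Rightarrow> real^2) \<Rightarrow> (nat \<Rightarrow> real) \<Rightarrow> real" where
  "h_ind \<alpha> T x y = (if digraph_iso (sector_digraph \<alpha> {..<card (verts T)} x y 1) T then 1 else 0)"

text \<open>
  Here \<^term>\<open>z\<close> ranges over the points with index in \<open>{1..<k}\<close>, and the point with index \<open>0\<close>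
  is fixed at the origin.
\<close>

definition mu_const :: "real \<Rightarrow> (real^2 \<Rightarrow> real) \<Rightarrow> ('a, 'b) pre_digraph \<Rightarrow> real" where
  "mu_const \<alpha> f T = (let k = card (verts T) in
     1 / (fact k * (2 * pi) ^ k) *
     (LINT y : (\<Pi>\<^sub>E i\<in>{..<k}. {0..2 * pi}) | (\<Pi>\<^sub>M i\<in>{..<k}. lborel).
        (\<integral>(x, z). h_ind \<alpha> T (z(0 := 0)) y * f x ^ k
           \<partial>(lborel \<Otimes>\<^sub>M (\<Pi>\<^sub>M i\<in>{1..<k}. lborel)))))"

end

theory Submission
  imports Defs "HOL-Real_Asymp.Real_Asymp"
begin

text \<open>
  Let \<open>p\<close> be the probability that \<open>k\<close> points induce a copy of \<open>T\<close> and \<open>N = n ^ k * r ^ (2 * (k - 1))\<close>,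
  where \<open>r = r n\<close>. Rescaling all points relative to the first one and dominated convergence give
  \<open>p / r ^ (2 * (k - 1)) \<longlonglongrightarrow> fact k * mu_const \<alpha> f T\<close>, which settles the mean of the count.

  For the fluctuations the fourth central moment suffices. Expand it as a sum over quadruples of
  \<open>k\<close>-sets of indices. A quadruple with a set disjoint from the other three contributes \<open>0\<close>. In the
  remaining ones the sets form a chain, each meeting the union of the previous ones, or two
  overlapping pairs. As \<open>T\<close> is connected, a copy has diameter \<open>O(r)\<close>, so a set that
  shares an index with given ones and has \<open>j < k\<close> new indices costs a factor \<open>O(r ^ (2 * j))\<close>, and
  summing over these sets costs a factor \<open>L = O(1 + (n * r\<^sup>2) ^ (k - 1)) = O(1 + N / n)\<close>.
  Hence the fourth moment is \<open>O(N * L ^ 3 + N\<^sup>2 * L\<^sup>2)\<close>. Divided by \<open>N ^ 4\<close> this is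
  \<open>O(1 / N\<^sup>2 + 1 / n\<^sup>2)\<close>, and the assumption on \<open>r\<close> says that \<open>N\<^sup>2\<close> is at least of
  order \<open>n powr (1 + \<delta>)\<close>. So the normalised fourth moments are summable, and the centred count
  divided by \<open>N\<close> tends to \<open>0\<close> almost surely.
\<close>

section \<open>Sector digraphs\<close>

text \<open>The variance would not be enough: the same expansion bounds it, after division by N ^ 2,
  by O(1 / N + 1 / n). Here 1 / n is not summable, and the hypothesis bounds N below only by a
  multiple of n powr ((1 + \<delta>) / 2). Passing to the fourth moment squares both rates. The
  moment estimate lives in the locale \<open>local_statistic\<close>, which knows nothing of
  sectors. Instead of the signed \<open>\<xi> = h - p\<close> it bounds products of the nonnegative
  \<open>g = h + p\<close>, from which one factor at a time can be peeled off. The added constant is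
  harmless: \<open>p\<close> is at most \<open>q ^ (k - 1)\<close>, the price of a set with
  \<open>k - 1\<close> new indices. Vertices are points and not indices, so the count is a sum over
  index sets only where the sample points are distinct; this has to be shown to hold almost surely.
  Isomorphism with \<open>T\<close> is first rewritten as a finite combination of sector conditions
  on the points. Measurability, scaling and the diameter bound are all read off from that
  form.\<close>

lemma digraph_iso_sector_digraph_iff:
  assumes "digraph T" and A: "finite A" "card A = card (verts T)"
  shows "digraph_iso (sector_digraph \<alpha> A x y r) T \<longleftrightarrow>
    inj_on x A \<and> (\<exists>\<sigma>\<in>A \<rightarrow>\<^sub>E verts T. bij_betw \<sigma> A (verts T) \<and>
      (\<forall>i\<in>A. \<forall>j\<in>A. i \<noteq> j \<longrightarrow> (x j \<in> sector \<alpha> (x i) (y i) r \<longleftrightarrow> (\<sigma> i, \<sigma> j) \<in> arcs_ends T)))"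
    (is "?L \<longleftrightarrow> ?R")
proof -
  interpret T: digraph T by fact
  let ?G = "sector_digraph \<alpha> A x y r"
  have verts: "verts ?G = x ` A"
    and arcs: "arcs ?G = {(x i, x j) | i j. i \<in> A \<and> j \<in> A \<and> i \<noteq> j \<and> x j \<in> sector \<alpha> (x i) (y i) r}"
    and [simp]: "tail ?G = fst" "head ?G = snd"
    by (simp_all add: sector_digraph_def)
  show ?thesis
  proof
    assume ?L
    then obtain h where h: "pre_digraph.digraph_isomorphism ?G h" "T = app_iso h ?G"
      unfolding digraph_iso_def by blast
    note hD = h(1)[unfolded pre_digraph.digraph_isomorphism_def]
    have vT: "verts T = iso_verts h ` x ` A" and aT: "arcs T = iso_arcs h ` arcs ?G"
      and tT: "tail T = iso_tail h" and hT: "head T = iso_head h"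
      using h(2) verts by simp_all
    \<comment> \<open>\<open>T\<close> has as many vertices as \<open>A\<close> has indices, and its
      vertices are an image of the points, so \<open>x\<close> cannot identify two indices.\<close>
    have "card (verts T) \<le> card (x ` A)" "card (x ` A) \<le> card A"
      using vT A(1) by (simp_all add: card_image_le)
    then have inj: "inj_on x A" using A by (simp add: eq_card_imp_inj_on)
    have inj2: "inj_on (iso_verts h) (x ` A)" using hD verts by simp
    define s where "s i = iso_verts h (x i)" for i
    have bij: "bij_betw s A (verts T)"
      unfolding bij_betw_def s_def using vT comp_inj_on[OF inj inj2] by (auto simp: o_def)
    have tl: "tail T (iso_arcs h e) = iso_verts h (fst e)"
      and hd: "head T (iso_arcs h e) = iso_verts h (snd e)" if "e \<in> arcs ?G" for e
      using hD that tT hT by auto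
    have eq: "x j \<in> sector \<alpha> (x i) (y i) r \<longleftrightarrow> (s i, s j) \<in> arcs_ends T"
      if ij: "i \<in> A" "j \<in> A" "i \<noteq> j" for i j
    proof
      assume "x j \<in> sector \<alpha> (x i) (y i) r"
      then have e: "(x i, x j) \<in> arcs ?G" using ij arcs by auto
      then have "iso_arcs h (x i, x j) \<in> arcs T" using aT by auto
      moreover have "tail T (iso_arcs h (x i, x j)) = s i" "head T (iso_arcs h (x i, x j)) = s j"
        using tl[OF e] hd[OF e] by (simp_all add: s_def)
      ultimately show "(s i, s j) \<in> arcs_ends T"
        unfolding arcs_ends_conv by force
    next
      assume "(s i, s j) \<in> arcs_ends T"
      then obtain e' where e': "e' \<in> arcs T" "tail T e' = s i" "head T e' = s j"
        by (auto simp: arcs_ends_conv)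
      then obtain e where e: "e \<in> arcs ?G" "e' = iso_arcs h e" using aT by auto
      then obtain i' j' where i': "e = (x i', x j')" "i' \<in> A" "j' \<in> A"
        "x j' \<in> sector \<alpha> (x i') (y i') r" using arcs by auto
      have "s i' = s i" "s j' = s j" using tl[OF e(1)] hd[OF e(1)] e' e i' by (simp_all add: s_def)
      then have "i' = i" "j' = j"
        using bij ij i' by (auto simp: bij_betw_def dest: inj_onD)
      then show "x j \<in> sector \<alpha> (x i) (y i) r" using i' by simp
    qed
    have "restrict s A \<in> A \<rightarrow>\<^sub>E verts T" "bij_betw (restrict s A) A (verts T)"
      using bij by (auto simp: bij_betw_def)
    then show ?R using inj eq by (intro conjI bexI[of _ "restrict s A"]) auto
  next
    assume ?R
    then obtain s where inj: "inj_on x A" and bij: "bij_betw s A (verts T)"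
      and eq: "\<And>i j. i \<in> A \<Longrightarrow> j \<in> A \<Longrightarrow> i \<noteq> j \<Longrightarrow>
        x j \<in> sector \<alpha> (x i) (y i) r \<longleftrightarrow> (s i, s j) \<in> arcs_ends T" by blast
    define v where "v u = s (the_inv_into A x u)" for u
    have v: "v (x i) = s i" if "i \<in> A" for i
      using that inj by (simp add: v_def the_inv_into_f_f)
    \<comment> \<open>Without multiple arcs an arc of \<open>T\<close> is recovered from its pair of
      ends, so the vertex bijection dictates the arc map \<open>a\<close>.\<close>
    have "inj_on (arc_to_ends T) (arcs T)" using T.no_multi_arcs by (auto intro: inj_onI)
    then have E: "the_inv_into (arcs T) (arc_to_ends T) (arc_to_ends T e) = e" if "e \<in> arcs T" for e
      using that by (simp add: the_inv_into_f_f)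
    define a where "a e = the_inv_into (arcs T) (arc_to_ends T) (v (fst e), v (snd e))" for e
    have a: "a e \<in> arcs T \<and> tail T (a e) = v (fst e) \<and> head T (a e) = v (snd e)"
      if e: "e \<in> arcs ?G" for e
    proof -
      obtain i j where ij: "e = (x i, x j)" "i \<in> A" "j \<in> A" "i \<noteq> j" "x j \<in> sector \<alpha> (x i) (y i) r"
        using e unfolding arcs by blast
      then have "(s i, s j) \<in> arcs_ends T" using eq by auto
      then obtain e' where "e' \<in> arcs T" "arc_to_ends T e' = (s i, s j)" by (auto simp: arcs_ends_def)
      moreover from this have "a e = e'" using E[of e'] ij v by (simp add: a_def)
      ultimately show ?thesis using ij v by (simp add: arc_to_ends_def)
    qed
    have arcsT: "arcs T = a ` arcs ?G"
    proof (intro equalityI subsetI)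
      fix e assume e: "e \<in> arcs T"
      then have "tail T e \<in> verts T" "head T e \<in> verts T" by auto
      then obtain i j where ij: "i \<in> A" "j \<in> A" "tail T e = s i" "head T e = s j"
        using bij unfolding bij_betw_def by (metis imageE)
      \<comment> \<open>The arcs of a sector digraph exclude the diagonal by definition; for
        \<open>T\<close> the absence of loops supplies this.\<close>
      then have "i \<noteq> j" using T.no_loops[OF e] by auto
      moreover have ends: "arc_to_ends T e = (s i, s j)" using ij by (simp add: arc_to_ends_def)
      ultimately have "(x i, x j) \<in> arcs ?G"
        using eq[of i j] ij e arcs by (auto simp: arcs_ends_def intro: rev_image_eqI)
      moreover have "a (x i, x j) = e" using E[OF e] ends ij v by (simp add: a_def)
      ultimately show "e \<in> a ` arcs ?G" by force
    qed (use a in auto)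
    define h where "h = \<lparr>iso_verts = v, iso_arcs = a, iso_head = head T, iso_tail = tail T\<rparr>"
    have "wf_digraph ?G" by unfold_locales (auto simp: sector_digraph_def)
    moreover have "inj_on v (x ` A)"
      using bij v by (auto simp: inj_on_def bij_betw_def)
    moreover have "inj_on a (arcs ?G)"
    proof (rule inj_onI)
      fix d e assume de: "d \<in> arcs ?G" "e \<in> arcs ?G" "a d = a e"
      then have "v (fst d) = v (fst e)" "v (snd d) = v (snd e)" using a by metis+
      moreover have "fst d \<in> x ` A" "snd d \<in> x ` A" "fst e \<in> x ` A" "snd e \<in> x ` A"
        using de arcs by auto
      ultimately show "d = e" using \<open>inj_on v (x ` A)\<close> by (auto dest: inj_onD intro: prod_eqI)
    qed
    ultimately have "pre_digraph.digraph_isomorphism ?G h"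
      using a by (auto simp: pre_digraph.digraph_isomorphism_def h_def verts)
    moreover have "T = app_iso h ?G"
    proof (rule pre_digraph.equality)
      have "v ` x ` A = s ` A" using v by (force simp: image_iff)
      then show "verts T = verts (app_iso h ?G)" using bij by (simp add: h_def verts bij_betw_def)
    qed (use arcsT in \<open>simp_all add: h_def\<close>)
    ultimately show ?L unfolding digraph_iso_def by blast
  qed
qed

lemma induce_subgraph_sector_digraph:
  assumes "inj_on x I" "A \<subseteq> I"
  shows "sector_digraph \<alpha> I x y r \<restriction> (x ` A) = sector_digraph \<alpha> A x y r"
proof -
  have *: "x i \<in> x ` A \<longleftrightarrow> i \<in> A" if "i \<in> I" for i
    using assms that by (meson inj_on_image_mem_iff)
  have "((\<exists>i j. p = (x i, x j) \<and> i \<in> I \<and> j \<in> I \<and> i \<noteq> j \<and> x j \<in> sector \<alpha> (x i) (y i) r) \<and>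
      fst p \<in> x ` A \<and> snd p \<in> x ` A) \<longleftrightarrow>
    (\<exists>i j. p = (x i, x j) \<and> i \<in> A \<and> j \<in> A \<and> i \<noteq> j \<and> x j \<in> sector \<alpha> (x i) (y i) r)" for p
  proof (rule iffI; elim exE conjE)
    fix i j assume "p = (x i, x j)" "i \<in> I" "j \<in> I" "i \<noteq> j" "x j \<in> sector \<alpha> (x i) (y i) r"
      "fst p \<in> x ` A" "snd p \<in> x ` A"
    then show "\<exists>i j. p = (x i, x j) \<and> i \<in> A \<and> j \<in> A \<and> i \<noteq> j \<and> x j \<in> sector \<alpha> (x i) (y i) r"
      using * by (intro exI[of _ i] exI[of _ j]) simp
  next
    fix i j assume "p = (x i, x j)" "i \<in> A" "j \<in> A" "i \<noteq> j" "x j \<in> sector \<alpha> (x i) (y i) r"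
    then show "(\<exists>i j. p = (x i, x j) \<and> i \<in> I \<and> j \<in> I \<and> i \<noteq> j \<and> x j \<in> sector \<alpha> (x i) (y i) r) \<and>
        fst p \<in> x ` A \<and> snd p \<in> x ` A"
      using assms(2) by (intro conjI exI[of _ i] exI[of _ j]) auto
  qed
  then show ?thesis unfolding induce_subgraph_def sector_digraph_def by simp
qed

text \<open>For distinct points, taking images is a bijection between index sets and vertex sets.
  The count becomes a sum of indicators over index sets, to which independence of the sample
  applies.\<close>

lemma induced_count_sector_digraph:
  assumes "inj_on x I"
  shows "induced_count (sector_digraph \<alpha> I x y r) T =
    card {A. A \<subseteq> I \<and> card A = card (verts T) \<and> digraph_iso (sector_digraph \<alpha> A x y r) T}"
proof -
  let ?S = "{A. A \<subseteq> I \<and> card A = card (verts T) \<and> digraph_iso (sector_digraph \<alpha> A x y r) T}"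
  have card: "card (x ` A) = card A" if "A \<subseteq> I" for A
    using assms that by (meson card_image inj_on_subset)
  have "{W. W \<subseteq> verts (sector_digraph \<alpha> I x y r) \<and> card W = card (verts T) \<and>
      digraph_iso (sector_digraph \<alpha> I x y r \<restriction> W) T} = (`) x ` ?S" (is "?W = _")
  proof (intro equalityI subsetI)
    fix W assume W: "W \<in> ?W"
    then obtain A where A: "A \<subseteq> I" "W = x ` A"
      by (auto simp: sector_digraph_def subset_image_iff)
    then show "W \<in> (`) x ` ?S"
      using W card[OF A(1)] induce_subgraph_sector_digraph[OF assms A(1)] by auto
  next
    fix W assume "W \<in> (`) x ` ?S"
    then show "W \<in> ?W"
      using card induce_subgraph_sector_digraph[OF assms] by (auto simp: sector_digraph_def)
  qed
  moreover have "inj_on ((`) x) ?S"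
    using inj_on_image_Pow[OF assms] by (rule inj_on_subset) auto
  ultimately show ?thesis unfolding induced_count_def by (simp add: card_image)
qed

section \<open>Metric and affine properties of sectors\<close>

lemma norm_cos_sin: "norm (vector [cos t, sin t] :: real^2) = 1"
  by (simp add: norm_vec_def L2_set_def sum_2)

lemma sector_dist: "u \<in> sector \<alpha> x y r \<Longrightarrow> dist x u \<le> r"
  by (auto simp: sector_def dist_norm norm_cos_sin)

lemma sector_affine:
  assumes "0 < r"
  shows "c + r *\<^sub>R v \<in> sector \<alpha> (c + r *\<^sub>R u) y r \<longleftrightarrow> v \<in> sector \<alpha> u y 1"
proof
  assume "c + r *\<^sub>R v \<in> sector \<alpha> (c + r *\<^sub>R u) y r"
  then obtain \<rho> \<phi> where *: "c + r *\<^sub>R v = c + r *\<^sub>R u + \<rho> *\<^sub>R vector [cos \<phi>, sin \<phi>]"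
    "0 \<le> \<rho>" "\<rho> \<le> r" "y \<le> \<phi>" "\<phi> \<le> y + \<alpha>" unfolding sector_def by blast
  then have "r *\<^sub>R v = r *\<^sub>R (u + (\<rho> / r) *\<^sub>R vector [cos \<phi>, sin \<phi>])"
    using assms by (simp add: scaleR_add_right)
  then have "v = u + (\<rho> / r) *\<^sub>R vector [cos \<phi>, sin \<phi>]" using assms by (subst (asm) scaleR_left_imp_eq) auto
  then show "v \<in> sector \<alpha> u y 1"
    using * assms unfolding sector_def mem_Collect_eq
    by (intro exI[of _ "\<rho> / r"] exI[of _ \<phi>]) auto
next
  assume "v \<in> sector \<alpha> u y 1"
  then obtain \<rho> \<phi> where *: "v = u + \<rho> *\<^sub>R vector [cos \<phi>, sin \<phi>]"
    "0 \<le> \<rho>" "\<rho> \<le> 1" "y \<le> \<phi>" "\<phi> \<le> y + \<alpha>" unfolding sector_def by blast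
  then show "c + r *\<^sub>R v \<in> sector \<alpha> (c + r *\<^sub>R u) y r"
    using assms unfolding sector_def mem_Collect_eq
    by (intro exI[of _ "r * \<rho>"] exI[of _ \<phi>]) (auto simp: scaleR_add_right mult_left_le)
qed

text \<open>A sector moves and scales with its apex while its inclination stays fixed, so adjacency
  depends only on relative positions in units of the radius. This yields the power of
  \<open>r\<close> in the mean.\<close>

lemma digraph_iso_sector_digraph_affine:
  assumes "digraph T" "finite A" "card A = card (verts T)" "0 < r"
  shows "digraph_iso (sector_digraph \<alpha> A (\<lambda>i. c + r *\<^sub>R x i) y r) T \<longleftrightarrow>
    digraph_iso (sector_digraph \<alpha> A x y 1) T"
proof -
  have "inj_on (\<lambda>i. c + r *\<^sub>R x i) A \<longleftrightarrow> inj_on x A"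
    using assms(4) by (auto simp: inj_on_def)
  then show ?thesis
    by (simp add: digraph_iso_sector_digraph_iff assms sector_affine)
qed

lemma digraph_iso_sector_digraph_cong:
  assumes "\<And>i. i \<in> A \<Longrightarrow> x i = x' i" "\<And>i. i \<in> A \<Longrightarrow> y i = y' i"
  shows "digraph_iso (sector_digraph \<alpha> A x y r) T \<longleftrightarrow> digraph_iso (sector_digraph \<alpha> A x' y' r) T"
proof -
  have "sector_digraph \<alpha> A x y r = sector_digraph \<alpha> A x' y' r"
  proof -
    have "(\<exists>i j. p = (x i, x j) \<and> i \<in> A \<and> j \<in> A \<and> i \<noteq> j \<and> x j \<in> sector \<alpha> (x i) (y i) r) \<longleftrightarrow>
      (\<exists>i j. p = (x' i, x' j) \<and> i \<in> A \<and> j \<in> A \<and> i \<noteq> j \<and> x' j \<in> sector \<alpha> (x' i) (y' i) r)" for p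
      by (intro ex_cong1) (auto simp: assms)
    moreover have "x ` A = x' ` A" using assms(1) by (rule image_cong[OF refl])
    ultimately show ?thesis unfolding sector_digraph_def by simp
  qed
  then show ?thesis by simp
qed

text \<open>Moves the copy event of an arbitrary index set to \<open>{..<k}\<close>, so that one
  integral formula serves all sets of size \<open>k\<close>.\<close>

lemma sector_digraph_reindex:
  assumes "inj_on \<pi> A"
  shows "sector_digraph \<alpha> (\<pi> ` A) x y r = sector_digraph \<alpha> A (\<lambda>i. x (\<pi> i)) (\<lambda>i. y (\<pi> i)) r"
proof -
  have "(\<exists>i j. p = (x i, x j) \<and> i \<in> \<pi> ` A \<and> j \<in> \<pi> ` A \<and> i \<noteq> j \<and> x j \<in> sector \<alpha> (x i) (y i) r) \<longleftrightarrow>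
    (\<exists>i j. p = (x (\<pi> i), x (\<pi> j)) \<and> i \<in> A \<and> j \<in> A \<and> i \<noteq> j \<and>
      x (\<pi> j) \<in> sector \<alpha> (x (\<pi> i)) (y (\<pi> i)) r)" for p
  proof (rule iffI; elim exE conjE)
    fix i j assume "p = (x i, x j)" "i \<in> \<pi> ` A" "j \<in> \<pi> ` A" "i \<noteq> j" "x j \<in> sector \<alpha> (x i) (y i) r"
    then show "\<exists>i j. p = (x (\<pi> i), x (\<pi> j)) \<and> i \<in> A \<and> j \<in> A \<and> i \<noteq> j \<and>
        x (\<pi> j) \<in> sector \<alpha> (x (\<pi> i)) (y (\<pi> i)) r" by blast
  next
    fix i j assume "p = (x (\<pi> i), x (\<pi> j))" "i \<in> A" "j \<in> A" "i \<noteq> j"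
      "x (\<pi> j) \<in> sector \<alpha> (x (\<pi> i)) (y (\<pi> i)) r"
    then show "\<exists>i j. p = (x i, x j) \<and> i \<in> \<pi> ` A \<and> j \<in> \<pi> ` A \<and> i \<noteq> j \<and> x j \<in> sector \<alpha> (x i) (y i) r"
      using inj_onD[OF assms, of i j] by (intro exI[of _ "\<pi> i"] exI[of _ "\<pi> j"]) auto
  qed
  then show ?thesis unfolding sector_digraph_def by (simp add: image_image)
qed

text \<open>Each arc joins points at distance at most \<open>r\<close>, and any two vertices are
  joined by an undirected walk whose length is bounded in terms of \<open>T\<close> alone. Hence one
  \<open>D\<close> serves all index sets, points, angles and radii.\<close>

lemma digraph_iso_sector_digraph_dist:
  assumes T: "digraph T" "Digraph_Component.connected T"
  obtains D :: real where "1 \<le> D" "\<And>\<alpha> A x y r a b. finite A \<Longrightarrow> card A = card (verts T) \<Longrightarrow> 0 \<le> r \<Longrightarrow>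
    digraph_iso (sector_digraph \<alpha> A x y r) T \<Longrightarrow> a \<in> A \<Longrightarrow> b \<in> A \<Longrightarrow> dist (x a) (x b) \<le> D * r"
proof -
  interpret T: digraph T by fact
  define R where "R = arcs_ends T \<union> (arcs_ends T)\<inverse>"
  have "finite R" by (simp add: R_def arcs_ends_conv)
  have R: "(u, v) \<in> R\<^sup>*" if "u \<in> verts T" "v \<in> verts T" for u v
  proof -
    have "(u, v) \<in> rtrancl_on (verts T) (arcs_ends (with_proj (mk_symmetric T)))"
      using T(2) that
      unfolding Digraph_Component.connected_def strongly_connected_def reachable_def by auto
    then have "(u, v) \<in> rtrancl_on (verts T) R"
      by (rule rtrancl_on_mono[rotated -1]) (auto simp: R_def parcs_mk_symmetric arcs_ends_conv)
    then show ?thesis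
      by (induct rule: rtrancl_on_induct) (auto intro: rtrancl_into_rtrancl)
  qed
  have "dist (x a) (x b) \<le> (1 + real (card R)) * r"
    if A: "finite A" "card A = card (verts T)" "0 \<le> r"
      "digraph_iso (sector_digraph \<alpha> A x y r) T" "a \<in> A" "b \<in> A" for \<alpha> A x y r a b
  proof -
    obtain s where bij: "bij_betw s A (verts T)"
      and eq: "\<And>i j. i \<in> A \<Longrightarrow> j \<in> A \<Longrightarrow> i \<noteq> j \<Longrightarrow>
        x j \<in> sector \<alpha> (x i) (y i) r \<longleftrightarrow> (s i, s j) \<in> arcs_ends T"
      using A(4) unfolding digraph_iso_sector_digraph_iff[OF T(1) A(1,2)] by blast
    have step: "dist (x i) (x j) \<le> r" if ij: "i \<in> A" "j \<in> A" "(s i, s j) \<in> R" for i j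
    proof -
      have "i \<noteq> j"
      proof
        assume "i = j"
        then have "(s i, s i) \<in> arcs_ends T" using that by (auto simp: R_def)
        then obtain e where e: "e \<in> arcs T" "(s i, s i) = (tail T e, head T e)"
          unfolding arcs_ends_conv by blast
        then show False using T.no_loops[OF e(1)] by (metis prod.inject)
      qed
      consider "(s i, s j) \<in> arcs_ends T" | "(s j, s i) \<in> arcs_ends T"
        using ij(3) unfolding R_def by blast
      then show ?thesis
      proof cases
        case 1
        then show ?thesis using eq[of i j] ij \<open>i \<noteq> j\<close> sector_dist by blast
      next
        case 2
        then have "x i \<in> sector \<alpha> (x j) (y j) r" using eq[of j i] ij \<open>i \<noteq> j\<close> by blast
        then show ?thesis using sector_dist by (subst dist_commute) blast
      qed
    qed
    \<comment> \<open>Induction on the length of a walk in the symmetrised arc relation; bijectivity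
      of \<open>s\<close> turns each visited vertex back into a unique index.\<close>
    have rel: "\<forall>j\<in>A. s j = v \<longrightarrow> dist (x a) (x j) \<le> real n * r"
      if "(s a, v) \<in> R ^^ n" for n v
      using that
    proof (induct n arbitrary: v)
      case 0
      then have "j = a" if "j \<in> A" "s j = v" for j
        using that bij A(5) by (auto simp: bij_betw_def inj_on_def)
      then show ?case by auto
    next
      case (Suc n)
      obtain w where w: "(s a, w) \<in> R ^^ n" "(w, v) \<in> R"
        using Suc(2) by (rule relpow_Suc_E)
      have wV: "w \<in> verts T" using w(2) by (auto simp: R_def arcs_ends_conv)
      obtain i where i: "i \<in> A" "s i = w"
        using wV bij_betw_imp_surj_on[OF bij] by (metis imageE)
      have "dist (x a) (x i) \<le> real n * r" using Suc(1)[OF w(1)] i by auto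
      then show ?case
      proof (intro ballI impI)
        fix j assume j: "j \<in> A" "s j = v"
        then have "dist (x i) (x j) \<le> r" using step[OF i(1) j(1)] i w by simp
        then show "dist (x a) (x j) \<le> real (Suc n) * r"
          using \<open>dist (x a) (x i) \<le> real n * r\<close> dist_triangle[of "x a" "x j" "x i"]
          by (simp add: algebra_simps)
      qed
    qed
    have "s a \<in> verts T" "s b \<in> verts T"
      using bij_betwE[OF bij] A(5,6) by blast+
    then obtain n where n: "n \<le> card R" "(s a, s b) \<in> R ^^ n"
      using R[of "s a" "s b"] unfolding rtrancl_finite_eq_relpow[OF \<open>finite R\<close>] by blast
    then have "dist (x a) (x b) \<le> real n * r"
      using rel[OF n(2)] A(6) by blast
    also have "\<dots> \<le> (1 + real (card R)) * r" using n A(3) by (intro mult_right_mono) auto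
    finally show ?thesis .
  qed
  \<comment> \<open>A walk needs at most \<open>card R\<close> steps; the additional 1 keeps
    \<open>D\<close> at least 1 even when \<open>R\<close> is empty.\<close>
  then show thesis by (intro that[of "1 + real (card R)"]) simp_all
qed

text \<open>Writing the angle as \<open>y + t\<close> lets the parameters \<open>\<rho>\<close> and
  \<open>t\<close> range over a compact set that does not depend on the point of the graph. The
  defining equation is closed, and projecting along a compact set preserves closedness.\<close>

lemma closed_sector_graph: "closed {(x, y, u). u \<in> sector \<alpha> x y r}"
proof -
  let ?T = "{(p, q). snd (snd q) = fst q + fst p *\<^sub>R vector [cos (fst (snd q) + snd p), sin (fst (snd q) + snd p)]}
    :: ((real \<times> real) \<times> ((real^2) \<times> real \<times> (real^2))) set"
  have vec: "(vector [a, b] :: real^2) = a *\<^sub>R axis 1 1 + b *\<^sub>R axis 2 1" for a b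
    by (simp add: vec_eq_iff forall_2 axis_def)
  have "closed ?T"
    unfolding vec case_prod_beta by (intro closed_Collect_eq continuous_intros)
  then have "closed {q. \<exists>p. p \<in> {0..r} \<times> {0..\<alpha>} \<and> (p, q) \<in> ?T}"
    by (intro closed_compact_projection) (auto intro: compact_Times)
  also have "{q. \<exists>p. p \<in> {0..r} \<times> {0..\<alpha>} \<and> (p, q) \<in> ?T} = {(x, y, u). u \<in> sector \<alpha> x y r}"
  proof (intro set_eqI)
    fix q :: "(real^2) \<times> real \<times> (real^2)"
    obtain x y u where q: "q = (x, y, u)" by (cases q) auto
    have "(\<exists>p. p \<in> {0..r} \<times> {0..\<alpha>} \<and> (p, q) \<in> ?T) \<longleftrightarrow>
      (\<exists>\<rho> t. 0 \<le> \<rho> \<and> \<rho> \<le> r \<and> 0 \<le> t \<and> t \<le> \<alpha> \<and> u = x + \<rho> *\<^sub>R vector [cos (y + t), sin (y + t)])"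
      by (auto simp: q)
    also have "\<dots> \<longleftrightarrow>
      (\<exists>\<rho> \<phi>. u = x + \<rho> *\<^sub>R vector [cos \<phi>, sin \<phi>] \<and> 0 \<le> \<rho> \<and> \<rho> \<le> r \<and> y \<le> \<phi> \<and> \<phi> \<le> y + \<alpha>)"
    proof (rule ex_cong1, rule iffI; elim exE conjE)
      fix \<rho> t assume "0 \<le> \<rho>" "\<rho> \<le> r" "0 \<le> t" "t \<le> \<alpha>" "u = x + \<rho> *\<^sub>R vector [cos (y + t), sin (y + t)]"
      then show "\<exists>\<phi>. u = x + \<rho> *\<^sub>R vector [cos \<phi>, sin \<phi>] \<and> 0 \<le> \<rho> \<and> \<rho> \<le> r \<and> y \<le> \<phi> \<and> \<phi> \<le> y + \<alpha>"
        by (intro exI[of _ "y + t"]) auto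
    next
      fix \<rho> \<phi> assume "u = x + \<rho> *\<^sub>R vector [cos \<phi>, sin \<phi>]" "0 \<le> \<rho>" "\<rho> \<le> r" "y \<le> \<phi>" "\<phi> \<le> y + \<alpha>"
      then show "\<exists>t. 0 \<le> \<rho> \<and> \<rho> \<le> r \<and> 0 \<le> t \<and> t \<le> \<alpha> \<and> u = x + \<rho> *\<^sub>R vector [cos (y + t), sin (y + t)]"
        by (intro exI[of _ "\<phi> - y"]) auto
    qed
    finally show "q \<in> {q. \<exists>p. p \<in> {0..r} \<times> {0..\<alpha>} \<and> (p, q) \<in> ?T} \<longleftrightarrow>
        q \<in> {(x, y, u). u \<in> sector \<alpha> x y r}"
      by (simp add: q sector_def)
  qed
  finally show ?thesis .
qed

text \<open>The event is a Boolean combination, over the finitely many candidate bijections, of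
  coincidences of points and of sector memberships. The latter are preimages of a closed
  set.\<close>

lemma measurable_digraph_iso_sector_digraph:
  assumes T: "digraph T" and A: "finite A" "card A = card (verts T)"
    and x[measurable]: "\<And>i. i \<in> A \<Longrightarrow> (\<lambda>w. x w i) \<in> borel_measurable N"
    and y[measurable]: "\<And>i. i \<in> A \<Longrightarrow> (\<lambda>w. y w i) \<in> borel_measurable N"
  shows "Measurable.pred N (\<lambda>w. digraph_iso (sector_digraph \<alpha> A (x w) (y w) r) T)"
proof -
  interpret T: digraph T by fact
  have [measurable]: "Measurable.pred N (\<lambda>w. x w j \<in> sector \<alpha> (x w i) (y w i) r)"
    if "i \<in> A" "j \<in> A" for i j
  proof -
    have "(\<lambda>w. (x w i, y w i, x w j)) \<in> borel_measurable N"
      using that by (intro borel_measurable_Pair) auto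
    moreover have "{(x, y, u). u \<in> sector \<alpha> x y r} \<in> sets borel"
      using closed_sector_graph by (rule borel_closed)
    ultimately have "Measurable.pred N (\<lambda>w. (x w i, y w i, x w j) \<in> {(x, y, u). u \<in> sector \<alpha> x y r})"
      by measurable
    then show ?thesis by simp
  qed
  have fin: "finite (A \<rightarrow>\<^sub>E verts T)" using A by (intro finite_PiE) auto
  have [measurable]: "Measurable.pred N (\<lambda>w. x w i = x w j)" if "i \<in> A" "j \<in> A" for i j
    using x[OF that(1)] x[OF that(2)] by simp
  show ?thesis
    unfolding digraph_iso_sector_digraph_iff[OF T A] inj_on_def
    using A(1) fin by measurable
qed

section \<open>The fourth central moment of a local statistic\<close>

lemma binomial_le_power: "n choose k \<le> n ^ k"
  by (cases "k \<le> n") (auto simp: binomial_le_pow binomial_eq_0)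

lemma sum_power_card_subsets_le:
  fixes q :: real
  assumes "0 \<le> q"
  shows "(\<Sum>B | B \<subseteq> {..<n} \<and> card B < k. q ^ card B) \<le> (\<Sum>j<k. (real n * q) ^ j)"
proof -
  let ?S = "\<lambda>j. {B. B \<subseteq> {..<n} \<and> card B = j}"
  have "(\<Sum>B | B \<subseteq> {..<n} \<and> card B < k. q ^ card B) = (\<Sum>B\<in>(\<Union>j<k. ?S j). q ^ card B)"
    by (rule sum.cong) auto
  also have "\<dots> = (\<Sum>j<k. \<Sum>B\<in>?S j. q ^ card B)"
    by (rule sum.UNION_disjoint) auto
  also have "\<dots> = (\<Sum>j<k. real (n choose j) * q ^ j)"
  proof (rule sum.cong[OF refl])
    fix j
    have "(\<Sum>B\<in>?S j. q ^ card B) = (\<Sum>B\<in>?S j. q ^ j)" by (rule sum.cong) auto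
    then show "(\<Sum>B\<in>?S j. q ^ card B) = real (n choose j) * q ^ j"
      using n_subsets[of "{..<n}" j] by simp
  qed
  also have "\<dots> \<le> (\<Sum>j<k. (real n * q) ^ j)"
  proof (rule sum_mono)
    fix j
    have "real (n choose j) \<le> real n ^ j"
      using binomial_le_power[of n j] by (metis of_nat_le_iff of_nat_power)
    then show "real (n choose j) * q ^ j \<le> (real n * q) ^ j"
      using assms by (simp add: power_mult_distrib mult_right_mono)
  qed
  finally show ?thesis .
qed

text \<open>A set is determined by its part inside \<open>U\<close>, for which there are at most
  \<open>2 ^ card U\<close> choices, and its part outside, which has fewer than \<open>k\<close>
  elements because the set meets \<open>U\<close>.\<close>

lemma sum_power_card_diff_le:
  fixes q :: real
  assumes q: "0 \<le> q" and U: "finite U"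
  shows "(\<Sum>A | A \<subseteq> {..<n} \<and> card A = k \<and> A \<inter> U \<noteq> {}. q ^ card (A - U))
    \<le> 2 ^ card U * (\<Sum>j<k. (real n * q) ^ j)"
proof -
  let ?S = "{A. A \<subseteq> {..<n} \<and> card A = k \<and> A \<inter> U \<noteq> {}}"
  let ?B = "{B. B \<subseteq> {..<n} \<and> card B < k}"
  let ?s = "\<lambda>A. (A \<inter> U, A - U)"
  have fin: "finite ?B" by simp
  have sub: "?s ` ?S \<subseteq> Pow U \<times> ?B"
  proof safe
    fix A x assume A: "A \<subseteq> {..<n}" "k = card A" "x \<in> A" "x \<in> U"
    then have "finite A" by (meson finite_lessThan finite_subset)
    then show "card (A - U) < card A" using A by (intro psubset_card_mono) auto
  qed auto
  have inj: "inj_on ?s ?S" by (rule inj_onI) (metis Int_Diff_Un prod.inject)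
  have "(\<Sum>A\<in>?S. q ^ card (A - U)) = (\<Sum>p\<in>?s ` ?S. q ^ card (snd p))"
    using inj by (subst sum.reindex) auto
  also have "\<dots> \<le> (\<Sum>p\<in>Pow U \<times> ?B. q ^ card (snd p))"
    using sub U fin q by (intro sum_mono2) auto
  also have "\<dots> = 2 ^ card U * (\<Sum>B\<in>?B. q ^ card B)"
    using U by (simp add: sum.cartesian_product' card_Pow)
  also have "\<dots> \<le> 2 ^ card U * (\<Sum>j<k. (real n * q) ^ j)"
    using sum_power_card_subsets_le[OF q] by (intro mult_left_mono) auto
  finally show ?thesis .
qed

text \<open>Lets the sums of \<open>chain\<close> and \<open>pairs\<close> over the various orders
  of the last three sets be identified with one another.\<close>

lemma sum_swap3:
  fixes u :: "'c \<Rightarrow> 'c \<Rightarrow> 'c \<Rightarrow> real"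
  shows "(\<Sum>B\<in>X. \<Sum>C\<in>X. \<Sum>D\<in>X. u B D C) = (\<Sum>B\<in>X. \<Sum>C\<in>X. \<Sum>D\<in>X. u B C D)"
    "(\<Sum>B\<in>X. \<Sum>C\<in>X. \<Sum>D\<in>X. u C B D) = (\<Sum>B\<in>X. \<Sum>C\<in>X. \<Sum>D\<in>X. u B C D)"
    "(\<Sum>B\<in>X. \<Sum>C\<in>X. \<Sum>D\<in>X. u C D B) = (\<Sum>B\<in>X. \<Sum>C\<in>X. \<Sum>D\<in>X. u B C D)"
    "(\<Sum>B\<in>X. \<Sum>C\<in>X. \<Sum>D\<in>X. u D B C) = (\<Sum>B\<in>X. \<Sum>C\<in>X. \<Sum>D\<in>X. u B C D)"
    "(\<Sum>B\<in>X. \<Sum>C\<in>X. \<Sum>D\<in>X. u D C B) = (\<Sum>B\<in>X. \<Sum>C\<in>X. \<Sum>D\<in>X. u B C D)"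
proof -
  have 1: "(\<Sum>B\<in>X. \<Sum>C\<in>X. \<Sum>D\<in>X. u B D C) = (\<Sum>B\<in>X. \<Sum>C\<in>X. \<Sum>D\<in>X. u B C D)" for u :: "'c \<Rightarrow> 'c \<Rightarrow> 'c \<Rightarrow> real"
    by (rule sum.cong[OF refl], rule sum.swap)
  have 2: "(\<Sum>B\<in>X. \<Sum>C\<in>X. \<Sum>D\<in>X. u C B D) = (\<Sum>B\<in>X. \<Sum>C\<in>X. \<Sum>D\<in>X. u B C D)" for u :: "'c \<Rightarrow> 'c \<Rightarrow> 'c \<Rightarrow> real"
    by (rule sum.swap)
  show "(\<Sum>B\<in>X. \<Sum>C\<in>X. \<Sum>D\<in>X. u B D C) = (\<Sum>B\<in>X. \<Sum>C\<in>X. \<Sum>D\<in>X. u B C D)" by (rule 1)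
  show "(\<Sum>B\<in>X. \<Sum>C\<in>X. \<Sum>D\<in>X. u C B D) = (\<Sum>B\<in>X. \<Sum>C\<in>X. \<Sum>D\<in>X. u B C D)" by (rule 2)
  show "(\<Sum>B\<in>X. \<Sum>C\<in>X. \<Sum>D\<in>X. u C D B) = (\<Sum>B\<in>X. \<Sum>C\<in>X. \<Sum>D\<in>X. u B C D)"
    using 2[of "\<lambda>B C D. u B D C"] 1[of u] by simp
  show "(\<Sum>B\<in>X. \<Sum>C\<in>X. \<Sum>D\<in>X. u D B C) = (\<Sum>B\<in>X. \<Sum>C\<in>X. \<Sum>D\<in>X. u B C D)"
    using 1[of "\<lambda>B C D. u C B D"] 2[of u] by simp
  show "(\<Sum>B\<in>X. \<Sum>C\<in>X. \<Sum>D\<in>X. u D C B) = (\<Sum>B\<in>X. \<Sum>C\<in>X. \<Sum>D\<in>X. u B C D)"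
    using 1[of "\<lambda>B C D. u C D B"] 2[of "\<lambda>B C D. u B D C"] 1[of u] by simp
qed

text \<open>In the application \<open>Z i\<close> is a point with its angle, \<open>h A\<close>
  indicates a copy on the indices \<open>A\<close>, and \<open>E\<close> means distance at most
  \<open>D * r\<close>. \<open>E_prob\<close> is uniform in the fixed point \<open>u\<close>, so it
  survives conditioning on any other part of the sample.\<close>

locale local_statistic = prob_space M for M :: "'w measure" +
  fixes N :: "'z measure" and Z :: "nat \<Rightarrow> 'w \<Rightarrow> 'z"
    and h :: "nat set \<Rightarrow> (nat \<Rightarrow> 'z) \<Rightarrow> real" and E :: "'z \<Rightarrow> 'z \<Rightarrow> bool"
    and k :: nat and p q :: real
  assumes indep: "indep_vars (\<lambda>_. N) Z UNIV"
    and E_measurable: "Measurable.pred (N \<Otimes>\<^sub>M N) (\<lambda>(u, v). E u v)"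
    and E_prob: "\<And>u b. u \<in> space N \<Longrightarrow> prob {\<omega> \<in> space M. E u (Z b \<omega>)} \<le> q"
    and h_measurable: "\<And>A. finite A \<Longrightarrow> card A = k \<Longrightarrow> h A \<in> borel_measurable (Pi\<^sub>M A (\<lambda>_. N))"
    and h_restrict: "\<And>A z. finite A \<Longrightarrow> card A = k \<Longrightarrow> h A (restrict z A) = h A z"
    and h_nonneg: "\<And>A z. 0 \<le> h A z" and h_le_1: "\<And>A z. h A z \<le> 1"
    and h_local: "\<And>A z a b. finite A \<Longrightarrow> card A = k \<Longrightarrow> h A z \<noteq> 0 \<Longrightarrow> a \<in> A \<Longrightarrow> b \<in> A \<Longrightarrow>
      a \<noteq> b \<Longrightarrow> E (z a) (z b)"
    and h_mean: "\<And>A. finite A \<Longrightarrow> card A = k \<Longrightarrow> expectation (\<lambda>\<omega>. h A (\<lambda>i. Z i \<omega>)) = p"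
    and q_nonneg: "0 \<le> q" and q_le_1: "q \<le> 1" and k_pos: "1 \<le> k"
begin

text \<open>The bounded measurable functions of finitely many coordinates. They are kept as
  functions of the whole sequence, so that products with different coordinate sets need no
  restriction maps.\<close>

definition local_fun :: "nat set \<Rightarrow> ((nat \<Rightarrow> 'z) \<Rightarrow> real) \<Rightarrow> bool" where
  "local_fun U F \<longleftrightarrow> finite U \<and> F \<in> borel_measurable (Pi\<^sub>M U (\<lambda>_. N)) \<and>
    (\<forall>z. F (restrict z U) = F z) \<and> (\<exists>B. \<forall>z. \<bar>F z\<bar> \<le> B)"

definition mean :: "((nat \<Rightarrow> 'z) \<Rightarrow> real) \<Rightarrow> real" where
  "mean F = expectation (\<lambda>\<omega>. F (\<lambda>i. Z i \<omega>))"

lemma Z_measurable[measurable]: "Z i \<in> measurable M N"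
  using indep by (auto simp: indep_vars_def)

lemma local_funD:
  assumes "local_fun U F"
  shows "finite U" "F \<in> borel_measurable (Pi\<^sub>M U (\<lambda>_. N))" "\<And>z. F (restrict z U) = F z"
  using assms by (auto simp: local_fun_def)

lemma local_fun_measurable:
  assumes "local_fun U F"
  shows "(\<lambda>\<omega>. F (\<lambda>i. Z i \<omega>)) \<in> borel_measurable M"
proof -
  note [measurable] = local_funD(2)[OF assms]
  have "(\<lambda>\<omega>. F (restrict (\<lambda>i. Z i \<omega>) U)) \<in> borel_measurable M" by measurable
  then show ?thesis by (simp only: local_funD(3)[OF assms])
qed

lemma local_fun_integrable:
  assumes "local_fun U F"
  shows "integrable M (\<lambda>\<omega>. F (\<lambda>i. Z i \<omega>))"
proof -
  obtain B where "\<And>z. \<bar>F z\<bar> \<le> B" using assms by (auto simp: local_fun_def)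
  then show ?thesis
    using local_fun_measurable[OF assms] by (intro integrable_const_bound[of _ B]) auto
qed

lemma local_fun_mono:
  assumes F: "local_fun U F" and "U \<subseteq> V" "finite V"
  shows "local_fun V F"
proof -
  have "(\<lambda>z. F (restrict z U)) \<in> borel_measurable (Pi\<^sub>M V (\<lambda>_. N))"
    using F assms(2) by (intro measurable_compose[OF measurable_restrict_subset[of U V]])
      (auto simp: local_fun_def)
  then have "F \<in> borel_measurable (Pi\<^sub>M V (\<lambda>_. N))" by (simp only: local_funD(3)[OF F])
  moreover have "F (restrict z V) = F z" for z
  proof -
    have "restrict (restrict z V) U = restrict z U"
      using assms(2) by (simp add: restrict_restrict Int_absorb1)
    then show ?thesis using local_funD(3)[OF F] by metis
  qed
  ultimately show ?thesis using F assms(3) unfolding local_fun_def by blast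
qed

lemma local_fun_mult:
  assumes "local_fun U F" "local_fun V G"
  shows "local_fun (U \<union> V) (\<lambda>z. F z * G z)"
proof -
  have FG: "local_fun (U \<union> V) F" "local_fun (U \<union> V) G"
    using local_funD(1)[OF assms(1)] local_funD(1)[OF assms(2)]
    by (auto intro: local_fun_mono[OF assms(1)] local_fun_mono[OF assms(2)])
  obtain B C where "\<And>z. \<bar>F z\<bar> \<le> B" "\<And>z. \<bar>G z\<bar> \<le> C" using assms by (auto simp: local_fun_def)
  then have "\<bar>F z * G z\<bar> \<le> B * C" for z
    unfolding abs_mult by (meson abs_ge_zero mult_mono order_trans)
  moreover have "(\<lambda>z. F z * G z) \<in> borel_measurable (Pi\<^sub>M (U \<union> V) (\<lambda>_. N))"
    using FG[THEN local_funD(2)] by (rule borel_measurable_times)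
  ultimately show ?thesis
    unfolding local_fun_def using FG[THEN local_funD(3)] local_funD(1)[OF FG(1)] by auto
qed

lemma local_fun_h: "finite A \<Longrightarrow> card A = k \<Longrightarrow> local_fun A (h A)"
  using h_measurable[of A] h_restrict[of A] h_nonneg[of A] h_le_1[of A]
  unfolding local_fun_def by (intro conjI allI exI[of _ 1]) simp_all

lemma local_fun_h_add: "finite A \<Longrightarrow> card A = k \<Longrightarrow> local_fun A (\<lambda>z. h A z + c)"
proof -
  assume A: "finite A" "card A = k"
  have "\<bar>h A z + c\<bar> \<le> 1 + \<bar>c\<bar>" for z
    using h_nonneg[of A z] h_le_1[of A z] by linarith
  then show ?thesis
    unfolding local_fun_def using A h_measurable[OF A] h_restrict[OF A]
    by (intro conjI allI exI[of _ "1 + \<bar>c\<bar>"]) simp_all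
qed

text \<open>Functions of disjoint blocks of an independent family are independent, and their
  boundedness makes the expectation multiplicative.\<close>

lemma mean_mult_disjoint:
  assumes F: "local_fun U F" and G: "local_fun V G" and UV: "U \<inter> V = {}"
  shows "mean (\<lambda>z. F z * G z) = mean F * mean G"
proof -
  have FG: "F \<in> borel_measurable (Pi\<^sub>M U (\<lambda>_. N))" "G \<in> borel_measurable (Pi\<^sub>M V (\<lambda>_. N))"
    using F G by (auto simp: local_fun_def)
  have "indep_var borel (F \<circ> (\<lambda>\<omega>. restrict (\<lambda>i. Z i \<omega>) U)) borel (G \<circ> (\<lambda>\<omega>. restrict (\<lambda>i. Z i \<omega>) V))"
    by (rule indep_var_compose[OF indep_var_restrict[OF indep UV] FG]) auto
  then have "indep_var borel (\<lambda>\<omega>. F (\<lambda>i. Z i \<omega>)) borel (\<lambda>\<omega>. G (\<lambda>i. Z i \<omega>))"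
    by (simp only: o_def local_funD(3)[OF F] local_funD(3)[OF G])
  then show ?thesis
    unfolding mean_def
    by (rule indep_var_lebesgue_integral) (use F G local_fun_integrable in auto)
qed

text \<open>Fubini with the coordinate \<open>b\<close> integrated first: the sample at
  \<open>b\<close> is independent of the coordinates in \<open>U\<close>, and given those it is
  related to the one at \<open>a\<close> with probability at most \<open>q\<close>.\<close>

lemma mean_mult_E_le:
  assumes F: "local_fun U F" and F0: "\<And>z. 0 \<le> F z" and a: "a \<in> U" and b: "b \<notin> U"
  shows "mean (\<lambda>z. F z * of_bool (E (z a) (z b))) \<le> q * mean F"
proof -
  let ?U = "Pi\<^sub>M U (\<lambda>_. N)" and ?B = "Pi\<^sub>M {b} (\<lambda>_. N)"
  let ?ZU = "\<lambda>\<omega>. restrict (\<lambda>i. Z i \<omega>) U" and ?ZB = "\<lambda>\<omega>. restrict (\<lambda>i. Z i \<omega>) {b}"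
  note [measurable] = E_measurable
  have [measurable]: "F \<in> borel_measurable ?U" using F by (simp add: local_fun_def)
  let ?H = "\<lambda>(z, w). ennreal (F z * of_bool (E (z a) (w b)))"
  have E_ab: "Measurable.pred (?U \<Otimes>\<^sub>M ?B) (\<lambda>p. E (fst p a) (snd p b))"
  proof -
    have "(\<lambda>p. (fst p a, snd p b)) \<in> measurable (?U \<Otimes>\<^sub>M ?B) (N \<Otimes>\<^sub>M N)"
      using a by measurable
    from measurable_compose[OF this E_measurable] show ?thesis by simp
  qed
  have H[measurable]: "?H \<in> borel_measurable (?U \<Otimes>\<^sub>M ?B)"
    using E_ab unfolding case_prod_beta by measurable
  have ind: "indep_var ?U ?ZU ?B ?ZB"
    by (rule indep_var_restrict[OF indep]) (use b in auto)
  have rv: "?ZU \<in> measurable M ?U" "?ZB \<in> measurable M ?B" by measurable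
  interpret B: prob_space "distr M ?B ?ZB" by (rule prob_space_distr) (rule rv)
  have Eb: "emeasure M {\<omega> \<in> space M. E u (Z b \<omega>)} \<le> ennreal q" if "u \<in> space N" for u
    using E_prob[OF that, of b] by (simp add: emeasure_eq_measure ennreal_leI)
  have "ennreal (mean (\<lambda>z. F z * of_bool (E (z a) (z b)))) =
      (\<integral>\<^sup>+\<omega>. ennreal (F (\<lambda>i. Z i \<omega>) * of_bool (E (Z a \<omega>) (Z b \<omega>))) \<partial>M)"
  proof -
    obtain C where C: "\<And>z. \<bar>F z\<bar> \<le> C" using F by (auto simp: local_fun_def)
    have [measurable]: "Measurable.pred M (\<lambda>\<omega>. E (Z a \<omega>) (Z b \<omega>))"
      using measurable_compose[OF measurable_Pair[OF Z_measurable[of a] Z_measurable[of b]] E_measurable]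
      by simp
    note [measurable] = local_fun_measurable[OF F]
    have "integrable M (\<lambda>\<omega>. F (\<lambda>i. Z i \<omega>) * of_bool (E (Z a \<omega>) (Z b \<omega>)))"
      by (rule integrable_const_bound[of _ C]) (use C F0 order_trans[OF abs_ge_zero C] in auto)
    then show ?thesis
      unfolding mean_def by (subst nn_integral_eq_integral) (auto simp: F0)
  qed
  also have "\<dots> = (\<integral>\<^sup>+\<omega>. ?H (?ZU \<omega>, ?ZB \<omega>) \<partial>M)"
    using a by (simp add: local_funD(3)[OF F])
  also have "\<dots> = (\<integral>\<^sup>+p. ?H p \<partial>distr M (?U \<Otimes>\<^sub>M ?B) (\<lambda>\<omega>. (?ZU \<omega>, ?ZB \<omega>)))"
    by (subst nn_integral_distr) (use rv in auto)
  \<comment> \<open>Independence enters here: as \<open>b\<close> lies outside \<open>U\<close>, the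
    joint law of the two blocks is a product.\<close>
  also have "distr M (?U \<Otimes>\<^sub>M ?B) (\<lambda>\<omega>. (?ZU \<omega>, ?ZB \<omega>)) = distr M ?U ?ZU \<Otimes>\<^sub>M distr M ?B ?ZB"
    using ind by (simp add: indep_var_distribution_eq)
  also have "(\<integral>\<^sup>+p. ?H p \<partial>(distr M ?U ?ZU \<Otimes>\<^sub>M distr M ?B ?ZB)) =
      (\<integral>\<^sup>+z. \<integral>\<^sup>+w. ?H (z, w) \<partial>distr M ?B ?ZB \<partial>distr M ?U ?ZU)"
    by (rule B.nn_integral_fst[symmetric]) simp
  also have "\<dots> \<le> (\<integral>\<^sup>+z. ennreal q * ennreal (F z) \<partial>distr M ?U ?ZU)"
  proof (rule nn_integral_mono)
    fix z assume "z \<in> space (distr M ?U ?ZU)"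
    then have z: "z \<in> space ?U" by simp
    then have za: "z a \<in> space N" using a by (auto simp: space_PiM)
    have [measurable]: "Measurable.pred N (E (z a))"
      using measurable_compose[OF measurable_Pair1'[OF za] E_measurable] by simp
    have "(\<integral>\<^sup>+w. ?H (z, w) \<partial>distr M ?B ?ZB) = (\<integral>\<^sup>+\<omega>. ?H (z, ?ZB \<omega>) \<partial>M)"
      by (rule nn_integral_distr) (use rv z in \<open>auto intro: measurable_compose[OF measurable_Pair1' H]\<close>)
    also have "\<dots> = (\<integral>\<^sup>+\<omega>. ennreal (F z) * indicator {\<omega> \<in> space M. E (z a) (Z b \<omega>)} \<omega> \<partial>M)"
      by (rule nn_integral_cong) (auto simp: indicator_def)
    also have "\<dots> = ennreal (F z) * emeasure M {\<omega> \<in> space M. E (z a) (Z b \<omega>)}"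
      by (rule nn_integral_cmult_indicator) measurable
    also have "\<dots> \<le> ennreal q * ennreal (F z)"
      using Eb[OF za] by (subst mult.commute) (rule mult_right_mono, auto)
    finally show "(\<integral>\<^sup>+w. ?H (z, w) \<partial>distr M ?B ?ZB) \<le> ennreal q * ennreal (F z)" .
  qed
  also have "\<dots> = ennreal q * (\<integral>\<^sup>+\<omega>. ennreal (F (?ZU \<omega>)) \<partial>M)"
    by (subst nn_integral_cmult) (simp_all add: nn_integral_distr rv)
  also have "(\<integral>\<^sup>+\<omega>. ennreal (F (?ZU \<omega>)) \<partial>M) = ennreal (mean F)"
    using F0 local_fun_integrable[OF F]
    by (simp add: local_funD(3)[OF F] mean_def nn_integral_eq_integral)
  also have "ennreal q * ennreal (mean F) = ennreal (q * mean F)"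
    using q_nonneg by (simp add: ennreal_mult')
  finally show ?thesis
    using q_nonneg F0 by (subst (asm) ennreal_le_iff) (auto simp: mean_def)
qed

lemma local_fun_E: 
  assumes "finite U" "a \<in> U" "b \<in> U"
  shows "local_fun U (\<lambda>z. of_bool (E (z a) (z b)))"
proof -
  have "(\<lambda>z. (z a, z b)) \<in> measurable (Pi\<^sub>M U (\<lambda>_. N)) (N \<Otimes>\<^sub>M N)"
    using assms by measurable
  from measurable_compose[OF this E_measurable]
  have "Measurable.pred (Pi\<^sub>M U (\<lambda>_. N)) (\<lambda>z. E (z a) (z b))" by simp
  then have "(\<lambda>z. of_bool (E (z a) (z b)) :: real) \<in> borel_measurable (Pi\<^sub>M U (\<lambda>_. N))"
    by measurable
  then show ?thesis using assms by (auto simp: local_fun_def intro!: exI[of _ 1])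
qed

lemma mean_nonneg: "(\<And>z. 0 \<le> F z) \<Longrightarrow> 0 \<le> mean F"
  unfolding mean_def by simp

lemma mean_mono:
  assumes "local_fun U F" "local_fun V G" "\<And>z. F z \<le> G z"
  shows "mean F \<le> mean G"
  unfolding mean_def using assms by (intro integral_mono local_fun_integrable) auto

text \<open>All new coordinates are compared with the same anchor \<open>a\<close>, which forms a
  star, so each one can be integrated out separately at the price \<open>q\<close>. Locality is
  proved alongside because the next induction step needs it for the partial product.\<close>

lemma mean_mult_prod_E_le:
  assumes F: "local_fun U F" and F0: "\<And>z. 0 \<le> F z" and a: "a \<in> U"
    and B: "finite B" "B \<inter> U = {}"
  shows "local_fun (U \<union> B) (\<lambda>z. F z * (\<Prod>b\<in>B. of_bool (E (z a) (z b)))) \<and>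
    mean (\<lambda>z. F z * (\<Prod>b\<in>B. of_bool (E (z a) (z b)))) \<le> q ^ card B * mean F"
  using B
proof (induction B)
  case empty
  then show ?case using F by simp
next
  case (insert b B)
  let ?G = "\<lambda>z. F z * (\<Prod>b\<in>B. of_bool (E (z a) (z b)))"
  have IH: "local_fun (U \<union> B) ?G" "mean ?G \<le> q ^ card B * mean F" using insert by auto
  have eq: "(\<lambda>z. F z * (\<Prod>b\<in>insert b B. of_bool (E (z a) (z b)))) =
      (\<lambda>z. ?G z * of_bool (E (z a) (z b)))"
    using insert by (auto simp: fun_eq_iff)
  have fin: "finite (U \<union> insert b B)" using F insert by (auto simp: local_fun_def)
  have "local_fun (U \<union> insert b B) (\<lambda>z. ?G z * of_bool (E (z a) (z b)))"
    using local_fun_mult[OF IH(1) local_fun_E[OF fin, of a b]] a by (simp add: Un_absorb1 subset_insertI2 insert_commute Un_commute Un_left_commute)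
  moreover have "mean (\<lambda>z. ?G z * of_bool (E (z a) (z b))) \<le> q * mean ?G"
    using a insert F0 by (intro mean_mult_E_le[OF IH(1)]) (auto intro!: mult_nonneg_nonneg prod_nonneg)
  moreover have "q * mean ?G \<le> q * (q ^ card B * mean F)"
    using IH(2) q_nonneg by (rule mult_left_mono)
  ultimately show ?case using insert unfolding eq by (simp add: mult.assoc)
qed

text \<open>Take an index common to \<open>A\<close> and \<open>U\<close> as anchor. By
  \<open>h_local\<close> a nonzero \<open>h A\<close> forces every new index to be related to it,
  and \<open>h A\<close> is at most 1, so \<open>h A\<close> is bounded by the star product.\<close>

lemma mean_mult_h_le:
  assumes F: "local_fun U F" and F0: "\<And>z. 0 \<le> F z"
    and A: "finite A" "card A = k" "A \<inter> U \<noteq> {}"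
  shows "mean (\<lambda>z. F z * h A z) \<le> q ^ card (A - U) * mean F"
proof -
  obtain a where a: "a \<in> A" "a \<in> U" using A by auto
  note * = mean_mult_prod_E_le[OF F F0 a(2), of "A - U"]
  have "mean (\<lambda>z. F z * h A z) \<le> mean (\<lambda>z. F z * (\<Prod>b\<in>A - U. of_bool (E (z a) (z b))))"
  proof (rule mean_mono)
    show "local_fun (U \<union> A) (\<lambda>z. F z * h A z)"
      using F A local_fun_h by (intro local_fun_mult) auto
    show "local_fun (U \<union> (A - U)) (\<lambda>z. F z * (\<Prod>b\<in>A - U. of_bool (E (z a) (z b))))"
      using * A by auto
    fix z
    have "h A z \<le> (\<Prod>b\<in>A - U. of_bool (E (z a) (z b)))"
    proof (cases "h A z = 0")
      case False
      then have "\<And>b. b \<in> A - U \<Longrightarrow> E (z a) (z b)" using h_local[OF A(1,2) False a(1)] a by auto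
      then show ?thesis using h_le_1 by simp
    qed (auto intro: prod_nonneg)
    then show "F z * h A z \<le> F z * (\<Prod>b\<in>A - U. of_bool (E (z a) (z b)))"
      using F0 by (rule mult_left_mono)
  qed
  also have "\<dots> \<le> q ^ card (A - U) * mean F" using * A by auto
  finally show ?thesis .
qed

lemma local_fun_1: "finite U \<Longrightarrow> local_fun U (\<lambda>_. 1)"
  by (auto simp: local_fun_def intro!: exI[of _ 1])

lemma p_nonneg: "0 \<le> p"
proof -
  have "0 \<le> expectation (\<lambda>\<omega>. h {..<k} (\<lambda>i. Z i \<omega>))" by (simp add: h_nonneg)
  then show ?thesis by (simp add: h_mean)
qed

lemma p_le: "p \<le> q ^ (k - 1)"
proof -
  have "0 \<in> {..<k}" using k_pos by auto
  \<comment> \<open>One index of \<open>{..<k}\<close> is treated as already present, with the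
    constant function 1; the other \<open>k - 1\<close> are new.\<close>
  then have "mean (\<lambda>z. 1 * h {..<k} z) \<le> q ^ card ({..<k} - {0}) * mean (\<lambda>_. 1)"
    by (intro mean_mult_h_le[where U = "{0}"] local_fun_1) auto
  moreover have "mean (\<lambda>z. 1 * h {..<k} z) = p" using h_mean[of "{..<k}"] by (simp add: mean_def)
  moreover have "mean (\<lambda>_. 1) = 1" by (simp add: mean_def prob_space)
  moreover have "card ({..<k} - {0}) = k - 1" using \<open>0 \<in> {..<k}\<close> by (simp add: card_Diff_singleton)
  ultimately show ?thesis by simp
qed

text \<open>A nonnegative majorant of the centred indicator. Signed factors could not be peeled off
  one by one with inequalities.\<close>

definition g :: "nat set \<Rightarrow> (nat \<Rightarrow> 'z) \<Rightarrow> real" where "g A z = h A z + p"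

lemma g_nonneg: "0 \<le> g A z"
  unfolding g_def using h_nonneg[of A z] p_nonneg by simp

lemma local_fun_g: "finite A \<Longrightarrow> card A = k \<Longrightarrow> local_fun A (g A)"
  using local_fun_h_add[of A p] by (simp add: g_def[abs_def])

lemma mean_g: "finite A \<Longrightarrow> card A = k \<Longrightarrow> mean (g A) = 2 * p"
  using h_mean[of A] local_fun_integrable[OF local_fun_h, of A]
  by (simp add: mean_def g_def prob_space)

text \<open>The summand \<open>p\<close> costs no more than \<open>h A\<close>: a set that meets
  \<open>U\<close> has at most \<open>k - 1\<close> new indices, and
  \<open>p \<le> q ^ (k - 1)\<close> with \<open>q \<le> 1\<close>. Hence the factor 2.\<close>

lemma mean_mult_g_le:
  assumes F: "local_fun U F" and F0: "\<And>z. 0 \<le> F z"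
    and A: "finite A" "card A = k" "A \<inter> U \<noteq> {}"
  shows "mean (\<lambda>z. F z * g A z) \<le> 2 * q ^ card (A - U) * mean F"
proof -
  have "mean (\<lambda>z. F z * g A z) = mean (\<lambda>z. F z * h A z) + p * mean F"
  proof -
    have "integrable M (\<lambda>\<omega>. F (\<lambda>i. Z i \<omega>) * h A (\<lambda>i. Z i \<omega>))" "integrable M (\<lambda>\<omega>. F (\<lambda>i. Z i \<omega>))"
      using local_fun_integrable[OF F] local_fun_integrable[OF local_fun_mult[OF F local_fun_h[OF A(1,2)]]]
      by auto
    then show ?thesis by (simp add: mean_def g_def distrib_left mult.commute)
  qed
  moreover have "mean (\<lambda>z. F z * h A z) \<le> q ^ card (A - U) * mean F"
    by (rule mean_mult_h_le[OF assms])
  moreover have "p * mean F \<le> q ^ card (A - U) * mean F"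
  proof (rule mult_right_mono)
    have "card (A - U) < k" using A by (metis Diff_disjoint Diff_subset Int_commute inf.absorb_iff2 psubsetI psubset_card_mono)
    then have "q ^ (k - 1) \<le> q ^ card (A - U)"
      using q_nonneg q_le_1 by (intro power_decreasing) auto
    then show "p \<le> q ^ card (A - U)" using p_le by simp
  qed (rule mean_nonneg[OF F0])
  ultimately show ?thesis by (simp add: algebra_simps)
qed

text \<open>\<open>S n\<close> dominates the expected number of copies, \<open>L n\<close> the conditional expectation of the number of
  copies that meet a given set of at most \<open>3 * k\<close> sample points.\<close>

definition K :: "nat \<Rightarrow> nat set set" where "K n = {A. A \<subseteq> {..<n} \<and> card A = k}"

definition L :: "nat \<Rightarrow> real" where "L n = 2 ^ (3 * k + 1) * (\<Sum>j<k. (real n * q) ^ j)"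

definition S :: "nat \<Rightarrow> real" where "S n = 2 * real n ^ k * q ^ (k - 1)"

lemma K_D: "A \<in> K n \<Longrightarrow> finite A \<and> card A = k"
  by (auto simp: K_def intro: finite_subset[OF _ finite_lessThan])

lemma L_nonneg: "0 \<le> L n" unfolding L_def using q_nonneg by (auto intro!: mult_nonneg_nonneg sum_nonneg)

lemma S_nonneg: "0 \<le> S n" unfolding S_def using q_nonneg by auto

text \<open>One link of a chain. The bound on \<open>card U\<close> is what the fourth set of a
  quadruple requires, as it is attached to a union of three sets of size \<open>k\<close>.\<close>

lemma sum_mean_mult_g_le:
  assumes F: "local_fun U F" and F0: "\<And>z. 0 \<le> F z" and U: "card U \<le> 3 * k"
  shows "(\<Sum>A\<in>K n. of_bool (A \<inter> U \<noteq> {}) * mean (\<lambda>z. F z * g A z)) \<le> L n * mean F"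
proof -
  have finU: "finite U" using F by (simp add: local_fun_def)
  have "(\<Sum>A\<in>K n. of_bool (A \<inter> U \<noteq> {}) * mean (\<lambda>z. F z * g A z))
      \<le> (\<Sum>A\<in>K n. of_bool (A \<inter> U \<noteq> {}) * (2 * q ^ card (A - U) * mean F))"
    using K_D mean_mult_g_le[OF F F0] by (intro sum_mono) auto
  also have "\<dots> = 2 * mean F * (\<Sum>A\<in>K n. of_bool (A \<inter> U \<noteq> {}) * q ^ card (A - U))"
    by (simp add: sum_distrib_left mult_ac)
  also have "(\<Sum>A\<in>K n. of_bool (A \<inter> U \<noteq> {}) * q ^ card (A - U)) =
      (\<Sum>A | A \<subseteq> {..<n} \<and> card A = k \<and> A \<inter> U \<noteq> {}. q ^ card (A - U))"
    by (rule sum.mono_neutral_cong_right) (auto simp: K_def)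
  also have "2 * mean F * \<dots> \<le> 2 * mean F * (2 ^ (3 * k) * (\<Sum>j<k. (real n * q) ^ j))"
  proof (rule mult_left_mono)
    \<comment> \<open>The constant \<open>2 ^ (3 * k + 1)\<close> of \<open>L\<close> is this bound
      on the number of subsets of \<open>U\<close>, times the 2 that comes from
      \<open>g\<close>.\<close>
    have "(2::real) ^ card U \<le> 2 ^ (3 * k)" using U by (intro power_increasing) auto
    then have "2 ^ card U * (\<Sum>j<k. (real n * q) ^ j) \<le> 2 ^ (3 * k) * (\<Sum>j<k. (real n * q) ^ j)"
      using q_nonneg by (intro mult_right_mono sum_nonneg) auto
    then show "(\<Sum>A | A \<subseteq> {..<n} \<and> card A = k \<and> A \<inter> U \<noteq> {}. q ^ card (A - U))
        \<le> 2 ^ (3 * k) * (\<Sum>j<k. (real n * q) ^ j)"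
      using sum_power_card_diff_le[OF q_nonneg finU, of n k] by linarith
  qed (use mean_nonneg[OF F0] in simp)
  finally show ?thesis by (simp add: L_def mult_ac)
qed

lemma sum_mean_g_le: "(\<Sum>A\<in>K n. mean (g A)) \<le> S n"
proof -
  have "(\<Sum>A\<in>K n. mean (g A)) = (\<Sum>A\<in>K n. 2 * p)"
    using K_D mean_g by (intro sum.cong) auto
  also have "\<dots> = real (n choose k) * (2 * p)"
    unfolding K_def using n_subsets[of "{..<n}" k] by simp
  also have "\<dots> \<le> real n ^ k * (2 * q ^ (k - 1))"
    using binomial_le_power[of n k] p_nonneg p_le
    by (intro mult_mono) (auto simp flip: of_nat_power)
  finally show ?thesis by (simp add: S_def mult_ac)
qed

section \<open>Expansion of the fourth moment over quadruples of index sets\<close>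

definition \<xi> :: "nat set \<Rightarrow> (nat \<Rightarrow> 'z) \<Rightarrow> real" where "\<xi> A z = h A z - p"

lemma local_fun_\<xi>: "finite A \<Longrightarrow> card A = k \<Longrightarrow> local_fun A (\<xi> A)"
  using local_fun_h_add[of A "- p"] by (simp add: \<xi>_def[abs_def])

lemma abs_\<xi>_le: "\<bar>\<xi> A z\<bar> \<le> g A z"
  unfolding \<xi>_def g_def using h_nonneg[of A z] p_nonneg by linarith

lemma mean_\<xi>: "finite A \<Longrightarrow> card A = k \<Longrightarrow> mean (\<xi> A) = 0"
  using h_mean[of A] local_fun_integrable[OF local_fun_h, of A]
  by (simp add: mean_def \<xi>_def prob_space)

definition g4 :: "nat set \<Rightarrow> nat set \<Rightarrow> nat set \<Rightarrow> nat set \<Rightarrow> real" where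
  "g4 A B C D = mean (\<lambda>z. g A z * g B z * g C z * g D z)"

text \<open>The conditions are nested by the last set they mention, so that the sum over
  \<open>D\<close>, then over \<open>C\<close>, then over \<open>B\<close> can be pulled inside the
  factors that do not depend on it.\<close>

definition chain :: "nat set \<Rightarrow> nat set \<Rightarrow> nat set \<Rightarrow> nat set \<Rightarrow> real" where
  "chain A B C D = of_bool (B \<inter> A \<noteq> {}) * (of_bool (C \<inter> (A \<union> B) \<noteq> {}) *
    (of_bool (D \<inter> (A \<union> B \<union> C) \<noteq> {}) * g4 A B C D))"

text \<open>Disjointness of the two unions is part of the condition because it makes
  \<open>g4\<close> factor by independence.\<close>

definition pairs :: "nat set \<Rightarrow> nat set \<Rightarrow> nat set \<Rightarrow> nat set \<Rightarrow> real" where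
  "pairs A B C D = of_bool (B \<inter> A \<noteq> {}) * (of_bool (D \<inter> C \<noteq> {}) *
    (of_bool ((A \<union> B) \<inter> (C \<union> D) = {}) * g4 A B C D))"

lemma sum_g_pair_le:
  "(\<Sum>A\<in>K n. \<Sum>B\<in>K n. of_bool (B \<inter> A \<noteq> {}) * mean (\<lambda>z. g A z * g B z)) \<le> S n * L n"
proof -
  have "(\<Sum>A\<in>K n. \<Sum>B\<in>K n. of_bool (B \<inter> A \<noteq> {}) * mean (\<lambda>z. g A z * g B z))
      \<le> (\<Sum>A\<in>K n. L n * mean (g A))"
    using K_D local_fun_g g_nonneg by (intro sum_mono sum_mean_mult_g_le) auto
  also have "\<dots> = L n * (\<Sum>A\<in>K n. mean (g A))" by (simp add: sum_distrib_left)
  also have "\<dots> \<le> L n * S n" using L_nonneg by (intro mult_left_mono sum_mean_g_le)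
  finally show ?thesis by (simp add: mult.commute)
qed

text \<open>The sets are summed out from the last to the first: \<open>D\<close>, \<open>C\<close>
  and \<open>B\<close> each meet the union of their predecessors and give a factor
  \<open>L n\<close>, and the free set \<open>A\<close> gives \<open>S n\<close>.\<close>

lemma sum_chain_le: "(\<Sum>A\<in>K n. \<Sum>B\<in>K n. \<Sum>C\<in>K n. \<Sum>D\<in>K n. chain A B C D) \<le> S n * L n ^ 3"
proof -
  have 4: "(\<Sum>D\<in>K n. of_bool (D \<inter> (A \<union> B \<union> C) \<noteq> {}) * g4 A B C D)
      \<le> L n * mean (\<lambda>z. g A z * g B z * g C z)" if "A \<in> K n" "B \<in> K n" "C \<in> K n" for A B C
    unfolding g4_def
  proof (rule sum_mean_mult_g_le)
    show "local_fun (A \<union> B \<union> C) (\<lambda>z. g A z * g B z * g C z)"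
      using that K_D local_fun_g by (intro local_fun_mult) auto
    have "card (A \<union> B \<union> C) \<le> card A + card B + card C"
      by (meson add_mono_thms_linordered_semiring(3) card_Un_le order_trans)
    then show "card (A \<union> B \<union> C) \<le> 3 * k"
      using K_D[OF that(1)] K_D[OF that(2)] K_D[OF that(3)] by linarith
  qed (simp add: g_nonneg)
  have 3: "(\<Sum>C\<in>K n. of_bool (C \<inter> (A \<union> B) \<noteq> {}) * mean (\<lambda>z. g A z * g B z * g C z))
      \<le> L n * mean (\<lambda>z. g A z * g B z)" if "A \<in> K n" "B \<in> K n" for A B
  proof (rule sum_mean_mult_g_le)
    show "local_fun (A \<union> B) (\<lambda>z. g A z * g B z)"
      using that K_D local_fun_g by (intro local_fun_mult) auto
    show "card (A \<union> B) \<le> 3 * k" using K_D[OF that(1)] K_D[OF that(2)] card_Un_le[of A B] by linarith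
  qed (simp add: g_nonneg)
  have "(\<Sum>A\<in>K n. \<Sum>B\<in>K n. \<Sum>C\<in>K n. \<Sum>D\<in>K n. chain A B C D) \<le>
    (\<Sum>A\<in>K n. \<Sum>B\<in>K n. \<Sum>C\<in>K n. of_bool (B \<inter> A \<noteq> {}) * (of_bool (C \<inter> (A \<union> B) \<noteq> {}) *
      (L n * mean (\<lambda>z. g A z * g B z * g C z))))"
    unfolding chain_def sum_distrib_left[symmetric] using 4
    by (intro sum_mono mult_left_mono) auto
  also have "\<dots> = (\<Sum>A\<in>K n. \<Sum>B\<in>K n. of_bool (B \<inter> A \<noteq> {}) * (L n * (\<Sum>C\<in>K n.
      of_bool (C \<inter> (A \<union> B) \<noteq> {}) * mean (\<lambda>z. g A z * g B z * g C z))))"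
    by (simp add: sum_distrib_left mult_ac)
  also have "\<dots> \<le> (\<Sum>A\<in>K n. \<Sum>B\<in>K n. of_bool (B \<inter> A \<noteq> {}) * (L n * (L n * mean (\<lambda>z. g A z * g B z))))"
    using 3 L_nonneg by (intro sum_mono mult_left_mono) auto
  also have "\<dots> = L n ^ 2 * (\<Sum>A\<in>K n. \<Sum>B\<in>K n. of_bool (B \<inter> A \<noteq> {}) * mean (\<lambda>z. g A z * g B z))"
    by (simp add: sum_distrib_left mult_ac power2_eq_square)
  also have "\<dots> \<le> L n ^ 2 * (S n * L n)"
    by (intro mult_left_mono sum_g_pair_le) simp
  finally show ?thesis by (simp add: mult_ac power2_eq_square power3_eq_cube)
qed

lemma sum_pairs_le: "(\<Sum>A\<in>K n. \<Sum>B\<in>K n. \<Sum>C\<in>K n. \<Sum>D\<in>K n. pairs A B C D) \<le> S n ^ 2 * L n ^ 2"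
proof -
  let ?m = "\<lambda>A B. of_bool (B \<inter> A \<noteq> {}) * mean (\<lambda>z. g A z * g B z)"
  have m0: "0 \<le> ?m A B" for A B using mean_nonneg g_nonneg by simp
  have "pairs A B C D \<le> ?m A B * ?m C D" if "A \<in> K n" "B \<in> K n" "C \<in> K n" "D \<in> K n" for A B C D
  proof (cases "(A \<union> B) \<inter> (C \<union> D) = {}")
    case True
    have "mean (\<lambda>z. (g A z * g B z) * (g C z * g D z)) = mean (\<lambda>z. g A z * g B z) * mean (\<lambda>z. g C z * g D z)"
      by (rule mean_mult_disjoint[OF _ _ True]) (use that K_D local_fun_g in \<open>auto intro!: local_fun_mult\<close>)
    then have "g4 A B C D = mean (\<lambda>z. g A z * g B z) * mean (\<lambda>z. g C z * g D z)"
      by (simp add: g4_def mult.assoc)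
    then show ?thesis using True by (simp add: pairs_def mult_ac)
  next
    case False
    then have "pairs A B C D = 0" by (simp add: pairs_def)
    moreover have "0 \<le> ?m A B * ?m C D" by (intro mult_nonneg_nonneg m0)
    ultimately show ?thesis by linarith
  qed
  \<comment> \<open>After factoring, the disjointness condition is dropped. This only enlarges the
    nonnegative sum and splits it into two separate sums over overlapping pairs.\<close>
  then have "(\<Sum>A\<in>K n. \<Sum>B\<in>K n. \<Sum>C\<in>K n. \<Sum>D\<in>K n. pairs A B C D) \<le>
      (\<Sum>A\<in>K n. \<Sum>B\<in>K n. \<Sum>C\<in>K n. \<Sum>D\<in>K n. ?m A B * ?m C D)"
    by (intro sum_mono)
  also have "\<dots> = (\<Sum>A\<in>K n. \<Sum>B\<in>K n. ?m A B) * (\<Sum>A\<in>K n. \<Sum>B\<in>K n. ?m A B)"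
    by (simp only: sum_distrib_left[symmetric] sum_distrib_right[symmetric])
  also have "\<dots> \<le> (S n * L n) * (S n * L n)"
    by (intro mult_mono sum_g_pair_le sum_nonneg mult_nonneg_nonneg m0 S_nonneg L_nonneg)
  finally show ?thesis by (simp add: power2_eq_square mult_ac)
qed

lemma mean_\<xi>_isolated:
  assumes "A \<in> K n" "B \<in> K n" "C \<in> K n" "D \<in> K n" "D \<inter> (A \<union> B \<union> C) = {}"
  shows "mean (\<lambda>z. \<xi> A z * \<xi> B z * \<xi> C z * \<xi> D z) = 0"
proof -
  have "mean (\<lambda>z. (\<xi> A z * \<xi> B z * \<xi> C z) * \<xi> D z) = mean (\<lambda>z. \<xi> A z * \<xi> B z * \<xi> C z) * mean (\<xi> D)"
    by (rule mean_mult_disjoint[of "A \<union> B \<union> C" _ D])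
      (use assms K_D local_fun_\<xi> in \<open>auto intro!: local_fun_mult\<close>)
  then show ?thesis using mean_\<xi> K_D assms by simp
qed

lemma g4_nonneg: "0 \<le> g4 A B C D"
  unfolding g4_def by (intro mean_nonneg mult_nonneg_nonneg g_nonneg)

lemma g4_commute:
  "g4 A B D C = g4 A B C D" "g4 A C B D = g4 A B C D" "g4 A C D B = g4 A B C D"
  "g4 A D B C = g4 A B C D" "g4 A D C B = g4 A B C D"
  unfolding g4_def by (simp_all add: mult_ac)

lemma chain_nonneg: "0 \<le> chain A B C D" and pairs_nonneg: "0 \<le> pairs A B C D"
  unfolding chain_def pairs_def using g4_nonneg by simp_all

text \<open>By independence and centring only those quadruples contribute in which every set meets another
  one; such a quadruple can be ordered as a chain, or it splits into two overlapping pairs.\<close>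

lemma mean_\<xi>4_le:
  assumes K: "A \<in> K n" "B \<in> K n" "C \<in> K n" "D \<in> K n"
  shows "mean (\<lambda>z. \<xi> A z * \<xi> B z * \<xi> C z * \<xi> D z) \<le>
    chain A B C D + chain A B D C + chain A C B D + chain A C D B + chain A D B C + chain A D C B +
    pairs A B C D + pairs A C B D + pairs A D B C" (is "?m \<le> ?R")
proof -
  have nn: "0 \<le> chain A B C D" "0 \<le> chain A B D C" "0 \<le> chain A C B D" "0 \<le> chain A C D B"
    "0 \<le> chain A D B C" "0 \<le> chain A D C B"
    "0 \<le> pairs A B C D" "0 \<le> pairs A C B D" "0 \<le> pairs A D B C"
    by (rule chain_nonneg pairs_nonneg)+
  have le: "?m \<le> g4 A B C D"
    unfolding g4_def
  proof (rule mean_mono)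
    show "local_fun (A \<union> B \<union> C \<union> D) (\<lambda>z. \<xi> A z * \<xi> B z * \<xi> C z * \<xi> D z)"
      "local_fun (A \<union> B \<union> C \<union> D) (\<lambda>z. g A z * g B z * g C z * g D z)"
      using K K_D local_fun_\<xi> local_fun_g by (auto intro!: local_fun_mult)
    fix z
    have "\<xi> A z * \<xi> B z * \<xi> C z * \<xi> D z \<le> \<bar>\<xi> A z\<bar> * \<bar>\<xi> B z\<bar> * \<bar>\<xi> C z\<bar> * \<bar>\<xi> D z\<bar>"
      by (simp flip: abs_mult)
    also have "\<dots> \<le> g A z * g B z * g C z * g D z"
      by (intro mult_mono abs_\<xi>_le mult_nonneg_nonneg g_nonneg) auto
    finally show "\<xi> A z * \<xi> B z * \<xi> C z * \<xi> D z \<le> g A z * g B z * g C z * g D z" .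
  qed
  show ?thesis
  proof (cases "A \<inter> (B \<union> C \<union> D) = {} \<or> B \<inter> (A \<union> C \<union> D) = {} \<or> C \<inter> (A \<union> B \<union> D) = {} \<or> D \<inter> (A \<union> B \<union> C) = {}")
    case True
    then have "?m = 0"
      using mean_\<xi>_isolated[of B n C D A] mean_\<xi>_isolated[of A n C D B]
        mean_\<xi>_isolated[of A n B D C] mean_\<xi>_isolated[of A n B C D] K
      by (auto simp: mult_ac)
    then show ?thesis using nn by linarith
  next
    case False
    have comm: "X \<inter> Y = {} \<longleftrightarrow> Y \<inter> X = {}" for X Y :: "nat set" by (simp add: Int_commute)
    \<comment> \<open>The overlap graph on the four sets has no isolated vertex. It is either
      connected, and then the other three sets can be listed after \<open>A\<close> as a chain, or a
      perfect matching. Once the unions are split this is a propositional fact about the six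
      pairwise intersections.\<close>
    from False consider "B \<inter> A \<noteq> {}" "C \<inter> (A \<union> B) \<noteq> {}" "D \<inter> (A \<union> B \<union> C) \<noteq> {}"
      | "B \<inter> A \<noteq> {}" "D \<inter> (A \<union> B) \<noteq> {}" "C \<inter> (A \<union> B \<union> D) \<noteq> {}"
      | "C \<inter> A \<noteq> {}" "B \<inter> (A \<union> C) \<noteq> {}" "D \<inter> (A \<union> C \<union> B) \<noteq> {}"
      | "C \<inter> A \<noteq> {}" "D \<inter> (A \<union> C) \<noteq> {}" "B \<inter> (A \<union> C \<union> D) \<noteq> {}"
      | "D \<inter> A \<noteq> {}" "B \<inter> (A \<union> D) \<noteq> {}" "C \<inter> (A \<union> D \<union> B) \<noteq> {}"
      | "D \<inter> A \<noteq> {}" "C \<inter> (A \<union> D) \<noteq> {}" "B \<inter> (A \<union> D \<union> C) \<noteq> {}"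
      | "B \<inter> A \<noteq> {}" "D \<inter> C \<noteq> {}" "(A \<union> B) \<inter> (C \<union> D) = {}"
      | "C \<inter> A \<noteq> {}" "D \<inter> B \<noteq> {}" "(A \<union> C) \<inter> (B \<union> D) = {}"
      | "D \<inter> A \<noteq> {}" "C \<inter> B \<noteq> {}" "(A \<union> D) \<inter> (B \<union> C) = {}"
      unfolding Int_Un_distrib Int_Un_distrib2 Un_empty
      using comm[of A B] comm[of A C] comm[of A D] comm[of B C] comm[of B D] comm[of C D] by satx
    then have "g4 A B C D \<in> {chain A B C D, chain A B D C, chain A C B D, chain A C D B,
      chain A D B C, chain A D C B, pairs A B C D, pairs A C B D, pairs A D B C}"
    proof cases
    qed (simp_all add: chain_def pairs_def g4_commute)
    then show ?thesis using le nn by (elim insertE emptyE) linarith+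
  qed
qed

text \<open>The 6 counts the orders in which three sets can follow \<open>A\<close> in a chain, the
  3 the ways to split four sets into two pairs. By symmetry of \<open>g4\<close>, renaming summation
  variables makes the sums within each kind equal.\<close>

lemma fourth_central_moment_le:
  "expectation (\<lambda>\<omega>. (\<Sum>A\<in>K n. h A (\<lambda>i. Z i \<omega>) - p) ^ 4) \<le> 6 * (S n * L n ^ 3) + 3 * (S n ^ 2 * L n ^ 2)"
proof -
  have int: "integrable M (\<lambda>\<omega>. \<xi> A (\<lambda>i. Z i \<omega>) * \<xi> B (\<lambda>i. Z i \<omega>) * \<xi> C (\<lambda>i. Z i \<omega>) * \<xi> D (\<lambda>i. Z i \<omega>))"
    if "A \<in> K n" "B \<in> K n" "C \<in> K n" "D \<in> K n" for A B C D
  proof (rule local_fun_integrable)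
    show "local_fun (A \<union> B \<union> C \<union> D) (\<lambda>z. \<xi> A z * \<xi> B z * \<xi> C z * \<xi> D z)"
      using that K_D local_fun_\<xi> by (auto intro!: local_fun_mult)
  qed
  have "(\<Sum>A\<in>K n. h A z - p) ^ 4 = (\<Sum>A\<in>K n. \<Sum>B\<in>K n. \<Sum>C\<in>K n. \<Sum>D\<in>K n. \<xi> A z * \<xi> B z * \<xi> C z * \<xi> D z)" for z
  proof -
    have "(\<Sum>A\<in>K n. h A z - p) = (\<Sum>A\<in>K n. \<xi> A z)" (is "?s = ?t") by (simp add: \<xi>_def)
    have "?t ^ 4 = ?t * ?t * ?t * ?t" by (simp add: power4_eq_xxxx)
    also have "\<dots> = (\<Sum>A\<in>K n. \<Sum>B\<in>K n. \<Sum>C\<in>K n. \<Sum>D\<in>K n. \<xi> A z * \<xi> B z * \<xi> C z * \<xi> D z)"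
      by (simp only: sum_distrib_left[symmetric] sum_distrib_right[symmetric])
    finally show ?thesis using \<open>?s = ?t\<close> by simp
  qed
  then have "expectation (\<lambda>\<omega>. (\<Sum>A\<in>K n. h A (\<lambda>i. Z i \<omega>) - p) ^ 4) =
      (\<Sum>A\<in>K n. \<Sum>B\<in>K n. \<Sum>C\<in>K n. \<Sum>D\<in>K n. mean (\<lambda>z. \<xi> A z * \<xi> B z * \<xi> C z * \<xi> D z))"
    using int by (simp add: mean_def Bochner_Integration.integral_sum)
  also have "\<dots> \<le> (\<Sum>A\<in>K n. \<Sum>B\<in>K n. \<Sum>C\<in>K n. \<Sum>D\<in>K n.
    chain A B C D + chain A B D C + chain A C B D + chain A C D B + chain A D B C + chain A D C B +
    pairs A B C D + pairs A C B D + pairs A D B C)"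
    by (intro sum_mono mean_\<xi>4_le)
  also have "\<dots> = 6 * (\<Sum>A\<in>K n. \<Sum>B\<in>K n. \<Sum>C\<in>K n. \<Sum>D\<in>K n. chain A B C D) +
      3 * (\<Sum>A\<in>K n. \<Sum>B\<in>K n. \<Sum>C\<in>K n. \<Sum>D\<in>K n. pairs A B C D)"
    unfolding sum.distrib sum_swap3[of "chain _"] sum_swap3[of "pairs _"] by simp
  also have "\<dots> \<le> 6 * (S n * L n ^ 3) + 3 * (S n ^ 2 * L n ^ 2)"
    using sum_chain_le[of n] sum_pairs_le[of n] by linarith
  finally show ?thesis .
qed

end

section \<open>Convergence criteria\<close>

lemma binomial_over_power_tendsto:
  "(\<lambda>n. real (n choose k) / real n ^ k) \<longlonglongrightarrow> 1 / fact k"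
proof -
  have "(\<lambda>n. (\<Prod>i = 0..<k. 1 - real i / real n) / fact k) \<longlonglongrightarrow> (\<Prod>i = 0..<k. 1 - 0) / fact k"
    by (intro tendsto_intros lim_const_over_n) auto
  then have "(\<lambda>n. (\<Prod>i = 0..<k. 1 - real i / real n) / fact k) \<longlonglongrightarrow> 1 / fact k" by simp
  moreover have "eventually (\<lambda>n. (\<Prod>i = 0..<k. 1 - real i / real n) / fact k = real (n choose k) / real n ^ k) sequentially"
    using eventually_gt_at_top[of 0]
  proof eventually_elim
    case (elim n)
    have "(\<Prod>i = 0..<k. 1 - real i / real n) = (\<Prod>i = 0..<k. (real n - real i) / real n)"
      using elim by (intro prod.cong) (auto simp: field_simps)
    also have "\<dots> = (\<Prod>i = 0..<k. real n - real i) / real n ^ k" by (simp add: prod_dividef)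
    finally show ?case by (simp add: binomial_gbinomial gbinomial_prod_rev)
  qed
  ultimately show ?thesis by (rule Lim_transform_eventually)
qed

text \<open>The series of fourth powers has finite expectation, by monotone convergence, and is
  therefore almost surely finite, so its terms tend to 0.\<close>

lemma (in prob_space) AE_tendsto_0_if_summable_moment4:
  fixes V :: "nat \<Rightarrow> 'a \<Rightarrow> real"
  assumes int: "\<And>n. integrable M (\<lambda>\<omega>. V n \<omega> ^ 4)" and V[measurable]: "\<And>n. V n \<in> borel_measurable M"
    and w: "summable w" and le: "eventually (\<lambda>n. expectation (\<lambda>\<omega>. V n \<omega> ^ 4) \<le> w n) sequentially"
  shows "AE \<omega> in M. (\<lambda>n. V n \<omega>) \<longlonglongrightarrow> 0"
proof -
  obtain n0 where n0: "\<And>n. n0 \<le> n \<Longrightarrow> expectation (\<lambda>\<omega>. V n \<omega> ^ 4) \<le> w n"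
    using le by (auto simp: eventually_sequentially)
  have "summable (\<lambda>n. w (n + n0))" using w by (rule summable_ignore_initial_segment)
  have pos: "0 \<le> expectation (\<lambda>\<omega>. V n \<omega> ^ 4)" for n by (rule Bochner_Integration.integral_nonneg) simp
  have root: "root 4 (v ^ 4) = \<bar>v\<bar>" for v :: real
    using real_root_power_cancel[of 4 "\<bar>v\<bar>"] by (simp add: power_even_abs)
  have w0: "0 \<le> w (n + n0)" for n using n0[of "n + n0"] pos[of "n + n0"] by (meson le_add2 order_trans)
  have "(\<integral>\<^sup>+\<omega>. (\<Sum>n. ennreal (V (n + n0) \<omega> ^ 4)) \<partial>M) = (\<Sum>n. \<integral>\<^sup>+\<omega>. ennreal (V (n + n0) \<omega> ^ 4) \<partial>M)"
    by (rule nn_integral_suminf) simp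
  also have "\<dots> = (\<Sum>n. ennreal (expectation (\<lambda>\<omega>. V (n + n0) \<omega> ^ 4)))"
    using int by (simp add: nn_integral_eq_integral)
  also have "\<dots> \<le> (\<Sum>n. ennreal (w (n + n0)))"
    using n0 by (intro suminf_le ennreal_leI) auto
  also have "\<dots> < \<infinity>"
    using suminf_ennreal2[OF w0 \<open>summable (\<lambda>n. w (n + n0))\<close>] by simp
  finally have "AE \<omega> in M. (\<Sum>n. ennreal (V (n + n0) \<omega> ^ 4)) \<noteq> \<infinity>"
    by (intro nn_integral_PInf_AE) auto
  then show ?thesis
  proof eventually_elim
    fix \<omega> assume "(\<Sum>n. ennreal (V (n + n0) \<omega> ^ 4)) \<noteq> \<infinity>"
    then have "summable (\<lambda>n. V (n + n0) \<omega> ^ 4)"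
      by (intro summable_suminf_not_top) auto
    then have "(\<lambda>n. V (n + n0) \<omega> ^ 4) \<longlonglongrightarrow> 0" by (rule summable_LIMSEQ_zero)
    then have "(\<lambda>n. root 4 (V (n + n0) \<omega> ^ 4)) \<longlonglongrightarrow> root 4 0" by (rule tendsto_real_root)
    then have "(\<lambda>n. \<bar>V (n + n0) \<omega>\<bar>) \<longlonglongrightarrow> 0" by (simp add: root)
    then have "(\<lambda>n. V (n + n0) \<omega>) \<longlonglongrightarrow> 0" by (rule tendsto_rabs_zero_cancel)
    then show "(\<lambda>n. V n \<omega>) \<longlonglongrightarrow> 0" by (rule LIMSEQ_offset)
  qed
qed

lemma power_le_1_plus_power:
  fixes x :: real
  assumes "0 \<le> x" "j \<le> m"
  shows "x ^ j \<le> 1 + x ^ m"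
proof (cases "x \<le> 1")
  case True
  then have "x ^ j \<le> 1" using assms by (simp add: power_le_one)
  then show ?thesis using assms by (simp add: add_increasing2)
next
  case False
  then have "x ^ j \<le> x ^ m" using assms by (intro power_increasing) auto
  then show ?thesis by simp
qed

text \<open>With \<open>b * N\<close> for \<open>S n\<close> and \<open>L\<close> for \<open>L n\<close>, the left-hand side is the bound of
  \<open>fourth_central_moment_le\<close> divided by \<open>N ^ 4\<close>.\<close>

lemma moment4_ratio_le:
  fixes N n :: real
  assumes N: "1 \<le> N" and n: "1 \<le> n" and a: "0 \<le> a" and b: "0 \<le> b" and L: "0 \<le> L" "L \<le> a * (1 + N / n)"
  shows "(6 * (b * N * L ^ 3) + 3 * ((b * N)\<^sup>2 * L\<^sup>2)) / N ^ 4
    \<le> (24 * b * a ^ 3 + 6 * b\<^sup>2 * a\<^sup>2) * (1 / N\<^sup>2 + 1 / n\<^sup>2)"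
proof -
  \<comment> \<open>After division by \<open>N ^ 4\<close> the bound is a polynomial in
    \<open>L / N\<close>, and \<open>L / N\<close> is at most \<open>a * t\<close>.\<close>
  define t where "t = 1 / N + 1 / n"
  define l where "l = L / N"
  have "1 / N \<le> 1" "1 / n \<le> 1" using N n by simp_all
  then have t: "0 \<le> t" "t \<le> 2" using N n unfolding t_def by (simp, linarith)
  have l: "0 \<le> l" "l \<le> a * t" using L N n by (auto simp: l_def t_def field_simps)
  have t2: "t\<^sup>2 \<le> 2 * (1 / N\<^sup>2 + 1 / n\<^sup>2)"
  proof -
    have "0 \<le> (1 / N - 1 / n)\<^sup>2" by simp
    then show ?thesis unfolding t_def by (simp add: power2_eq_square algebra_simps)
  qed
  have "(6 * (b * N * L ^ 3) + 3 * ((b * N)\<^sup>2 * L\<^sup>2)) / N ^ 4 = 6 * b * l ^ 3 + 3 * b\<^sup>2 * l\<^sup>2"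
    using N by (simp add: l_def field_simps power2_eq_square power3_eq_cube power4_eq_xxxx)
  also have "\<dots> \<le> 6 * b * (a * t) ^ 3 + 3 * b\<^sup>2 * (a * t)\<^sup>2"
    using l b by (intro add_mono mult_left_mono power_mono) auto
  also have "\<dots> = (6 * b * a ^ 3 * t + 3 * b\<^sup>2 * a\<^sup>2) * t\<^sup>2"
    by (simp add: power2_eq_square power3_eq_cube algebra_simps)
  \<comment> \<open>\<open>t \<le> 2\<close> lowers the cubic chain term to the quadratic order of
    the pair term; the bound on \<open>t\<^sup>2\<close> doubles both, whence 24 and 6.\<close>
  also have "\<dots> \<le> (6 * b * a ^ 3 * 2 + 3 * b\<^sup>2 * a\<^sup>2) * (2 * (1 / N\<^sup>2 + 1 / n\<^sup>2))"
    using t t2 a b by (intro mult_mono add_mono mult_left_mono) auto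
  also have "\<dots> = (24 * b * a ^ 3 + 6 * b\<^sup>2 * a\<^sup>2) * (1 / N\<^sup>2 + 1 / n\<^sup>2)"
    by (simp add: algebra_simps)
  finally show ?thesis .
qed

section \<open>The joint law of points and angles\<close>

text \<open>A product measure is determined by its values on boxes, and there the integral of the
  product density factors.\<close>

lemma PiM_density_lborel:
  fixes g :: "'a::euclidean_space \<Rightarrow> ennreal"
  assumes [measurable]: "g \<in> borel_measurable borel" and fin: "finite I"
    and sf: "sigma_finite_measure (density lborel g)"
  shows "Pi\<^sub>M I (\<lambda>_. density lborel g) = density (Pi\<^sub>M I (\<lambda>_. lborel)) (\<lambda>x. \<Prod>i\<in>I. g (x i))"
proof -
  interpret D: product_sigma_finite "\<lambda>_. density lborel g" using sf by (simp add: product_sigma_finite_def)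
  interpret L: product_sigma_finite "\<lambda>_. lborel :: 'a measure" ..
  show ?thesis
  proof (rule D.PiM_eqI[OF fin, symmetric])
    show "sets (density (Pi\<^sub>M I (\<lambda>_. lborel)) (\<lambda>x. \<Prod>i\<in>I. g (x i))) =
        sets (Pi\<^sub>M I (\<lambda>_. density lborel g))"
      unfolding sets_density by (intro sets_PiM_cong) auto
    fix A :: "_ \<Rightarrow> 'a set" assume A: "\<And>i. i \<in> I \<Longrightarrow> A i \<in> sets (density lborel g)"
    then have A'[measurable]: "\<And>i. i \<in> I \<Longrightarrow> A i \<in> sets borel" by simp
    have "emeasure (density (Pi\<^sub>M I (\<lambda>_. lborel)) (\<lambda>x. \<Prod>i\<in>I. g (x i))) (Pi\<^sub>E I A) =
        (\<integral>\<^sup>+x. (\<Prod>i\<in>I. g (x i)) * indicator (Pi\<^sub>E I A) x \<partial>Pi\<^sub>M I (\<lambda>_. lborel))"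
      using fin A' by (intro emeasure_density sets_PiM_I_finite) auto
    also have "\<dots> = (\<integral>\<^sup>+x. (\<Prod>i\<in>I. g (x i) * indicator (A i) (x i)) \<partial>Pi\<^sub>M I (\<lambda>_. lborel))"
    proof (rule nn_integral_cong)
      fix x :: "_ \<Rightarrow> 'a" assume "x \<in> space (Pi\<^sub>M I (\<lambda>_. lborel))"
      then have "x \<in> extensional I" by (auto simp: space_PiM PiE_def)
      then have "(indicator (Pi\<^sub>E I A) x :: ennreal) = (\<Prod>i\<in>I. indicator (A i) (x i))"
        using fin by (auto simp: indicator_def PiE_def Pi_def)
      then show "(\<Prod>i\<in>I. g (x i)) * indicator (Pi\<^sub>E I A) x = (\<Prod>i\<in>I. g (x i) * indicator (A i) (x i))"
        by (simp add: prod.distrib)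
    qed
    also have "\<dots> = (\<Prod>i\<in>I. \<integral>\<^sup>+x. g x * indicator (A i) x \<partial>lborel)"
      using fin by (intro L.product_nn_integral_prod) auto
    also have "\<dots> = (\<Prod>i\<in>I. emeasure (density lborel g) (A i))"
      by (intro prod.cong refl) (simp add: emeasure_density)
    finally show "emeasure (density (Pi\<^sub>M I (\<lambda>_. lborel)) (\<lambda>x. \<Prod>i\<in>I. g (x i))) (Pi\<^sub>E I A) =
        (\<Prod>i\<in>I. emeasure (density lborel g) (A i))" .
  qed
qed

text \<open>A change of variables in which every coordinate contributes the Jacobian
  \<open>r ^ DIM('a)\<close>. The underlying equality of measures is checked on boxes.\<close>

lemma nn_integral_PiM_lborel_affine:
  fixes c :: "'a::euclidean_space"
  assumes r: "0 < r" and fin: "finite I"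
    and G[measurable]: "G \<in> borel_measurable (Pi\<^sub>M I (\<lambda>_. lborel :: 'a measure))"
  shows "(\<integral>\<^sup>+z. G z \<partial>Pi\<^sub>M I (\<lambda>_. lborel)) =
    ennreal (r ^ (DIM('a) * card I)) * (\<integral>\<^sup>+z. G (\<lambda>i\<in>I. c + r *\<^sub>R z i) \<partial>Pi\<^sub>M I (\<lambda>_. lborel))"
proof -
  let ?P = "Pi\<^sub>M I (\<lambda>_. lborel :: 'a measure)"
  let ?s = "ennreal (r ^ (DIM('a) * card I))"
  let ?T = "\<lambda>z. \<lambda>i\<in>I. c + r *\<^sub>R z i"
  interpret L: product_sigma_finite "\<lambda>_. lborel :: 'a measure" ..
  have T[measurable]: "?T \<in> measurable ?P ?P" by measurable
  have "density (distr ?P ?P ?T) (\<lambda>_. ?s) = ?P"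
  proof (rule L.PiM_eqI[OF fin])
    fix A :: "_ \<Rightarrow> 'a set" assume A: "\<And>i. i \<in> I \<Longrightarrow> A i \<in> sets lborel"
    let ?B = "\<lambda>i. (\<lambda>x. c + r *\<^sub>R x) -` A i"
    have B: "?B i \<in> sets lborel" if "i \<in> I" for i
      using A[OF that] measurable_sets[of "\<lambda>x::'a. c + r *\<^sub>R x" borel borel "A i"] by simp
    have AP: "Pi\<^sub>E I A \<in> sets ?P" using fin A by (intro sets_PiM_I_finite) auto
    have "?T -` Pi\<^sub>E I A \<inter> space ?P = Pi\<^sub>E I ?B"
      by (auto simp: space_PiM PiE_def Pi_def extensional_def)
    then have "emeasure (density (distr ?P ?P ?T) (\<lambda>_. ?s)) (Pi\<^sub>E I A) = ?s * emeasure ?P (Pi\<^sub>E I ?B)"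
      using AP by (simp add: emeasure_density_const emeasure_distr)
    also have "\<dots> = ?s * (\<Prod>i\<in>I. emeasure lborel (?B i))"
      using fin B by (simp add: L.emeasure_PiM)
    also have "?s * (\<Prod>i\<in>I. emeasure lborel (?B i)) = (\<Prod>i\<in>I. ennreal (r ^ DIM('a)) * emeasure lborel (?B i))"
      using r by (simp add: prod.distrib power_mult ennreal_power)
    also have "\<dots> = (\<Prod>i\<in>I. emeasure lborel (A i))"
    proof (rule prod.cong[OF refl])
      fix i assume i: "i \<in> I"
      have "emeasure lborel (A i) =
          emeasure (density (distr lborel borel (\<lambda>x. c + r *\<^sub>R x)) (\<lambda>_. ennreal (\<bar>r\<bar> ^ DIM('a)))) (A i)"
        using lborel_affine[of r c] r by simp
      also have "\<dots> = ennreal (r ^ DIM('a)) * emeasure lborel (?B i)"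
        using A[OF i] r by (simp add: emeasure_density_const emeasure_distr)
      finally show "ennreal (r ^ DIM('a)) * emeasure lborel (?B i) = emeasure lborel (A i)" by simp
    qed
    finally show "emeasure (density (distr ?P ?P ?T) (\<lambda>_. ?s)) (Pi\<^sub>E I A) = (\<Prod>i\<in>I. emeasure lborel (A i))" .
  qed simp
  then have "(\<integral>\<^sup>+z. G z \<partial>?P) = (\<integral>\<^sup>+z. G z \<partial>density (distr ?P ?P ?T) (\<lambda>_. ?s))" by simp
  also have "\<dots> = ?s * (\<integral>\<^sup>+z. G (?T z) \<partial>?P)"
    by (simp add: nn_integral_density nn_integral_distr nn_integral_cmult)
  finally show ?thesis .
qed

text \<open>The angles live on a half-open interval while \<open>mu_const\<close> integrates over a
  closed one; the two differ by a null set.\<close>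

lemma uniform_measure_lborel_Icc:
  fixes a b :: real
  assumes "a < b"
  shows "uniform_measure lborel {a..<b} = density lborel (\<lambda>y. ennreal (indicator {a..b} y / (b - a)))"
  unfolding uniform_measure_def
proof (rule density_cong)
  show "AE y in lborel. indicator {a..<b} y / emeasure lborel {a..<b} = ennreal (indicator {a..b} y / (b - a))"
    using AE_lborel_singleton[of b]
    by eventually_elim (use assms in \<open>auto simp: indicator_def divide_ennreal[symmetric] simp flip: ennreal_1\<close>)
qed auto

lemma prob_density_le_cball:
  assumes f: "prob_density f" and K: "\<And>x. f x \<le> K" and R: "0 \<le> R"
  shows "emeasure (density lborel (\<lambda>x. ennreal (f x))) (cball c R) \<le> ennreal (K * pi * R ^ 2)"
proof -
  have [measurable]: "f \<in> borel_measurable borel" and f0: "\<And>x. 0 \<le> f x" using f by (auto simp: prob_density_def)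
  have K0: "0 \<le> K" using f0[of 0] K[of 0] by linarith
  have "emeasure (density lborel (\<lambda>x. ennreal (f x))) (cball c R) =
      (\<integral>\<^sup>+x. ennreal (f x) * indicator (cball c R) x \<partial>lborel)"
    by (simp add: emeasure_density)
  also have "\<dots> \<le> (\<integral>\<^sup>+x. ennreal K * indicator (cball c R) x \<partial>lborel)"
    using K by (intro nn_integral_mono mult_right_mono ennreal_leI) auto
  also have "\<dots> = ennreal K * emeasure lborel (cball c R)"
    by (simp add: nn_integral_cmult_indicator)
  also have "\<dots> = ennreal (K * pi * R ^ 2)"
    using R K0 by (simp add: emeasure_cball unit_ball_vol_2 ennreal_mult mult.assoc)
  finally show ?thesis .
qed

section \<open>Laws and independence of the random sample\<close>

context random_sector_model
begin

abbreviation "\<nu>X \<equiv> density lborel (\<lambda>x. ennreal (f x))"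
abbreviation "\<nu>Y \<equiv> uniform_measure lborel {0..<2 * pi}"

lemma X_measurable[measurable]: "X i \<in> borel_measurable M"
  using distributed_measurable[OF X_density[of i]] by simp

lemma Y_measurable[measurable]: "Y i \<in> borel_measurable M"
  using Y_indep by (auto simp: indep_vars_def)

lemma distr_X: "distr M borel (X i) = \<nu>X"
  using distributed_distr_eq_density[OF X_density[of i]] by (simp cong: distr_cong)

lemma distr_Y: "distr M borel (Y i) = \<nu>Y"
  using Y_uniform[of i] by (simp cong: distr_cong)

lemma prob_space_\<nu>X: "prob_space \<nu>X"
  using prob_space_distr[OF X_measurable[of 0]] by (simp add: distr_X)

lemma prob_space_\<nu>Y: "prob_space \<nu>Y"
  using prob_space_distr[OF Y_measurable[of 0]] by (simp add: distr_Y)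

text \<open>Any injectively chosen subfamily of an i.i.d. sequence has the same product law. It is
  obtained as an image of the law of the whole sequence and serves both \<open>X\<close> and
  \<open>Y\<close>.\<close>

lemma distr_reindex:
  fixes V :: "nat \<Rightarrow> 'w \<Rightarrow> 'd::topological_space" and \<pi> :: "nat \<Rightarrow> nat"
  assumes ind: "indep_vars (\<lambda>_. borel) V UNIV" and d: "\<And>i. distr M borel (V i) = \<nu>"
    and \<pi>: "inj_on \<pi> I"
  shows "distr M (Pi\<^sub>M I (\<lambda>_. borel)) (\<lambda>\<omega>. \<lambda>i\<in>I. V (\<pi> i) \<omega>) = Pi\<^sub>M I (\<lambda>_. \<nu>)"
proof -
  have V[measurable]: "V i \<in> borel_measurable M" for i using ind by (auto simp: indep_vars_def)
  have \<nu>: "prob_space \<nu>" using prob_space_distr[OF V[of 0]] by (simp add: d)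
  have s: "sets \<nu> = sets borel" using d[of 0] by (metis sets_distr)
  have S: "sets (Pi\<^sub>M J (\<lambda>_. \<nu>)) = sets (Pi\<^sub>M J (\<lambda>_. borel))" for J :: "nat set"
    using s by (intro sets_PiM_cong) auto
  have "distr M (\<Pi>\<^sub>M i\<in>UNIV. borel) (\<lambda>x. \<lambda>i\<in>UNIV. V i x) = (\<Pi>\<^sub>M i\<in>UNIV. distr M borel (V i))"
    using ind by (subst (asm) indep_vars_iff_distr_eq_PiM) auto
  then have U: "distr M (\<Pi>\<^sub>M i\<in>UNIV. borel) (\<lambda>x i. V i x) = (\<Pi>\<^sub>M i\<in>UNIV. \<nu>)"
    by (simp add: d restrict_def)
  have "(\<Pi>\<^sub>M i\<in>I. \<nu>) = distr (\<Pi>\<^sub>M i\<in>UNIV. \<nu>) (\<Pi>\<^sub>M i\<in>I. \<nu>) (\<lambda>\<omega>. \<lambda>n\<in>I. \<omega> (\<pi> n))"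
    using distr_PiM_reindex[of UNIV "\<lambda>_. \<nu>" \<pi> I] \<nu> \<pi> by simp
  also have "\<dots> = distr (distr M (\<Pi>\<^sub>M i\<in>UNIV. borel) (\<lambda>x i. V i x)) (\<Pi>\<^sub>M i\<in>I. borel) (\<lambda>\<omega>. \<lambda>n\<in>I. \<omega> (\<pi> n))"
    unfolding U by (rule distr_cong) (simp_all add: S)
  also have "\<dots> = distr M (\<Pi>\<^sub>M i\<in>I. borel) (\<lambda>\<omega>. \<lambda>i\<in>I. V (\<pi> i) \<omega>)"
  proof (subst distr_distr)
    show "(\<lambda>x i. V i x) \<in> M \<rightarrow>\<^sub>M Pi\<^sub>M UNIV (\<lambda>i. borel)" by (rule measurable_PiM_single') auto
  qed (auto simp: o_def intro!: measurable_restrict)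
  finally show ?thesis by simp
qed

lemma XY_events_indep:
  assumes A: "A \<in> sets (Pi\<^sub>M UNIV (\<lambda>_. borel))" and B: "B \<in> sets (Pi\<^sub>M UNIV (\<lambda>_. borel))"
  shows "prob ({\<omega> \<in> space M. (\<lambda>i. X i \<omega>) \<in> A} \<inter> {\<omega> \<in> space M. (\<lambda>i. Y i \<omega>) \<in> B}) =
    prob {\<omega> \<in> space M. (\<lambda>i. X i \<omega>) \<in> A} * prob {\<omega> \<in> space M. (\<lambda>i. Y i \<omega>) \<in> B}"
proof (rule indep_setD[OF XY_indep])
  show "{\<omega> \<in> space M. (\<lambda>i. X i \<omega>) \<in> A} \<in> sets (vimage_algebra (space M) (\<lambda>\<omega> i. X i \<omega>) (Pi\<^sub>M UNIV (\<lambda>_. borel)))"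
    using in_vimage_algebra[OF A, of "\<lambda>\<omega> i. X i \<omega>" "space M"] by (simp add: vimage_def Int_def conj_commute)
  show "{\<omega> \<in> space M. (\<lambda>i. Y i \<omega>) \<in> B} \<in> sets (vimage_algebra (space M) (\<lambda>\<omega> i. Y i \<omega>) (Pi\<^sub>M UNIV (\<lambda>_. borel)))"
    using in_vimage_algebra[OF B, of "\<lambda>\<omega> i. Y i \<omega>" "space M"] by (simp add: vimage_def Int_def conj_commute)
qed

text \<open>Enough to compare rectangles. The preimages of their sides are events of the whole
  sequence of points and of the whole sequence of angles, which \<open>XY_indep\<close> makes
  independent.\<close>

lemma distr_XY_reindex:
  fixes \<pi> :: "nat \<Rightarrow> nat"
  assumes \<pi>: "inj_on \<pi> I"
  shows "distr M (Pi\<^sub>M I (\<lambda>_. borel) \<Otimes>\<^sub>M Pi\<^sub>M I (\<lambda>_. borel)) (\<lambda>\<omega>. (\<lambda>i\<in>I. X (\<pi> i) \<omega>, \<lambda>i\<in>I. Y (\<pi> i) \<omega>)) =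
    Pi\<^sub>M I (\<lambda>_. \<nu>X) \<Otimes>\<^sub>M Pi\<^sub>M I (\<lambda>_. \<nu>Y)" (is "?D = ?PX \<Otimes>\<^sub>M ?PY")
proof -
  let ?bX = "Pi\<^sub>M I (\<lambda>_. borel) :: (nat \<Rightarrow> real^2) measure" and ?bY = "Pi\<^sub>M I (\<lambda>_. borel) :: (nat \<Rightarrow> real) measure"
  let ?X = "\<lambda>\<omega>. \<lambda>i\<in>I. X (\<pi> i) \<omega>" and ?Y = "\<lambda>\<omega>. \<lambda>i\<in>I. Y (\<pi> i) \<omega>"
  have dX: "?PX = distr M ?bX ?X" and dY: "?PY = distr M ?bY ?Y"
    using distr_reindex[OF X_indep distr_X \<pi>] distr_reindex[OF Y_indep distr_Y \<pi>] by simp_all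
  have mX[measurable]: "?X \<in> measurable M ?bX" and mY[measurable]: "?Y \<in> measurable M ?bY" by measurable
  interpret PX: prob_space ?PX unfolding dX by (rule prob_space_distr) (rule mX)
  interpret PY: prob_space ?PY unfolding dY by (rule prob_space_distr) (rule mY)
  show ?thesis
  proof (rule pair_measure_eqI[symmetric])
    show "sigma_finite_measure ?PX" "sigma_finite_measure ?PY" ..
    show "sets (?PX \<Otimes>\<^sub>M ?PY) = sets ?D"
      unfolding sets_distr dX dY by (rule sets_pair_measure_cong) simp_all
    fix A B assume "A \<in> sets ?PX" "B \<in> sets ?PY"
    then have A: "A \<in> sets ?bX" and B: "B \<in> sets ?bY" by (simp_all add: dX dY)
    have rX: "(\<lambda>x. \<lambda>i\<in>I. x (\<pi> i)) \<in> measurable (Pi\<^sub>M UNIV (\<lambda>_. borel)) ?bX"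
      and rY: "(\<lambda>x. \<lambda>i\<in>I. x (\<pi> i)) \<in> measurable (Pi\<^sub>M UNIV (\<lambda>_. borel)) ?bY"
      by (auto intro!: measurable_restrict)
    let ?A = "(\<lambda>x. \<lambda>i\<in>I. x (\<pi> i)) -` A \<inter> space (Pi\<^sub>M UNIV (\<lambda>_. borel))"
    let ?B = "(\<lambda>x. \<lambda>i\<in>I. x (\<pi> i)) -` B \<inter> space (Pi\<^sub>M UNIV (\<lambda>_. borel))"
    have eqX: "{\<omega> \<in> space M. (\<lambda>i. X i \<omega>) \<in> ?A} = ?X -` A \<inter> space M"
      and eqY: "{\<omega> \<in> space M. (\<lambda>i. Y i \<omega>) \<in> ?B} = ?Y -` B \<inter> space M"
      by (auto simp: space_PiM)
    have "?A \<in> sets (Pi\<^sub>M UNIV (\<lambda>_. borel))" "?B \<in> sets (Pi\<^sub>M UNIV (\<lambda>_. borel))"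
      using measurable_sets[OF rX A] measurable_sets[OF rY B] by simp_all
    from XY_events_indep[OF this]
    have "prob ((?X -` A \<inter> space M) \<inter> (?Y -` B \<inter> space M)) = prob (?X -` A \<inter> space M) * prob (?Y -` B \<inter> space M)"
      unfolding eqX eqY .
    moreover have "(\<lambda>\<omega>. (?X \<omega>, ?Y \<omega>)) -` (A \<times> B) \<inter> space M = (?X -` A \<inter> space M) \<inter> (?Y -` B \<inter> space M)"
      by auto
    ultimately show "emeasure ?PX A * emeasure ?PY B = emeasure ?D (A \<times> B)"
      using A B unfolding dX dY
      by (simp add: emeasure_distr emeasure_eq_measure ennreal_mult'')
  qed
qed

text \<open>The three independence assumptions combine into independence of the pairs, which the
  fourth moment argument needs. They are checked on events \<open>X i \<in> A\<close>,
  \<open>Y i \<in> B\<close>; these are stable under intersection and generate the sigma-algebra of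
  the pair.\<close>

lemma XY_indep_vars: "indep_vars (\<lambda>_. borel \<Otimes>\<^sub>M borel) (\<lambda>i \<omega>. (X i \<omega>, Y i \<omega>)) UNIV"
proof -
  let ?G = "\<lambda>i. {(X i -` A \<inter> space M) \<inter> (Y i -` B \<inter> space M) | A B. A \<in> sets borel \<and> B \<in> sets borel}"
  have prod: "prob ((\<Inter>j\<in>J. X j -` A j \<inter> space M) \<inter> (\<Inter>j\<in>J. Y j -` B j \<inter> space M)) =
      (\<Prod>j\<in>J. prob (X j -` A j \<inter> space M)) * (\<Prod>j\<in>J. prob (Y j -` B j \<inter> space M))"
    if J: "finite J" "J \<noteq> {}" and A: "\<And>j. j \<in> J \<Longrightarrow> A j \<in> sets borel" and B: "\<And>j. j \<in> J \<Longrightarrow> B j \<in> sets borel" for J A B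
  proof -
    have "prod_emb UNIV (\<lambda>_. borel) J (Pi\<^sub>E J A) \<in> sets (Pi\<^sub>M UNIV (\<lambda>_. borel))"
      "prod_emb UNIV (\<lambda>_. borel) J (Pi\<^sub>E J B) \<in> sets (Pi\<^sub>M UNIV (\<lambda>_. borel))"
      using J A B by (auto intro!: sets_PiM_I)
    note XY_events_indep[OF this]
    moreover have "{\<omega> \<in> space M. (\<lambda>i. X i \<omega>) \<in> prod_emb UNIV (\<lambda>_. borel) J (Pi\<^sub>E J A)} = (\<Inter>j\<in>J. X j -` A j \<inter> space M)"
      "{\<omega> \<in> space M. (\<lambda>i. Y i \<omega>) \<in> prod_emb UNIV (\<lambda>_. borel) J (Pi\<^sub>E J B)} = (\<Inter>j\<in>J. Y j -` B j \<inter> space M)"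
      using J by (auto simp: prod_emb_def space_PiM PiE_iff)
    moreover have "prob (\<Inter>j\<in>J. X j -` A j \<inter> space M) = (\<Prod>j\<in>J. prob (X j -` A j \<inter> space M))"
      by (rule indep_varsD[OF X_indep]) (use J A in auto)
    moreover have "prob (\<Inter>j\<in>J. Y j -` B j \<inter> space M) = (\<Prod>j\<in>J. prob (Y j -` B j \<inter> space M))"
      by (rule indep_varsD[OF Y_indep]) (use J B in auto)
    ultimately show ?thesis by simp
  qed
  have "indep_sets ?G UNIV"
  proof (rule indep_setsI)
    fix J D assume J: "J \<noteq> {}" "finite J" and D: "\<forall>j\<in>J. D j \<in> ?G j"
    then obtain A B where AB: "\<And>j. j \<in> J \<Longrightarrow> D j = (X j -` A j \<inter> space M) \<inter> (Y j -` B j \<inter> space M) \<and>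
        A j \<in> sets borel \<and> B j \<in> sets borel" by simp metis
    have "prob (\<Inter>j\<in>J. D j) = prob ((\<Inter>j\<in>J. X j -` A j \<inter> space M) \<inter> (\<Inter>j\<in>J. Y j -` B j \<inter> space M))"
      using AB J by (intro arg_cong[where f = prob]) auto
    also have "\<dots> = (\<Prod>j\<in>J. prob (X j -` A j \<inter> space M) * prob (Y j -` B j \<inter> space M))"
      using prod[OF J(2,1), of A B] AB by (simp add: prod.distrib)
    also have "\<dots> = (\<Prod>j\<in>J. prob (D j))"
    proof (rule prod.cong[OF refl])
      fix j assume "j \<in> J"
      \<comment> \<open>The one-index case of \<open>prod\<close>: within a single pair the point
        and the angle are independent.\<close>
      then show "prob (X j -` A j \<inter> space M) * prob (Y j -` B j \<inter> space M) = prob (D j)"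
        using prod[of "{j}" A B] AB by simp
    qed
    finally show "prob (\<Inter>j\<in>J. D j) = (\<Prod>j\<in>J. prob (D j))" .
  qed (auto intro!: sets.Int measurable_sets[OF X_measurable] measurable_sets[OF Y_measurable])
  then have "indep_sets (\<lambda>i. sigma_sets (space M) (?G i)) UNIV"
  proof (rule indep_sets_sigma)
    fix i
    show "Int_stable (?G i)"
    proof (rule Int_stableI)
      fix a b assume "a \<in> ?G i" "b \<in> ?G i"
      then obtain A B A' B' where *: "a = (X i -` A \<inter> space M) \<inter> (Y i -` B \<inter> space M)"
        "b = (X i -` A' \<inter> space M) \<inter> (Y i -` B' \<inter> space M)"
        "A \<in> sets borel" "B \<in> sets borel" "A' \<in> sets borel" "B' \<in> sets borel" by blast
      then have "a \<inter> b = (X i -` (A \<inter> A') \<inter> space M) \<inter> (Y i -` (B \<inter> B') \<inter> space M)" by auto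
      then show "a \<inter> b \<in> ?G i" using * by blast
    qed
  qed
  then have "indep_sets (\<lambda>i. {(\<lambda>\<omega>. (X i \<omega>, Y i \<omega>)) -` C \<inter> space M | C. C \<in> sets (borel \<Otimes>\<^sub>M borel)}) UNIV"
  proof (rule indep_sets_mono_sets)
    fix i
    let ?S = "sigma (space M) (?G i)"
    have G: "?G i \<subseteq> Pow (space M)" by auto
    have S: "sets ?S = sigma_sets (space M) (?G i)" "space ?S = space M"
      using sets_measure_of[OF G] space_measure_of[OF G] by simp_all
    have "X i \<in> borel_measurable ?S"
    proof (rule measurableI)
      fix A :: "(real^2) set" assume "A \<in> sets borel"
      then have "(X i -` A \<inter> space M) \<inter> (Y i -` UNIV \<inter> space M) \<in> ?G i"
        by (intro CollectI exI[of _ A] exI[of _ UNIV]) simp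
      moreover have "(X i -` A \<inter> space M) \<inter> (Y i -` UNIV \<inter> space M) = X i -` A \<inter> space M" by auto
      ultimately show "X i -` A \<inter> space ?S \<in> sets ?S"
        unfolding S by (metis (no_types, lifting) sigma_sets.Basic)
    qed simp
    moreover have "Y i \<in> borel_measurable ?S"
    proof (rule measurableI)
      fix B :: "real set" assume "B \<in> sets borel"
      then have "(X i -` UNIV \<inter> space M) \<inter> (Y i -` B \<inter> space M) \<in> ?G i"
        by (intro CollectI exI[of _ UNIV] exI[of _ B]) simp
      moreover have "(X i -` UNIV \<inter> space M) \<inter> (Y i -` B \<inter> space M) = Y i -` B \<inter> space M" by auto
      ultimately show "Y i -` B \<inter> space ?S \<in> sets ?S"
        unfolding S by (metis (no_types, lifting) sigma_sets.Basic)
    qed simp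
    ultimately have "(\<lambda>\<omega>. (X i \<omega>, Y i \<omega>)) \<in> measurable ?S (borel \<Otimes>\<^sub>M borel)" by (rule measurable_Pair)
    from measurable_sets[OF this]
    show "{(\<lambda>\<omega>. (X i \<omega>, Y i \<omega>)) -` C \<inter> space M | C. C \<in> sets (borel \<Otimes>\<^sub>M borel)} \<subseteq> sigma_sets (space M) (?G i)"
      unfolding S by blast
  qed
  then show ?thesis unfolding indep_vars_def2 by simp
qed

end

section \<open>The mean\<close>

text \<open>\<open>B\<close> bounds the density and \<open>D\<close> is the diameter of a copy in
  units of the radius; connectedness of \<open>T\<close> is represented by
  \<open>iso_dist\<close>.\<close>

locale sector_subgraph_model = random_sector_model M f X Y
  for M :: "'w measure" and f :: "real^2 \<Rightarrow> real"
    and X :: "nat \<Rightarrow> 'w \<Rightarrow> real^2" and Y :: "nat \<Rightarrow> 'w \<Rightarrow> real" +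
  fixes \<alpha> B D :: real and T :: "('a, 'b) pre_digraph" and k :: nat
  assumes T: "digraph T" and card_T: "card (verts T) = k" and k_pos: "1 \<le> k"
    and f_density: "prob_density f" and f_le: "\<And>x. f x \<le> B"
    and f_cont: "AE x in lborel. isCont f x"
    and D_pos: "0 < D"
    and iso_dist: "\<And>A x y r a b. finite A \<Longrightarrow> card A = k \<Longrightarrow> 0 \<le> r \<Longrightarrow>
      digraph_iso (sector_digraph \<alpha> A x y r) T \<Longrightarrow> (a :: nat) \<in> A \<Longrightarrow> b \<in> A \<Longrightarrow> dist (x a) (x b) \<le> D * r"
begin

context notes One_nat_def [simp del]
begin

abbreviation iso :: "nat set \<Rightarrow> (nat \<Rightarrow> real^2) \<Rightarrow> (nat \<Rightarrow> real) \<Rightarrow> real \<Rightarrow> bool" where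
  "iso A x y r \<equiv> digraph_iso (sector_digraph \<alpha> A x y r) T"

abbreviation "PX \<equiv> \<lambda>I :: nat set. Pi\<^sub>M I (\<lambda>_. lborel :: (real^2) measure)"
abbreviation "PY \<equiv> \<lambda>I :: nat set. Pi\<^sub>M I (\<lambda>_. lborel :: real measure)"
text \<open>Angles first, then the base point, then the relative positions: the order of the
  integrals in \<open>mu_const\<close>.\<close>

abbreviation "Q \<equiv> PY {..<k} \<Otimes>\<^sub>M (lborel \<Otimes>\<^sub>M PX {1..<k})"

definition u :: "real \<Rightarrow> real" where "u y = indicator {0..2 * pi} y / (2 * pi)"

text \<open>The integrand of the copy probability after the substitution of \<open>x + r *\<^sub>R z i\<close> for all points but the
  first one, \<open>x\<close>; at \<open>r = 0\<close> it is the integrand of \<^const>\<open>mu_const\<close>.\<close>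

definition F :: "real \<Rightarrow> (nat \<Rightarrow> real) \<times> (real^2) \<times> (nat \<Rightarrow> real^2) \<Rightarrow> real" where
  "F r = (\<lambda>(y, x, z). (\<Prod>i<k. u (y i)) * (f x * (\<Prod>i\<in>{1..<k}. f (x + r *\<^sub>R z i)) *
     of_bool (iso {..<k} (z(0 := 0)) y 1)))"

section \<open>An exact integral formula for the copy probability\<close>

lemma f_measurable[measurable]: "f \<in> borel_measurable borel" and f_nonneg: "0 \<le> f x"
  using f_density by (auto simp: prob_density_def)

lemma B_nonneg: "0 \<le> B"
  using f_nonneg[of 0] f_le[of 0] by linarith

lemma u_measurable[measurable]: "u \<in> borel_measurable borel" and u_nonneg: "0 \<le> u y"
  by (auto simp: u_def[abs_def])

lemma \<nu>Y_eq: "\<nu>Y = density lborel (\<lambda>y. ennreal (u y))"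
  using uniform_measure_lborel_Icc[of 0 "2 * pi"] by (simp add: u_def)

lemma PiM_\<nu>X: "finite I \<Longrightarrow> Pi\<^sub>M I (\<lambda>_. \<nu>X) = density (PX I) (\<lambda>x. \<Prod>i\<in>I. ennreal (f (x i)))"
  using prob_space_\<nu>X by (intro PiM_density_lborel) (auto simp: prob_space_imp_sigma_finite)

lemma PiM_\<nu>Y: "finite I \<Longrightarrow> Pi\<^sub>M I (\<lambda>_. \<nu>Y) = density (PY I) (\<lambda>y. \<Prod>i\<in>I. ennreal (u (y i)))"
  using prob_space_\<nu>Y unfolding \<nu>Y_eq
  by (intro PiM_density_lborel) (auto simp: prob_space_imp_sigma_finite)

text \<open>The right-hand side does not depend on \<open>A\<close>. The angles are integrated
  outermost so that the points can be rescaled while the angles are fixed.\<close>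

lemma nn_integral_iso:
  assumes A: "finite A" "card A = k"
  shows "emeasure M {\<omega> \<in> space M. iso A (\<lambda>i. X i \<omega>) (\<lambda>i. Y i \<omega>) r} =
    (\<integral>\<^sup>+y. (\<Prod>i<k. ennreal (u (y i))) *
      (\<integral>\<^sup>+x. (\<Prod>i<k. ennreal (f (x i))) * of_bool (iso {..<k} x y r) \<partial>PX {..<k}) \<partial>PY {..<k})"
proof -
  let ?I = "{..<k}"
  obtain \<pi> where \<pi>: "bij_betw \<pi> ?I A"
    using A by (metis finite_same_card_bij card_lessThan finite_lessThan)
  then have inj: "inj_on \<pi> ?I" and im: "\<pi> ` ?I = A" by (auto simp: bij_betw_def)
  let ?b = "Pi\<^sub>M ?I (\<lambda>_. borel) \<Otimes>\<^sub>M Pi\<^sub>M ?I (\<lambda>_. borel)"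
  let ?P = "\<lambda>\<omega>. (\<lambda>i\<in>?I. X (\<pi> i) \<omega>, \<lambda>i\<in>?I. Y (\<pi> i) \<omega>)"
  let ?h = "\<lambda>(x, y). of_bool (iso ?I x y r) :: ennreal"
  have P: "?P \<in> measurable M ?b" by measurable
  have pred: "Measurable.pred ?b (\<lambda>p. iso ?I (fst p) (snd p) r)"
    using T card_T by (intro measurable_digraph_iso_sector_digraph) auto
  then have h: "?h \<in> borel_measurable ?b" unfolding case_prod_beta by measurable
  interpret PX: prob_space "Pi\<^sub>M ?I (\<lambda>_. \<nu>X)" by (intro prob_space_PiM prob_space_\<nu>X)
  interpret PY: prob_space "Pi\<^sub>M ?I (\<lambda>_. \<nu>Y)" by (intro prob_space_PiM prob_space_\<nu>Y)
  interpret PP: pair_sigma_finite "Pi\<^sub>M ?I (\<lambda>_. \<nu>X)" "Pi\<^sub>M ?I (\<lambda>_. \<nu>Y)" ..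
  have sb: "sets (Pi\<^sub>M ?I (\<lambda>_. \<nu>X) \<Otimes>\<^sub>M Pi\<^sub>M ?I (\<lambda>_. \<nu>Y)) = sets ?b"
    by (intro sets_pair_measure_cong sets_PiM_cong) auto
  have sl: "sets (PX ?I \<Otimes>\<^sub>M PY ?I) = sets ?b"
    by (intro sets_pair_measure_cong sets_PiM_cong) auto
  have eq: "iso A (\<lambda>i. X i \<omega>) (\<lambda>i. Y i \<omega>) r \<longleftrightarrow> iso ?I (fst (?P \<omega>)) (snd (?P \<omega>)) r" for \<omega>
    unfolding im[symmetric] sector_digraph_reindex[OF inj]
    by (rule digraph_iso_sector_digraph_cong) auto
  have "{\<omega> \<in> space M. iso A (\<lambda>i. X i \<omega>) (\<lambda>i. Y i \<omega>) r} \<in> sets M"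
    using measurable_compose[OF P pred] unfolding eq by (simp add: pred_def)
  then have "emeasure M {\<omega> \<in> space M. iso A (\<lambda>i. X i \<omega>) (\<lambda>i. Y i \<omega>) r} =
      (\<integral>\<^sup>+\<omega>. indicator {\<omega> \<in> space M. iso A (\<lambda>i. X i \<omega>) (\<lambda>i. Y i \<omega>) r} \<omega> \<partial>M)"
    by simp
  also have "\<dots> = (\<integral>\<^sup>+\<omega>. ?h (?P \<omega>) \<partial>M)"
    by (rule nn_integral_cong) (simp add: indicator_def eq case_prod_beta del: fst_conv snd_conv)
  also have "\<dots> = (\<integral>\<^sup>+p. ?h p \<partial>distr M ?b ?P)"
    by (rule nn_integral_distr[symmetric, OF P]) (use h in simp)
  also have "\<dots> = (\<integral>\<^sup>+p. ?h p \<partial>(Pi\<^sub>M ?I (\<lambda>_. \<nu>X) \<Otimes>\<^sub>M Pi\<^sub>M ?I (\<lambda>_. \<nu>Y)))"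
    unfolding distr_XY_reindex[OF inj] ..
  also have "\<dots> = (\<integral>\<^sup>+y. \<integral>\<^sup>+x. ?h (x, y) \<partial>Pi\<^sub>M ?I (\<lambda>_. \<nu>X) \<partial>Pi\<^sub>M ?I (\<lambda>_. \<nu>Y))"
    using h by (intro PP.nn_integral_snd[symmetric]) (simp add: measurable_cong_sets[OF sb refl])
  also have "\<dots> = (\<integral>\<^sup>+y. \<integral>\<^sup>+x. of_bool (iso ?I x y r) \<partial>Pi\<^sub>M ?I (\<lambda>_. \<nu>X) \<partial>Pi\<^sub>M ?I (\<lambda>_. \<nu>Y))"
    by (simp only: prod.case)
  also have "\<dots> = (\<integral>\<^sup>+y. \<integral>\<^sup>+x. of_bool (iso ?I x y r) \<partial>density (PX ?I) (\<lambda>x. \<Prod>i<k. ennreal (f (x i)))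
      \<partial>density (PY ?I) (\<lambda>y. \<Prod>i<k. ennreal (u (y i))))"
    by (simp only: PiM_\<nu>X PiM_\<nu>Y finite_lessThan)
  also have "\<dots> = (\<integral>\<^sup>+y. \<integral>\<^sup>+x. (\<Prod>i<k. ennreal (f (x i))) * of_bool (iso ?I x y r) \<partial>PX ?I
      \<partial>density (PY ?I) (\<lambda>y. \<Prod>i<k. ennreal (u (y i))))"
  proof (rule nn_integral_cong)
    fix y assume "y \<in> space (density (PY ?I) (\<lambda>y. \<Prod>i<k. ennreal (u (y i))))"
    then have y: "y \<in> space (PY ?I)" by simp
    have [measurable]: "Measurable.pred (PX ?I) (\<lambda>x. iso ?I x y r)"
      using T card_T by (intro measurable_digraph_iso_sector_digraph) auto
    show "(\<integral>\<^sup>+x. of_bool (iso ?I x y r) \<partial>density (PX ?I) (\<lambda>x. \<Prod>i<k. ennreal (f (x i)))) =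
        (\<integral>\<^sup>+x. (\<Prod>i<k. ennreal (f (x i))) * of_bool (iso ?I x y r) \<partial>PX ?I)"
      by (intro nn_integral_density) measurable
  qed
  also have "\<dots> = (\<integral>\<^sup>+y. (\<Prod>i<k. ennreal (u (y i))) *
      (\<integral>\<^sup>+x. (\<Prod>i<k. ennreal (f (x i))) * of_bool (iso ?I x y r) \<partial>PX ?I) \<partial>PY ?I)"
  proof (rule nn_integral_density)
    interpret LX: product_sigma_finite "\<lambda>_. lborel :: (real^2) measure" ..
    interpret LX: finite_product_sigma_finite "\<lambda>_. lborel :: (real^2) measure" ?I by standard simp
    have "?h \<in> borel_measurable (PX ?I \<Otimes>\<^sub>M PY ?I)" using h by (simp add: measurable_cong_sets[OF sl refl])
    from measurable_compose[OF measurable_pair_swap' this]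
    have [measurable]: "(\<lambda>p. of_bool (iso ?I (snd p) (fst p) r) :: ennreal) \<in> borel_measurable (PY ?I \<Otimes>\<^sub>M PX ?I)"
      by (simp add: case_prod_beta)
    have "(\<lambda>(y, x). (\<Prod>i<k. ennreal (f (x i))) * of_bool (iso ?I x y r)) \<in> borel_measurable (PY ?I \<Otimes>\<^sub>M PX ?I)"
      unfolding case_prod_beta by measurable
    then show "(\<lambda>y. \<integral>\<^sup>+x. (\<Prod>i<k. ennreal (f (x i))) * of_bool (iso ?I x y r) \<partial>PX ?I) \<in> borel_measurable (PY ?I)"
      by (rule LX.borel_measurable_nn_integral)
  qed measurable
  finally show ?thesis .
qed

text \<open>All points but the first are expressed relative to it in units of \<open>r\<close>. The
  \<open>k - 1\<close> planar substitutions give the power \<open>r ^ (2 * (k - 1))\<close>, and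
  affine invariance reduces the copy event to radius 1.\<close>

lemma nn_integral_iso_scale:
  assumes r: "0 < r"
  shows "(\<integral>\<^sup>+x. (\<Prod>i<k. ennreal (f (x i))) * of_bool (iso {..<k} x y r) \<partial>PX {..<k}) =
    ennreal (r ^ (2 * (k - 1))) * (\<integral>\<^sup>+x. \<integral>\<^sup>+z. ennreal (f x * (\<Prod>i\<in>{1..<k}. f (x + r *\<^sub>R z i)) *
      of_bool (iso {..<k} (z(0 := 0)) y 1)) \<partial>PX {1..<k} \<partial>lborel)"
proof -
  interpret LX: product_sigma_finite "\<lambda>_. lborel :: (real^2) measure" ..
  have I: "{..<k} = insert 0 {1..<k}" using k_pos by auto
  have c: "DIM(real^2) * card {1..<k} = 2 * (k - 1)" by simp
  let ?G = "\<lambda>x. (\<Prod>i<k. ennreal (f (x i))) * of_bool (iso {..<k} x y r)"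
  have "Measurable.pred (PX {..<k}) (\<lambda>x. iso {..<k} x y r)"
    using T card_T by (intro measurable_digraph_iso_sector_digraph) auto
  then have G: "?G \<in> borel_measurable (PX {..<k})" by measurable
  have "(\<integral>\<^sup>+x. ?G x \<partial>PX {..<k}) = (\<integral>\<^sup>+x. \<integral>\<^sup>+z. ?G (z(0 := x)) \<partial>PX {1..<k} \<partial>lborel)"
    using G unfolding I by (intro LX.product_nn_integral_insert_rev) auto
  also have "\<dots> = (\<integral>\<^sup>+x. ennreal (r ^ (2 * (k - 1))) * (\<integral>\<^sup>+z. ennreal (f x * (\<Prod>i\<in>{1..<k}. f (x + r *\<^sub>R z i)) *
      of_bool (iso {..<k} (z(0 := 0)) y 1)) \<partial>PX {1..<k}) \<partial>lborel)"
  proof (rule nn_integral_cong)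
    fix x :: "real^2"
    have "(\<lambda>z. z(0 := x)) \<in> measurable (PX {1..<k}) (PX {..<k})"
      unfolding I by (intro measurable_fun_upd[where J = "{1..<k}"]) auto
    from measurable_compose[OF this G]
    have "(\<integral>\<^sup>+z. ?G (z(0 := x)) \<partial>PX {1..<k}) =
        ennreal (r ^ (DIM(real^2) * card {1..<k})) * (\<integral>\<^sup>+z. ?G ((\<lambda>i\<in>{1..<k}. x + r *\<^sub>R z i)(0 := x)) \<partial>PX {1..<k})"
      using r by (intro nn_integral_PiM_lborel_affine) auto
    also have "(\<integral>\<^sup>+z. ?G ((\<lambda>i\<in>{1..<k}. x + r *\<^sub>R z i)(0 := x)) \<partial>PX {1..<k}) =
      (\<integral>\<^sup>+z. ennreal (f x * (\<Prod>i\<in>{1..<k}. f (x + r *\<^sub>R z i)) * of_bool (iso {..<k} (z(0 := 0)) y 1)) \<partial>PX {1..<k})"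
    proof (rule nn_integral_cong)
      fix z :: "nat \<Rightarrow> real^2"
      let ?x = "(\<lambda>i\<in>{1..<k}. x + r *\<^sub>R z i)(0 := x)"
      \<comment> \<open>The origin at index 0 is sent to the base point \<open>x\<close> by the
        affine map, so one formula covers all indices.\<close>
      have "iso {..<k} ?x y r \<longleftrightarrow> iso {..<k} (\<lambda>i. x + r *\<^sub>R (z(0 := 0)) i) y r"
        by (rule digraph_iso_sector_digraph_cong) auto
      also have "\<dots> \<longleftrightarrow> iso {..<k} (z(0 := 0)) y 1"
        using T card_T r by (intro digraph_iso_sector_digraph_affine) auto
      finally have 1: "iso {..<k} ?x y r \<longleftrightarrow> iso {..<k} (z(0 := 0)) y 1" .
      have "(\<Prod>i<k. ennreal (f (?x i))) = ennreal (\<Prod>i<k. f (?x i))"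
        by (rule prod_ennreal) (simp add: f_nonneg)
      also have "(\<Prod>i<k. f (?x i)) = f x * (\<Prod>i\<in>{1..<k}. f (?x i))" unfolding I by simp
      also have "(\<Prod>i\<in>{1..<k}. f (?x i)) = (\<Prod>i\<in>{1..<k}. f (x + r *\<^sub>R z i))"
        by (rule prod.cong) auto
      finally have 2: "(\<Prod>i<k. ennreal (f (?x i))) = ennreal (f x * (\<Prod>i\<in>{1..<k}. f (x + r *\<^sub>R z i)))" .
      show "?G ?x = ennreal (f x * (\<Prod>i\<in>{1..<k}. f (x + r *\<^sub>R z i)) * of_bool (iso {..<k} (z(0 := 0)) y 1))"
        unfolding 1 2 by (cases "iso {..<k} (z(0 := 0)) y 1") simp_all
    qed
    finally show "(\<integral>\<^sup>+z. ?G (z(0 := x)) \<partial>PX {1..<k}) = ennreal (r ^ (2 * (k - 1))) *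
      (\<integral>\<^sup>+z. ennreal (f x * (\<Prod>i\<in>{1..<k}. f (x + r *\<^sub>R z i)) * of_bool (iso {..<k} (z(0 := 0)) y 1)) \<partial>PX {1..<k})"
      by (simp only: c)
  qed
  also have "\<dots> = ennreal (r ^ (2 * (k - 1))) * (\<integral>\<^sup>+x. \<integral>\<^sup>+z. ennreal (f x * (\<Prod>i\<in>{1..<k}. f (x + r *\<^sub>R z i)) *
      of_bool (iso {..<k} (z(0 := 0)) y 1)) \<partial>PX {1..<k} \<partial>lborel)"
  proof (rule nn_integral_cmult)
    interpret LX: finite_product_sigma_finite "\<lambda>_. lborel :: (real^2) measure" "{1..<k}" by standard simp
    have [measurable]: "(\<lambda>p. (snd p)(0 := 0)) \<in> measurable (lborel \<Otimes>\<^sub>M PX {1..<k}) (PX {..<k})"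
      unfolding I by (intro measurable_fun_upd[where J = "{1..<k}"]) auto
    have "Measurable.pred (PX {..<k}) (\<lambda>x. iso {..<k} x y 1)"
      using T card_T by (intro measurable_digraph_iso_sector_digraph) auto
    then have "Measurable.pred (lborel \<Otimes>\<^sub>M PX {1..<k}) (\<lambda>p. iso {..<k} ((snd p)(0 := 0)) y 1)"
      by measurable
    then have "(\<lambda>(x, z). ennreal (f x * (\<Prod>i\<in>{1..<k}. f (x + r *\<^sub>R z i)) * of_bool (iso {..<k} (z(0 := 0)) y 1)))
        \<in> borel_measurable (lborel \<Otimes>\<^sub>M PX {1..<k})"
      unfolding case_prod_beta by measurable
    then show "(\<lambda>x. \<integral>\<^sup>+z. ennreal (f x * (\<Prod>i\<in>{1..<k}. f (x + r *\<^sub>R z i)) *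
        of_bool (iso {..<k} (z(0 := 0)) y 1)) \<partial>PX {1..<k}) \<in> borel_measurable lborel"
      by (rule LX.borel_measurable_nn_integral)
  qed
  finally show ?thesis .
qed

lemma sigma_finite_PX: "finite I \<Longrightarrow> sigma_finite_measure (PX I)"
  and sigma_finite_PY: "finite I \<Longrightarrow> sigma_finite_measure (PY I)"
  by (auto intro!: product_sigma_finite.sigma_finite product_sigma_finite.intro lborel.sigma_finite_measure_axioms)

lemma measurable_iso_origin:
  "Measurable.pred Q (\<lambda>q. iso {..<k} ((snd (snd q))(0 := 0)) (fst q) 1)"
proof (rule measurable_digraph_iso_sector_digraph[OF T])
  fix i assume i: "i \<in> {..<k}"
  show "(\<lambda>q. ((snd (snd q))(0 := 0)) i) \<in> borel_measurable Q"
  proof (cases "i = 0")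
    case False
    then have "i \<in> {1..<k}" using i by auto
    then have "(\<lambda>q. snd (snd q) i) \<in> borel_measurable Q" by measurable
    then show ?thesis using False by simp
  qed simp
  show "(\<lambda>q. fst q i) \<in> borel_measurable Q" using i by measurable
qed (simp_all add: card_T)

lemma F_measurable[measurable]: "F r \<in> borel_measurable Q"
proof -
  note [measurable] = measurable_iso_origin
  show ?thesis unfolding F_def case_prod_beta by measurable
qed

lemma emeasure_iso:
  assumes A: "finite A" "card A = k" and r: "0 < r"
  shows "emeasure M {\<omega> \<in> space M. iso A (\<lambda>i. X i \<omega>) (\<lambda>i. Y i \<omega>) r} =
    ennreal (r ^ (2 * (k - 1))) * (\<integral>\<^sup>+q. ennreal (F r q) \<partial>Q)"
proof -
  let ?g = "\<lambda>y x z. ennreal (f x * (\<Prod>i\<in>{1..<k}. f (x + r *\<^sub>R z i)) * of_bool (iso {..<k} (z(0 := 0)) y 1))"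
  interpret PX: sigma_finite_measure "PX {1..<k}" by (rule sigma_finite_PX) simp
  interpret P: pair_sigma_finite "lborel :: (real^2) measure" "PX {1..<k}" ..
  note [measurable] = measurable_iso_origin
  have g: "(\<lambda>(y, x, z). ?g y x z) \<in> borel_measurable Q"
    unfolding case_prod_beta by measurable
  have U: "(\<Prod>i<k. ennreal (u (y i))) = ennreal (\<Prod>i<k. u (y i))" for y
    by (rule prod_ennreal) (simp add: u_nonneg)
  have gy: "(\<lambda>p. ?g y (fst p) (snd p)) \<in> borel_measurable (lborel \<Otimes>\<^sub>M PX {1..<k})" if "y \<in> space (PY {..<k})" for y
    using measurable_compose[OF measurable_Pair1'[OF that] g] by (simp add: case_prod_beta)
  have "emeasure M {\<omega> \<in> space M. iso A (\<lambda>i. X i \<omega>) (\<lambda>i. Y i \<omega>) r} =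
    (\<integral>\<^sup>+y. ennreal (r ^ (2 * (k - 1))) * (ennreal (\<Prod>i<k. u (y i)) * (\<integral>\<^sup>+x. \<integral>\<^sup>+z. ?g y x z \<partial>PX {1..<k} \<partial>lborel)) \<partial>PY {..<k})"
    unfolding nn_integral_iso[OF A] nn_integral_iso_scale[OF r] U by (simp only: mult.left_commute)
  also have "\<dots> = (\<integral>\<^sup>+y. ennreal (r ^ (2 * (k - 1))) * (\<integral>\<^sup>+p. ennreal (F r (y, p)) \<partial>(lborel \<Otimes>\<^sub>M PX {1..<k})) \<partial>PY {..<k})"
  proof (rule nn_integral_cong)
    fix y assume y: "y \<in> space (PY {..<k})"
    have "(\<integral>\<^sup>+x. \<integral>\<^sup>+z. ?g y x z \<partial>PX {1..<k} \<partial>lborel) = (\<integral>\<^sup>+p. ?g y (fst p) (snd p) \<partial>(lborel \<Otimes>\<^sub>M PX {1..<k}))"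
      using PX.nn_integral_fst[OF gy[OF y]] by simp
    moreover have "ennreal (\<Prod>i<k. u (y i)) * (\<integral>\<^sup>+p. ?g y (fst p) (snd p) \<partial>(lborel \<Otimes>\<^sub>M PX {1..<k})) =
        (\<integral>\<^sup>+p. ennreal (\<Prod>i<k. u (y i)) * ?g y (fst p) (snd p) \<partial>(lborel \<Otimes>\<^sub>M PX {1..<k}))"
      by (rule nn_integral_cmult[symmetric, OF gy[OF y]])
    moreover have "\<dots> = (\<integral>\<^sup>+p. ennreal (F r (y, p)) \<partial>(lborel \<Otimes>\<^sub>M PX {1..<k}))"
      unfolding F_def by (intro nn_integral_cong) (simp add: case_prod_beta ennreal_mult' prod_nonneg u_nonneg)
    ultimately show "ennreal (r ^ (2 * (k - 1))) * (ennreal (\<Prod>i<k. u (y i)) * (\<integral>\<^sup>+x. \<integral>\<^sup>+z. ?g y x z \<partial>PX {1..<k} \<partial>lborel)) =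
      ennreal (r ^ (2 * (k - 1))) * (\<integral>\<^sup>+p. ennreal (F r (y, p)) \<partial>(lborel \<Otimes>\<^sub>M PX {1..<k}))" by simp
  qed
  also have "\<dots> = ennreal (r ^ (2 * (k - 1))) * (\<integral>\<^sup>+y. \<integral>\<^sup>+p. ennreal (F r (y, p)) \<partial>(lborel \<Otimes>\<^sub>M PX {1..<k}) \<partial>PY {..<k})"
    by (intro nn_integral_cmult P.borel_measurable_nn_integral) simp
  also have "(\<integral>\<^sup>+y. \<integral>\<^sup>+p. ennreal (F r (y, p)) \<partial>(lborel \<Otimes>\<^sub>M PX {1..<k}) \<partial>PY {..<k}) = (\<integral>\<^sup>+q. ennreal (F r q) \<partial>Q)"
    by (rule P.nn_integral_fst) (rule measurable_compose[OF F_measurable measurable_ennreal])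
  finally show ?thesis .
qed

section \<open>Domination and the limit of vanishing radius\<close>

definition W :: "(nat \<Rightarrow> real) \<times> (real^2) \<times> (nat \<Rightarrow> real^2) \<Rightarrow> ennreal" where
  "W = (\<lambda>(y, x, z). (\<Prod>i<k. ennreal (u (y i))) * (ennreal (B ^ (k - 1)) * (ennreal (f x) *
    (\<Prod>i\<in>{1..<k}. indicator (cball 0 D) (z i)))))"

lemma indicator_cball_measurable:
  assumes "finite I"
  shows "(\<lambda>z. \<Prod>i\<in>I. indicator (cball 0 D) (z i) :: ennreal) \<in> borel_measurable (PX I)"
proof (rule borel_measurable_prod_ennreal)
  fix i assume "i \<in> I"
  then have "(\<lambda>z. z i) \<in> measurable (PX I) borel" by measurable
  then show "(\<lambda>z. indicator (cball 0 D) (z i) :: ennreal) \<in> borel_measurable (PX I)"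
    by (rule measurable_compose) (rule borel_measurable_indicator, simp)
qed

lemma W_measurable: "W \<in> borel_measurable Q"
proof -
  define c where "c z = (\<Prod>i\<in>{1..<k}. indicator (cball 0 D) (z i) :: ennreal)" for z :: "nat \<Rightarrow> real^2"
  have [measurable]: "c \<in> borel_measurable (PX {1..<k})"
    unfolding c_def[abs_def] by (rule indicator_cball_measurable) simp
  have "W = (\<lambda>(y, x, z). (\<Prod>i<k. ennreal (u (y i))) * (ennreal (B ^ (k - 1)) * (ennreal (f x) * c z)))"
    by (simp add: W_def c_def)
  then show ?thesis unfolding case_prod_beta by simp
qed

text \<open>The factors integrate separately: \<open>u\<close> and \<open>f\<close> are probability
  densities, and each relative position contributes the area of a disk.\<close>

lemma W_finite: "(\<integral>\<^sup>+q. W q \<partial>Q) < \<infinity>"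
proof -
  interpret LX: product_sigma_finite "\<lambda>_. lborel :: (real^2) measure" ..
  interpret LY: product_sigma_finite "\<lambda>_. lborel :: real measure" ..
  interpret PX: sigma_finite_measure "PX {1..<k}" by (rule sigma_finite_PX) simp
  interpret P: pair_sigma_finite "lborel :: (real^2) measure" "PX {1..<k}" ..
  define c where "c z = (\<Prod>i\<in>{1..<k}. indicator (cball 0 D) (z i) :: ennreal)" for z :: "nat \<Rightarrow> real^2"
  have [measurable]: "c \<in> borel_measurable (PX {1..<k})"
    unfolding c_def[abs_def] by (rule indicator_cball_measurable) simp
  have W: "W (y, x, z) = (\<Prod>i<k. ennreal (u (y i))) * (ennreal (B ^ (k - 1)) * (ennreal (f x) * c z))" for y x z
    by (simp add: W_def c_def)
  have W': "(\<lambda>p. W (y, p)) \<in> borel_measurable (lborel \<Otimes>\<^sub>M PX {1..<k})" for y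
  proof -
    have "(\<lambda>p. W (y, p)) = (\<lambda>p. (\<Prod>i<k. ennreal (u (y i))) * (ennreal (B ^ (k - 1)) * (ennreal (f (fst p)) * c (snd p))))"
      by (simp add: fun_eq_iff W)
    then show ?thesis by simp
  qed
  let ?a = "\<lambda>y. \<Prod>i<k. ennreal (u (y i))"
  have "(\<integral>\<^sup>+q. W q \<partial>Q) = (\<integral>\<^sup>+y. \<integral>\<^sup>+p. W (y, p) \<partial>(lborel \<Otimes>\<^sub>M PX {1..<k}) \<partial>PY {..<k})"
    by (rule P.nn_integral_fst[OF W_measurable, symmetric])
  also have "\<dots> = (\<integral>\<^sup>+y. \<integral>\<^sup>+x. \<integral>\<^sup>+z. W (y, x, z) \<partial>PX {1..<k} \<partial>lborel \<partial>PY {..<k})"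
    by (intro nn_integral_cong PX.nn_integral_fst[symmetric] W')
  also have "\<dots> = (\<integral>\<^sup>+y. \<integral>\<^sup>+x. ?a y * (ennreal (B ^ (k - 1)) * (ennreal (f x) * (\<integral>\<^sup>+z. c z \<partial>PX {1..<k}))) \<partial>lborel \<partial>PY {..<k})"
    unfolding W by (simp add: nn_integral_cmult)
  also have "\<dots> = (\<integral>\<^sup>+y. ?a y \<partial>PY {..<k}) * (ennreal (B ^ (k - 1)) * ((\<integral>\<^sup>+x. ennreal (f x) \<partial>lborel) * (\<integral>\<^sup>+z. c z \<partial>PX {1..<k})))"
    by (simp add: nn_integral_cmult nn_integral_multc)
  also have "(\<integral>\<^sup>+z. c z \<partial>PX {1..<k}) = (\<Prod>i\<in>{1..<k}. emeasure lborel (cball (0 :: real^2) D))"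
    unfolding c_def by (subst LX.product_nn_integral_prod) (auto intro!: borel_measurable_indicator)
  also have "(\<integral>\<^sup>+y. ?a y \<partial>PY {..<k}) = (\<Prod>i<k. \<integral>\<^sup>+y. ennreal (u y) \<partial>lborel)"
    by (subst LY.product_nn_integral_prod) auto
  also have "(\<integral>\<^sup>+y. ennreal (u y) \<partial>lborel) = emeasure \<nu>Y UNIV"
    unfolding \<nu>Y_eq by (simp add: emeasure_density)
  also have "\<dots> = 1" using prob_space.emeasure_space_1[OF prob_space_\<nu>Y] by simp
  also have "(\<integral>\<^sup>+x. ennreal (f x) \<partial>lborel) = 1" using f_density by (simp add: prob_density_def)
  finally show ?thesis
    using D_pos by (simp add: emeasure_cball ennreal_power ennreal_mult_less_top)
qed

text \<open>A copy of radius 1 with its first point at the origin lies in the ball of radius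
  \<open>D\<close>, which confines the relative positions. The factors
  \<open>f (x + r *\<^sub>R z i)\<close> are bounded by \<open>B\<close>, and the remaining
  \<open>f x\<close> keeps the bound integrable in \<open>x\<close>, uniformly in
  \<open>r\<close>.\<close>

lemma F_le_W: "ennreal (F r q) \<le> W q"
proof -
  obtain y x z where q: "q = (y, x, z)" by (cases q) auto
  have U: "(\<Prod>i<k. ennreal (u (y i))) = ennreal (\<Prod>i<k. u (y i))"
    by (rule prod_ennreal) (simp add: u_nonneg)
  have I: "(\<Prod>i\<in>{1..<k}. indicator (cball 0 D) (z i)) = ennreal (\<Prod>i\<in>{1..<k}. indicator (cball 0 D) (z i))"
    by (subst prod_ennreal[symmetric]) (auto simp: ennreal_indicator)
  have "(\<Prod>i\<in>{1..<k}. f (x + r *\<^sub>R z i)) \<le> (\<Prod>i\<in>{1..<k}. B)"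
    by (intro prod_mono) (auto simp: f_nonneg f_le)
  then have 1: "(\<Prod>i\<in>{1..<k}. f (x + r *\<^sub>R z i)) \<le> B ^ (k - 1)" by simp
  have 2: "of_bool (iso {..<k} (z(0 := 0)) y 1) \<le> (\<Prod>i\<in>{1..<k}. indicator (cball 0 D) (z i) :: real)"
  proof (cases "iso {..<k} (z(0 := 0)) y 1")
    case True
    have "z i \<in> cball 0 D" if "i \<in> {1..<k}" for i
      using iso_dist[OF _ _ _ True, of 0 i] that k_pos by auto
    then show ?thesis by (simp add: indicator_def)
  qed (auto intro: prod_nonneg)
  have "F r q \<le> (\<Prod>i<k. u (y i)) * (f x * B ^ (k - 1) * (\<Prod>i\<in>{1..<k}. indicator (cball 0 D) (z i)))"
    unfolding F_def q prod.case using 1 2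
    by (intro mult_left_mono mult_mono mult_nonneg_nonneg prod_nonneg order_refl)
      (simp_all add: f_nonneg u_nonneg B_nonneg)
  then have "ennreal (F r q) \<le> ennreal ((\<Prod>i<k. u (y i)) * (f x * B ^ (k - 1) * (\<Prod>i\<in>{1..<k}. indicator (cball 0 D) (z i))))"
    by (rule ennreal_leI)
  also have "\<dots> = W q"
    unfolding W_def q U I prod.case
    by (simp add: ennreal_mult' ennreal_mult'' prod_nonneg u_nonneg f_nonneg B_nonneg mult_ac)
  finally show ?thesis .
qed

text \<open>Dominated convergence. Continuity of \<open>f\<close> is only needed at the base point,
  since all points \<open>x + \<rho> n *\<^sub>R z i\<close> tend to \<open>x\<close> for every
  fixed \<open>z\<close>.\<close>

lemma F_tendsto:
  assumes "\<rho> \<longlonglongrightarrow> 0"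
  shows "(\<lambda>n. \<integral>\<^sup>+q. ennreal (F (\<rho> n) q) \<partial>Q) \<longlonglongrightarrow> (\<integral>\<^sup>+q. ennreal (F 0 q) \<partial>Q)"
proof (rule nn_integral_dominated_convergence[where w = W])
  show "W \<in> borel_measurable Q" by (rule W_measurable)
  show "AE q in Q. (\<lambda>n. ennreal (F (\<rho> n) q)) \<longlonglongrightarrow> ennreal (F 0 q)"
  proof -
    interpret PX: sigma_finite_measure "PX {1..<k}" by (rule sigma_finite_PX) simp
    interpret P: pair_sigma_finite "lborel :: (real^2) measure" "PX {1..<k}" ..
    obtain N where N: "N \<in> null_sets lborel" "{x. \<not> isCont f x} \<subseteq> N"
      using f_cont by (auto simp: eventually_ae_filter)
    \<comment> \<open>The exceptional set restricts the base point alone, so it is a cylinder over a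
      null set.\<close>
    have "space (PY {..<k}) \<times> N \<times> space (PX {1..<k}) \<in> null_sets Q"
    proof (rule null_setsI)
      have N': "N \<in> sets lborel" "emeasure lborel N = 0" using N(1) by auto
      have S: "N \<times> space (PX {1..<k}) \<in> sets (lborel \<Otimes>\<^sub>M PX {1..<k})"
        by (rule pair_measureI[OF N'(1) sets.top])
      then show "space (PY {..<k}) \<times> N \<times> space (PX {1..<k}) \<in> sets Q"
        by (rule pair_measureI[OF sets.top])
      show "emeasure Q (space (PY {..<k}) \<times> N \<times> space (PX {1..<k})) = 0"
        using N'(2) by (simp add: P.emeasure_pair_measure_Times[OF sets.top S]
            PX.emeasure_pair_measure_Times[OF N'(1) sets.top])
    qed
    then have "AE q in Q. q \<notin> space (PY {..<k}) \<times> N \<times> space (PX {1..<k})" by (rule AE_not_in)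
    then show ?thesis
      using AE_space
    proof eventually_elim
      fix q assume q: "q \<notin> space (PY {..<k}) \<times> N \<times> space (PX {1..<k})" "q \<in> space Q"
      obtain y x z where yxz: "q = (y, x, z)" by (cases q) auto
      with q have "x \<notin> N" by (auto simp: space_pair_measure)
      then have c: "isCont f x" using N by auto
      have "(\<lambda>n. x + \<rho> n *\<^sub>R z i) \<longlonglongrightarrow> x + 0 *\<^sub>R z i" for i
        using assms by (intro tendsto_intros)
      then have "(\<lambda>n. f (x + \<rho> n *\<^sub>R z i)) \<longlonglongrightarrow> f (x + 0 *\<^sub>R z i)" for i
        using c by (intro isCont_tendsto_compose[where g = f]) auto
      then have "(\<lambda>n. F (\<rho> n) q) \<longlonglongrightarrow> F 0 q"
        unfolding F_def yxz prod.case by (intro tendsto_mult tendsto_const tendsto_prod)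
      then show "(\<lambda>n. ennreal (F (\<rho> n) q)) \<longlonglongrightarrow> ennreal (F 0 q)" by (rule tendsto_ennrealI)
    qed
  qed
  show "AE q in Q. ennreal (F (\<rho> j) q) \<le> W q" for j using F_le_W by simp
  show "(\<integral>\<^sup>+q. W q \<partial>Q) < \<infinity>" by (rule W_finite)
qed simp_all

text \<open>\<open>mu_const\<close> is built from Bochner integrals, so finiteness, inherited from
  \<open>W\<close>, must be known before the two sides can be compared. The factorial cancels the
  one in \<open>mu_const\<close>, which counts unordered sets of points.\<close>

lemma nn_integral_F_0: "(\<integral>\<^sup>+q. ennreal (F 0 q) \<partial>Q) = ennreal (fact k * mu_const \<alpha> f T)"
proof -
  let ?R = "lborel \<Otimes>\<^sub>M PX {1..<k}"
  interpret PX: sigma_finite_measure "PX {1..<k}" by (rule sigma_finite_PX) simp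
  interpret P: pair_sigma_finite "lborel :: (real^2) measure" "PX {1..<k}" ..
  define H where "H y p = of_bool (iso {..<k} ((snd p)(0 := 0)) y 1) * f (fst p) ^ k" for y p
  define box :: "(nat \<Rightarrow> real) set" where "box = (\<Pi>\<^sub>E i\<in>{..<k}. {0..2 * pi})"
  define J where "J y = (\<integral>\<^sup>+p. ennreal (H y p) \<partial>?R)" for y
  have H0: "0 \<le> H y p" for y p by (simp add: H_def f_nonneg)
  note [measurable] = measurable_iso_origin
  have Hm: "(\<lambda>q. H (fst q) (snd q)) \<in> borel_measurable Q" unfolding H_def by measurable
  have Hy: "H y \<in> borel_measurable ?R" if "y \<in> space (PY {..<k})" for y
    using measurable_compose[OF measurable_Pair1'[OF that] Hm] by simp
  have Jm[measurable]: "J \<in> borel_measurable (PY {..<k})"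
    unfolding J_def using measurable_compose[OF Hm measurable_ennreal]
    by (intro P.borel_measurable_nn_integral) (simp add: case_prod_beta)
  have box[measurable]: "box \<in> sets (PY {..<k})"
    unfolding box_def by (intro sets_PiM_I_finite) auto
  have F: "F 0 (y, p) = (\<Prod>i<k. u (y i)) * H y p" for y p
  proof -
    \<comment> \<open>At \<open>r = 0\<close> all \<open>k\<close> density factors are evaluated at
      the base point, which produces \<open>f^k\<close>.\<close>
    have "f (fst p) * (\<Prod>i\<in>{1..<k}. f (fst p)) = f (fst p) ^ k"
      using k_pos by (simp flip: power_Suc)
    then show ?thesis by (simp add: F_def H_def case_prod_beta mult_ac)
  qed
  have U: "(\<Prod>i<k. u (y i)) = indicator box y / (2 * pi) ^ k" if "y \<in> space (PY {..<k})" for y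
  proof -
    have "y \<in> extensional {..<k}" using that by (auto simp: space_PiM PiE_def)
    then have "indicator box y = (\<Prod>i<k. indicator {0..2 * pi} (y i) :: real)"
      by (auto simp: box_def indicator_def PiE_def Pi_def)
    then show ?thesis by (simp add: u_def prod_dividef)
  qed
  have "(\<integral>\<^sup>+q. ennreal (F 0 q) \<partial>Q) = (\<integral>\<^sup>+y. \<integral>\<^sup>+p. ennreal (F 0 (y, p)) \<partial>?R \<partial>PY {..<k})"
    by (rule P.nn_integral_fst[symmetric]) (rule measurable_compose[OF F_measurable measurable_ennreal])
  also have "\<dots> = (\<integral>\<^sup>+y. ennreal (1 / (2 * pi) ^ k) * (indicator box y * J y) \<partial>PY {..<k})"
  proof (rule nn_integral_cong)
    fix y assume y: "y \<in> space (PY {..<k})"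
    have "(\<integral>\<^sup>+p. ennreal (F 0 (y, p)) \<partial>?R) = (\<integral>\<^sup>+p. ennreal (indicator box y / (2 * pi) ^ k) * ennreal (H y p) \<partial>?R)"
      unfolding F U[OF y] by (intro nn_integral_cong ennreal_mult') simp
    also have "\<dots> = ennreal (indicator box y / (2 * pi) ^ k) * J y"
      unfolding J_def using Hy[OF y] by (intro nn_integral_cmult) auto
    finally show "(\<integral>\<^sup>+p. ennreal (F 0 (y, p)) \<partial>?R) = ennreal (1 / (2 * pi) ^ k) * (indicator box y * J y)"
      by (simp add: indicator_def)
  qed
  also have "\<dots> = ennreal (1 / (2 * pi) ^ k) * (\<integral>\<^sup>+y. indicator box y * J y \<partial>PY {..<k})"
    by (intro nn_integral_cmult) measurable
  finally have eq: "(\<integral>\<^sup>+q. ennreal (F 0 q) \<partial>Q) = ennreal (1 / (2 * pi) ^ k) * (\<integral>\<^sup>+y. indicator box y * J y \<partial>PY {..<k})" .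
  have "(\<integral>\<^sup>+q. ennreal (F 0 q) \<partial>Q) \<le> (\<integral>\<^sup>+q. W q \<partial>Q)"
    by (intro nn_integral_mono F_le_W)
  then have "(\<integral>\<^sup>+q. ennreal (F 0 q) \<partial>Q) < \<infinity>" using W_finite by (rule le_less_trans)
  then have fin: "(\<integral>\<^sup>+y. indicator box y * J y \<partial>PY {..<k}) < \<infinity>"
    unfolding eq by (auto simp: ennreal_mult_less_top ennreal_mult_eq_top_iff top.not_eq_extremum)
  have JI: "AE y in PY {..<k}. indicator box y * J y \<noteq> \<infinity>"
    by (rule nn_integral_PInf_AE) (use fin in simp_all)
  let ?I = "\<lambda>y. \<integral>p. H y p \<partial>?R"
  \<comment> \<open>Holds even when \<open>J y\<close> is infinite, as both sides then take the
    default value 0. Within \<open>box\<close> this happens only on a null set, by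
    \<open>JI\<close>.\<close>
  have I: "?I y = enn2real (J y)" if "y \<in> space (PY {..<k})" for y
    unfolding J_def by (rule integral_eq_nn_integral) (use Hy[OF that] H0 in auto)
  have "(LINT y : box | PY {..<k}. ?I y) = (\<integral>y. indicator box y * enn2real (J y) \<partial>PY {..<k})"
    unfolding set_lebesgue_integral_def by (intro Bochner_Integration.integral_cong) (simp_all add: I)
  also have "\<dots> = enn2real (\<integral>\<^sup>+y. ennreal (indicator box y * enn2real (J y)) \<partial>PY {..<k})"
    by (rule integral_eq_nn_integral) auto
  also have "(\<integral>\<^sup>+y. ennreal (indicator box y * enn2real (J y)) \<partial>PY {..<k}) =
      (\<integral>\<^sup>+y. indicator box y * J y \<partial>PY {..<k})"
    by (rule nn_integral_cong_AE, use JI in eventually_elim)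
      (auto simp: indicator_def ennreal_enn2real_if top.not_eq_extremum)
  finally have L: "(LINT y : box | PY {..<k}. ?I y) = enn2real (\<integral>\<^sup>+y. indicator box y * J y \<partial>PY {..<k})" .
  have "mu_const \<alpha> f T = 1 / (fact k * (2 * pi) ^ k) * (LINT y : box | PY {..<k}. ?I y)"
    unfolding mu_const_def Let_def card_T box_def H_def h_ind_def
    by (simp add: case_prod_unfold of_bool_def)
  then have mu: "fact k * mu_const \<alpha> f T = 1 / (2 * pi) ^ k * enn2real (\<integral>\<^sup>+y. indicator box y * J y \<partial>PY {..<k})"
    unfolding L by simp
  show ?thesis
    unfolding eq mu using fin by (subst ennreal_mult') simp_all
qed

lemma prob_iso_tendsto:
  assumes \<rho>: "\<rho> \<longlonglongrightarrow> 0" and pos: "\<And>n. n \<ge> 1 \<Longrightarrow> 0 < \<rho> n"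
  shows "(\<lambda>n. prob {\<omega> \<in> space M. iso {..<k} (\<lambda>i. X i \<omega>) (\<lambda>i. Y i \<omega>) (\<rho> n)} / \<rho> n ^ (2 * (k - 1)))
    \<longlonglongrightarrow> fact k * mu_const \<alpha> f T"
proof -
  have "(\<lambda>n. enn2real (\<integral>\<^sup>+q. ennreal (F (\<rho> n) q) \<partial>Q)) \<longlonglongrightarrow> enn2real (ennreal (fact k * mu_const \<alpha> f T))"
    using F_tendsto[OF \<rho>] unfolding nn_integral_F_0 by (intro tendsto_enn2real) auto
  moreover have "enn2real (ennreal (fact k * mu_const \<alpha> f T)) = fact k * mu_const \<alpha> f T"
    by (rule enn2real_ennreal) (simp add: mu_const_def Let_def h_ind_def f_nonneg case_prod_beta
        set_lebesgue_integral_def)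
  moreover have "eventually (\<lambda>n. enn2real (\<integral>\<^sup>+q. ennreal (F (\<rho> n) q) \<partial>Q) =
      prob {\<omega> \<in> space M. iso {..<k} (\<lambda>i. X i \<omega>) (\<lambda>i. Y i \<omega>) (\<rho> n)} / \<rho> n ^ (2 * (k - 1))) sequentially"
    using eventually_ge_at_top[of 1]
  proof eventually_elim
    case (elim n)
    then show ?case
      using emeasure_iso[of "{..<k}" "\<rho> n"] pos[of n] by (simp add: measure_def enn2real_mult)
  qed
  ultimately show ?thesis by (auto intro: Lim_transform_eventually)
qed

end

section \<open>Almost sure convergence\<close>

abbreviation Z :: "nat \<Rightarrow> 'w \<Rightarrow> (real^2) \<times> real" where "Z \<equiv> \<lambda>i \<omega>. (X i \<omega>, Y i \<omega>)"

definition near :: "real \<Rightarrow> (real^2) \<times> real \<Rightarrow> (real^2) \<times> real \<Rightarrow> bool" where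
  "near r = (\<lambda>u v. dist (fst u) (fst v) \<le> D * r)"

definition copy :: "real \<Rightarrow> nat set \<Rightarrow> (nat \<Rightarrow> (real^2) \<times> real) \<Rightarrow> real" where
  "copy r A z = of_bool (digraph_iso (sector_digraph \<alpha> A (\<lambda>i. fst (z i)) (\<lambda>i. snd (z i)) r) T)"

definition copy_prob :: "real \<Rightarrow> real" where
  "copy_prob r = prob {\<omega> \<in> space M. digraph_iso (sector_digraph \<alpha> {..<k} (\<lambda>i. X i \<omega>) (\<lambda>i. Y i \<omega>) r) T}"

text \<open>The density bound times the area of a disk of radius \<open>D * r\<close>. It takes the
  place of \<open>q\<close>.\<close>

definition near_prob :: "real \<Rightarrow> real" where "near_prob r = B * pi * (D * r)\<^sup>2"

lemma near_measurable:
  "Measurable.pred ((borel \<Otimes>\<^sub>M borel) \<Otimes>\<^sub>M (borel \<Otimes>\<^sub>M borel)) (\<lambda>(u, v). near r u v)"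
  unfolding near_def case_prod_beta by measurable

text \<open>The diameter bound gives the locality of copies, the density bound controls nearness,
  and the common mean comes from the integral formula.\<close>

lemma local_statistic:
  assumes r: "0 < r" and q: "near_prob r \<le> 1"
  shows "local_statistic M (borel \<Otimes>\<^sub>M borel) Z (copy r) (near r) k (copy_prob r) (near_prob r)"
proof
  show "indep_vars (\<lambda>_. borel \<Otimes>\<^sub>M borel) Z UNIV" by (rule XY_indep_vars)
  show "Measurable.pred ((borel \<Otimes>\<^sub>M borel) \<Otimes>\<^sub>M (borel \<Otimes>\<^sub>M borel)) (\<lambda>(u, v). near r u v)"
    by (rule near_measurable)
  show "0 \<le> near_prob r" unfolding near_prob_def using B_nonneg by simp
  show "near_prob r \<le> 1" "1 \<le> k" by fact+ (rule k_pos)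
  show "0 \<le> copy r A z" "copy r A z \<le> 1" for A z by (simp_all add: copy_def)
  show "prob {\<omega> \<in> space M. near r u (Z b \<omega>)} \<le> near_prob r" for u b
  proof -
    have "emeasure M {\<omega> \<in> space M. near r u (Z b \<omega>)} = emeasure (distr M borel (X b)) (cball (fst u) (D * r))"
      by (subst emeasure_distr) (auto simp: near_def vimage_def Int_def conj_commute)
    also have "\<dots> \<le> ennreal (near_prob r)"
      unfolding distr_X near_prob_def using r D_pos by (intro prob_density_le_cball f_density f_le) auto
    finally show ?thesis
      unfolding near_prob_def using B_nonneg by (simp add: emeasure_eq_measure)
  qed
  fix A :: "nat set" assume A: "finite A" "card A = k"
  show "copy r A \<in> borel_measurable (Pi\<^sub>M A (\<lambda>_. borel \<Otimes>\<^sub>M borel))"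
  proof -
    have "Measurable.pred (Pi\<^sub>M A (\<lambda>_. borel \<Otimes>\<^sub>M borel))
        (\<lambda>z. digraph_iso (sector_digraph \<alpha> A (\<lambda>i. fst (z i)) (\<lambda>i. snd (z i)) r) T)"
      using A T card_T by (intro measurable_digraph_iso_sector_digraph) auto
    then show ?thesis unfolding copy_def[abs_def] by measurable
  qed
  show "copy r A (restrict z A) = copy r A z" for z
  proof -
    have "digraph_iso (sector_digraph \<alpha> A (\<lambda>i. fst (restrict z A i)) (\<lambda>i. snd (restrict z A i)) r) T =
        digraph_iso (sector_digraph \<alpha> A (\<lambda>i. fst (z i)) (\<lambda>i. snd (z i)) r) T"
      by (rule digraph_iso_sector_digraph_cong) auto
    then show ?thesis by (simp add: copy_def)
  qed
  show "near r (z a) (z b)" if "copy r A z \<noteq> 0" "a \<in> A" "b \<in> A" for z a b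
    using that iso_dist[OF A, of r "\<lambda>i. fst (z i)" "\<lambda>i. snd (z i)" a b] r
    by (auto simp: copy_def near_def)
  let ?S = "\<lambda>A. {\<omega> \<in> space M. digraph_iso (sector_digraph \<alpha> A (\<lambda>i. X i \<omega>) (\<lambda>i. Y i \<omega>) r) T}"
  have S: "?S A \<in> events"
    using measurable_digraph_iso_sector_digraph[OF T A(1), of "\<lambda>\<omega> i. X i \<omega>" M "\<lambda>\<omega> i. Y i \<omega>" \<alpha> r] A card_T
    by (simp add: pred_def)
  have "expectation (\<lambda>\<omega>. copy r A (\<lambda>i. Z i \<omega>)) = expectation (indicator (?S A))"
    by (rule Bochner_Integration.integral_cong) (auto simp: copy_def indicator_def)
  also have "\<dots> = prob (?S A)" using S by simp
  \<comment> \<open>\<open>emeasure_iso\<close> has a right-hand side that does not mention the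
    index set.\<close>
  also have "\<dots> = copy_prob r"
    using emeasure_iso[OF A r] emeasure_iso[of "{..<k}" r] r by (simp add: copy_prob_def measure_def)
  finally show "expectation (\<lambda>\<omega>. copy r A (\<lambda>i. Z i \<omega>)) = copy_prob r" .
qed

section \<open>Sample points are almost surely distinct\<close>

lemma near_prob_tendsto: "\<rho> \<longlonglongrightarrow> 0 \<Longrightarrow> (\<lambda>n. near_prob (\<rho> n)) \<longlonglongrightarrow> 0"
  unfolding near_prob_def by (auto intro!: tendsto_eq_intros)

text \<open>Coinciding points are near each other at every scale, so the probability is at most
  \<open>near_prob\<close> of arbitrarily small radii. The bound is the case \<open>U = {i}\<close>
  of \<open>mean_mult_E_le\<close> with the constant function 1, available once
  \<open>near_prob\<close> is at most 1.\<close>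

lemma prob_X_eq:
  assumes "i \<noteq> j"
  shows "prob {\<omega> \<in> space M. X i \<omega> = X j \<omega>} = 0"
proof -
  let ?\<rho> = "\<lambda>n. 1 / real (Suc n)"
  have lim: "(\<lambda>n. near_prob (?\<rho> n)) \<longlonglongrightarrow> 0"
    using LIMSEQ_inverse_real_of_nat by (intro near_prob_tendsto) (simp add: inverse_eq_divide)
  have "eventually (\<lambda>n. prob {\<omega> \<in> space M. X i \<omega> = X j \<omega>} \<le> near_prob (?\<rho> n)) sequentially"
    using order_tendstoD(2)[OF lim zero_less_one]
  proof eventually_elim
    case (elim n)
    interpret S: local_statistic M "borel \<Otimes>\<^sub>M borel" Z "copy (?\<rho> n)" "near (?\<rho> n)" k "copy_prob (?\<rho> n)" "near_prob (?\<rho> n)"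
      using elim by (intro local_statistic) auto
    let ?N = "{\<omega> \<in> space M. near (?\<rho> n) (Z i \<omega>) (Z j \<omega>)}"
    have N: "?N \<in> events" unfolding near_def by measurable
    have "prob {\<omega> \<in> space M. X i \<omega> = X j \<omega>} \<le> prob ?N"
      using N D_pos by (intro finite_measure_mono) (auto simp: near_def)
    also have "\<dots> = expectation (indicator ?N)" using N by simp
    also have "\<dots> = S.mean (\<lambda>z. 1 * of_bool (near (?\<rho> n) (z i) (z j)))"
      unfolding S.mean_def by (rule Bochner_Integration.integral_cong) (auto simp: indicator_def)
    also have "\<dots> \<le> near_prob (?\<rho> n) * S.mean (\<lambda>_. 1)"
      using assms by (intro S.mean_mult_E_le[where U = "{i}"] S.local_fun_1) auto
    finally show ?case by (simp add: S.mean_def prob_space)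
  qed
  then have "prob {\<omega> \<in> space M. X i \<omega> = X j \<omega>} \<le> 0"
    using tendsto_lowerbound[OF lim] by simp
  then show ?thesis using measure_nonneg[of M] by (simp add: antisym)
qed

lemma AE_inj_X: "AE \<omega> in M. inj (\<lambda>i. X i \<omega>)"
proof -
  have "AE \<omega> in M. i \<noteq> j \<longrightarrow> X i \<omega> \<noteq> X j \<omega>" for i j
  proof (cases "i = j")
    case False
    have "{\<omega> \<in> space M. X i \<omega> = X j \<omega>} \<in> events" by measurable
    then have "AE \<omega> in M. \<omega> \<notin> {\<omega> \<in> space M. X i \<omega> = X j \<omega>}"
      using prob_X_eq[OF False] by (subst (asm) prob_eq_0) auto
    then show ?thesis using AE_space by eventually_elim auto
  qed simp
  then have "AE \<omega> in M. \<forall>i j. i \<noteq> j \<longrightarrow> X i \<omega> \<noteq> X j \<omega>" by (simp add: AE_all_countable)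
  then show ?thesis by eventually_elim (auto intro: injI)
qed

section \<open>Fluctuations of the normalised count\<close>

definition centred :: "(nat \<Rightarrow> real) \<Rightarrow> nat \<Rightarrow> 'w \<Rightarrow> real" where
  "centred r n \<omega> = (\<Sum>A | A \<subseteq> {..<n} \<and> card A = k. copy (r n) A (\<lambda>i. Z i \<omega>) - copy_prob (r n)) /
    (real n ^ k * r n ^ (2 * (k - 1)))"

text \<open>Splits the normalised count into a random fluctuation and a deterministic mean, whose
  limits are found separately.\<close>

lemma induced_count_eq:
  assumes "inj (\<lambda>i. X i \<omega>)"
  shows "real (induced_count (random_sector_digraph \<alpha> X Y n (r n) \<omega>) T) / (real n ^ k * r n ^ (2 * (k - 1))) =
    centred r n \<omega> + real (n choose k) / real n ^ k * (copy_prob (r n) / r n ^ (2 * (k - 1)))"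
proof -
  let ?K = "{A. A \<subseteq> {..<n} \<and> card A = k}"
  have "inj_on (\<lambda>i. X i \<omega>) {..<n}" using assms by (rule inj_on_subset) simp
  then have "induced_count (random_sector_digraph \<alpha> X Y n (r n) \<omega>) T =
    card {A. A \<subseteq> {..<n} \<and> card A = k \<and> digraph_iso (sector_digraph \<alpha> A (\<lambda>i. X i \<omega>) (\<lambda>i. Y i \<omega>) (r n)) T}"
    unfolding random_sector_digraph_def by (simp add: induced_count_sector_digraph card_T)
  also have "{A. A \<subseteq> {..<n} \<and> card A = k \<and> digraph_iso (sector_digraph \<alpha> A (\<lambda>i. X i \<omega>) (\<lambda>i. Y i \<omega>) (r n)) T} =
      ?K \<inter> {A. digraph_iso (sector_digraph \<alpha> A (\<lambda>i. X i \<omega>) (\<lambda>i. Y i \<omega>) (r n)) T}" by auto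
  also have "real (card \<dots>) = (\<Sum>A\<in>?K. copy (r n) A (\<lambda>i. Z i \<omega>))"
    unfolding copy_def by (subst sum_of_bool_eq) (auto simp: Int_def)
  also have "\<dots> = (\<Sum>A\<in>?K. copy (r n) A (\<lambda>i. Z i \<omega>) - copy_prob (r n)) + real (n choose k) * copy_prob (r n)"
    using n_subsets[of "{..<n}" k] by (simp add: sum_subtractf)
  finally show ?thesis unfolding centred_def by (simp add: add_divide_distrib)
qed

text \<open>With \<open>c = B * pi * D\<^sup>2\<close> the nearness bound is
  \<open>c * (r n)\<^sup>2\<close>. This turns \<open>S n\<close> into \<open>b * N\<close> and
  bounds \<open>L n\<close> by \<open>a * (1 + N / n)\<close>, the shape that
  \<open>moment4_ratio_le\<close> expects.\<close>

lemma centred_moment4_le: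
  assumes r: "0 < r n" "near_prob (r n) \<le> 1" and n: "1 \<le> n" and N: "1 \<le> real n ^ k * r n ^ (2 * (k - 1))"
  defines "b \<equiv> 2 * (B * pi * D\<^sup>2) ^ (k - 1)"
    and "a \<equiv> 2 ^ (3 * k + 1) * real k * (1 + (B * pi * D\<^sup>2) ^ (k - 1))"
  shows "centred r n \<in> borel_measurable M" "integrable M (\<lambda>\<omega>. centred r n \<omega> ^ 4)"
    "expectation (\<lambda>\<omega>. centred r n \<omega> ^ 4) \<le> (24 * b * a ^ 3 + 6 * b\<^sup>2 * a\<^sup>2) *
      (1 / (real n ^ k * r n ^ (2 * (k - 1)))\<^sup>2 + 1 / (real n)\<^sup>2)"
proof -
  interpret S: local_statistic M "borel \<Otimes>\<^sub>M borel" Z "copy (r n)" "near (r n)" k "copy_prob (r n)" "near_prob (r n)"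
    using r by (rule local_statistic)
  let ?N = "real n ^ k * r n ^ (2 * (k - 1))"
  let ?s = "\<lambda>\<omega>. \<Sum>A\<in>S.K n. copy (r n) A (\<lambda>i. Z i \<omega>) - copy_prob (r n)"
  have c: "centred r n \<omega> = ?s \<omega> / ?N" for \<omega> by (simp add: centred_def S.K_def)
  have [measurable]: "(\<lambda>\<omega>. copy (r n) A (\<lambda>i. Z i \<omega>)) \<in> borel_measurable M" if "A \<in> S.K n" for A
    using S.local_fun_measurable[OF S.local_fun_h] S.K_D[OF that] by auto
  show m: "centred r n \<in> borel_measurable M" unfolding c[abs_def] by measurable
  have "0 \<le> copy_prob (r n)" "copy_prob (r n) \<le> 1" by (simp_all add: copy_prob_def)
  then have d: "\<bar>copy (r n) A (\<lambda>i. Z i \<omega>) - copy_prob (r n)\<bar> \<le> 1" for A \<omega>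
    using S.h_nonneg[of A "\<lambda>i. Z i \<omega>"] S.h_le_1[of A "\<lambda>i. Z i \<omega>"] by linarith
  have s: "\<bar>?s \<omega>\<bar> \<le> real (card (S.K n))" for \<omega>
  proof -
    have "\<bar>?s \<omega>\<bar> \<le> (\<Sum>A\<in>S.K n. \<bar>copy (r n) A (\<lambda>i. Z i \<omega>) - copy_prob (r n)\<bar>)"
      by (rule sum_abs)
    also have "\<dots> \<le> (\<Sum>A\<in>S.K n. 1)" by (intro sum_mono d)
    finally show ?thesis by simp
  qed
  show i: "integrable M (\<lambda>\<omega>. centred r n \<omega> ^ 4)"
  proof (rule integrable_const_bound[of _ "(real (card (S.K n)) / ?N) ^ 4"])
    have p: "\<bar>?s \<omega> / ?N\<bar> \<le> real (card (S.K n)) / ?N" for \<omega>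
      unfolding abs_divide using s[of \<omega>] N by (intro frac_le) auto
    have "norm (centred r n \<omega> ^ 4) \<le> (real (card (S.K n)) / ?N) ^ 4" for \<omega>
      by (subst norm_power, unfold c real_norm_def, intro power_mono p) simp
    then show "AE \<omega> in M. norm (centred r n \<omega> ^ 4) \<le> (real (card (S.K n)) / ?N) ^ 4" by simp
  qed (use m in measurable)
  define x where "x = real n * near_prob (r n)"
  let ?c = "B * pi * D\<^sup>2"
  have c0: "0 \<le> ?c" using B_nonneg by simp
  have x0: "0 \<le> x" unfolding x_def using S.q_nonneg by simp
  have q: "near_prob (r n) = ?c * (r n)\<^sup>2" by (simp add: near_prob_def power_mult_distrib)
  have SN: "S.S n = b * ?N"
    unfolding S.S_def by (simp add: b_def q power_mult_distrib power_mult)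
  \<comment> \<open>The link between \<open>L\<close> and \<open>N\<close>: dividing
    \<open>N\<close> by \<open>n\<close> leaves \<open>k - 1\<close> factors
    \<open>n * (r n)\<^sup>2\<close>.\<close>
  have xk: "x ^ (k - 1) = ?c ^ (k - 1) * (?N / real n)"
  proof -
    have "real n ^ k = real n ^ (k - 1) * real n" using k_pos by (metis Suc_diff_1 One_nat_def Suc_le_lessD power_Suc2)
    then show ?thesis using n by (simp add: x_def q power_mult_distrib power_mult)
  qed
  \<comment> \<open>Whether \<open>x\<close> is small or large, each power lies below 1 plus the top
    power, so the number \<open>k\<close> of summands enters \<open>a\<close>.\<close>
  have "(\<Sum>j<k. x ^ j) \<le> (\<Sum>j<k. 1 + x ^ (k - 1))"
    by (intro sum_mono power_le_1_plus_power x0) auto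
  also have "\<dots> = real k * (1 + ?c ^ (k - 1) * (?N / real n))" by (simp add: xk del: One_nat_def)
  also have "\<dots> \<le> real k * ((1 + ?c ^ (k - 1)) * (1 + ?N / real n))"
  proof (rule mult_left_mono)
    have "0 \<le> ?N / real n" "0 \<le> ?c ^ (k - 1)" using N c0 by simp_all
    then show "1 + ?c ^ (k - 1) * (?N / real n) \<le> (1 + ?c ^ (k - 1)) * (1 + ?N / real n)"
      unfolding distrib_left distrib_right by linarith
  qed simp
  finally have "S.L n \<le> a * (1 + ?N / real n)"
    unfolding S.L_def a_def x_def by simp
  then have "(6 * (b * ?N * S.L n ^ 3) + 3 * ((b * ?N)\<^sup>2 * (S.L n)\<^sup>2)) / ?N ^ 4
      \<le> (24 * b * a ^ 3 + 6 * b\<^sup>2 * a\<^sup>2) * (1 / ?N\<^sup>2 + 1 / (real n)\<^sup>2)"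
    using N n c0 S.L_nonneg by (intro moment4_ratio_le) (auto simp: a_def b_def)
  moreover have "expectation (\<lambda>\<omega>. centred r n \<omega> ^ 4) = expectation (\<lambda>\<omega>. ?s \<omega> ^ 4) / ?N ^ 4"
    unfolding c by (simp add: power_divide)
  moreover have "expectation (\<lambda>\<omega>. ?s \<omega> ^ 4) / ?N ^ 4 \<le> (6 * (S.S n * S.L n ^ 3) + 3 * ((S.S n)\<^sup>2 * (S.L n)\<^sup>2)) / ?N ^ 4"
    using N S.fourth_central_moment_le[of n] by (intro divide_right_mono) auto
  ultimately show "expectation (\<lambda>\<omega>. centred r n \<omega> ^ 4) \<le> (24 * b * a ^ 3 + 6 * b\<^sup>2 * a\<^sup>2) *
      (1 / ?N\<^sup>2 + 1 / (real n)\<^sup>2)"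
    unfolding SN by linarith
qed

text \<open>The growth condition makes \<open>1 / N ^ 2\<close> at most a multiple of
  \<open>n powr (- 1 - \<delta>)\<close>. Both terms of the moment bound are then summable.\<close>

lemma AE_centred_tendsto_0:
  fixes r :: "nat \<Rightarrow> real"
  assumes pos: "\<And>n. n \<ge> 1 \<Longrightarrow> r n > 0" and r: "r \<longlonglongrightarrow> 0" and \<delta>: "0 < \<delta>"
    and lim: "liminf (\<lambda>n. ereal (real n powr (2 * real k - 1 - \<delta>) * r n ^ (4 * (k - 1)))) > 0"
  shows "AE \<omega> in M. (\<lambda>n. centred r n \<omega>) \<longlonglongrightarrow> 0"
proof -
  let ?N = "\<lambda>n. real n ^ k * r n ^ (2 * (k - 1))"
  obtain c where c: "0 < c" "ereal c < liminf (\<lambda>n. ereal (real n powr (2 * real k - 1 - \<delta>) * r n ^ (4 * (k - 1))))"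
    using ereal_dense2[OF lim] by (auto simp: zero_ereal_def)
  have "eventually (\<lambda>n. ereal c < ereal (real n powr (2 * real k - 1 - \<delta>) * r n ^ (4 * (k - 1)))) sequentially"
    using c(2) by (rule less_LiminfD)
  then have ev_c: "eventually (\<lambda>n. c < real n powr (2 * real k - 1 - \<delta>) * r n ^ (4 * (k - 1))) sequentially"
    by simp
  have ev_N: "eventually (\<lambda>n. c * real n powr (1 + \<delta>) \<le> (?N n)\<^sup>2) sequentially"
    using ev_c eventually_ge_at_top[of 1]
  proof eventually_elim
    case (elim n)
    \<comment> \<open>The exponents add up to \<open>2 * k\<close>, which completes the expression
      in the hypothesis to the square of \<open>N\<close>.\<close>
    have "real n powr (1 + \<delta>) * c \<le> real n powr (1 + \<delta>) * (real n powr (2 * real k - 1 - \<delta>) * r n ^ (4 * (k - 1)))"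
      using elim by (intro mult_left_mono) auto
    also have "\<dots> = real n powr (2 * real k) * r n ^ (4 * (k - 1))"
      by (simp flip: powr_add mult.assoc)
    also have "real n powr (2 * real k) = (real n ^ k)\<^sup>2"
      using elim powr_realpow[of "real n" "2 * k"] by (simp add: power_mult[symmetric] mult.commute)
    also have "r n ^ (4 * (k - 1)) = (r n ^ (2 * (k - 1)))\<^sup>2"
      by (simp add: power_mult[symmetric] mult.commute)
    finally show ?case by (simp add: power_mult_distrib mult.commute)
  qed
  \<comment> \<open>Needed for \<open>N \<ge> 1\<close> at large \<open>n\<close>, where the moment
    estimate applies.\<close>
  have "filterlim (\<lambda>n. c * real n powr (1 + \<delta>)) at_top sequentially"
    using c(1) \<delta> by real_asymp
  then have ev_big: "eventually (\<lambda>n. 1 \<le> c * real n powr (1 + \<delta>)) sequentially"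
    by (simp add: filterlim_at_top)
  have ev_q: "eventually (\<lambda>n. near_prob (r n) < 1) sequentially"
    using near_prob_tendsto[OF r] by (rule order_tendstoD(2)) simp
  define C where "C = (24 * (2 * (B * pi * D\<^sup>2) ^ (k - 1)) * (2 ^ (3 * k + 1) * real k * (1 + (B * pi * D\<^sup>2) ^ (k - 1))) ^ 3 +
    6 * (2 * (B * pi * D\<^sup>2) ^ (k - 1))\<^sup>2 * (2 ^ (3 * k + 1) * real k * (1 + (B * pi * D\<^sup>2) ^ (k - 1)))\<^sup>2)"
  have C0: "0 \<le> C" unfolding C_def using B_nonneg by (auto intro!: add_nonneg_nonneg mult_nonneg_nonneg)
  have ev: "eventually (\<lambda>n. centred r n \<in> borel_measurable M \<and> integrable M (\<lambda>\<omega>. centred r n \<omega> ^ 4) \<and>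
      expectation (\<lambda>\<omega>. centred r n \<omega> ^ 4) \<le> C * (1 / c * real n powr (- 1 - \<delta>) + real n powr - 2)) sequentially"
    using ev_N ev_big ev_q eventually_ge_at_top[of 1]
  proof eventually_elim
    case (elim n)
    have N0: "0 \<le> ?N n" using pos[of n] elim by simp
    have "1 \<le> (?N n)\<^sup>2" using elim by linarith
    then have N1: "1 \<le> ?N n" using N0 by (metis abs_le_square_iff abs_of_nonneg abs_one one_power2)
    have m: "centred r n \<in> borel_measurable M" "integrable M (\<lambda>\<omega>. centred r n \<omega> ^ 4)"
      "expectation (\<lambda>\<omega>. centred r n \<omega> ^ 4) \<le> C * (1 / (?N n)\<^sup>2 + 1 / (real n)\<^sup>2)"
      unfolding C_def by (rule centred_moment4_le; use pos[of n] elim N1 in simp)+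
    have "1 / (?N n)\<^sup>2 \<le> 1 / (c * real n powr (1 + \<delta>))"
      using elim by (intro frac_le) auto
    also have "\<dots> = 1 / c * real n powr (- (1 + \<delta>))"
      unfolding powr_minus_divide by simp
    also have "- (1 + \<delta>) = - 1 - \<delta>" by simp
    finally have "1 / (?N n)\<^sup>2 \<le> 1 / c * real n powr (- 1 - \<delta>)" .
    moreover have "1 / (real n)\<^sup>2 = real n powr - 2"
      using elim by (simp add: powr_minus_divide)
    ultimately have "C * (1 / (?N n)\<^sup>2 + 1 / (real n)\<^sup>2) \<le> C * (1 / c * real n powr (- 1 - \<delta>) + real n powr - 2)"
      using C0 by (intro mult_left_mono) auto
    then have "expectation (\<lambda>\<omega>. centred r n \<omega> ^ 4) \<le> C * (1 / c * real n powr (- 1 - \<delta>) + real n powr - 2)"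
      using m(3) by (rule order_trans[rotated])
    then show ?case using m(1,2) by blast
  qed
  then obtain n0 where n0: "\<And>n. n \<ge> n0 \<Longrightarrow> centred r n \<in> borel_measurable M \<and> integrable M (\<lambda>\<omega>. centred r n \<omega> ^ 4) \<and>
      expectation (\<lambda>\<omega>. centred r n \<omega> ^ 4) \<le> C * (1 / c * real n powr (- 1 - \<delta>) + real n powr - 2)"
    by (auto simp: eventually_sequentially)
  have "summable (\<lambda>n. real n powr (- 1 - \<delta>))" "summable (\<lambda>n. real n powr - 2)"
    using \<delta> by (simp_all add: summable_real_powr_iff)
  then have w: "summable (\<lambda>n. C * (1 / c * real n powr (- 1 - \<delta>) + real n powr - 2))"
    by (intro summable_mult summable_add)
  \<comment> \<open>The convergence criterion wants integrability for every index, which has been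
    established only from \<open>n0\<close> on; shifting the sequence does not affect the
    limit.\<close>
  have "AE \<omega> in M. (\<lambda>n. centred r (n + n0) \<omega>) \<longlonglongrightarrow> 0"
  proof (rule AE_tendsto_0_if_summable_moment4)
    show "summable (\<lambda>n. C * (1 / c * real (n + n0) powr (- 1 - \<delta>) + real (n + n0) powr - 2))"
      using summable_ignore_initial_segment[OF w, of n0] by simp
    show "eventually (\<lambda>n. expectation (\<lambda>\<omega>. centred r (n + n0) \<omega> ^ 4) \<le>
        C * (1 / c * real (n + n0) powr (- 1 - \<delta>) + real (n + n0) powr - 2)) sequentially"
      by (intro always_eventually allI) (use n0 le_add2 in blast)
  qed (use n0 le_add2 in blast)+
  then show ?thesis
  proof eventually_elim
    fix \<omega> assume "(\<lambda>n. centred r (n + n0) \<omega>) \<longlonglongrightarrow> 0"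
    then show "(\<lambda>n. centred r n \<omega>) \<longlonglongrightarrow> 0" by (rule LIMSEQ_offset)
  qed
qed

end

theorem theorem4:
  fixes M :: "'w measure"
    and X :: "nat \<Rightarrow> 'w \<Rightarrow> real^2"
    and Y :: "nat \<Rightarrow> 'w \<Rightarrow> real"
    and f :: "real^2 \<Rightarrow> real"
    and \<alpha> \<delta> :: real
    and r :: "nat \<Rightarrow> real"
    and k :: nat
    and T :: "('a, 'b) pre_digraph"
  assumes "0 < \<alpha>" and "\<alpha> \<le> 2 * pi"
    and "prob_density f"
    and "bounded (range f)"
    and "AE x in lborel. isCont f x"
    and "bounded {x. f x \<noteq> 0}"
    and "random_sector_model M f X Y"
    and "\<And>n. n \<ge> 1 \<Longrightarrow> r n > 0"
    and "k \<ge> 2"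
    and "digraph T" and "card (verts T) = k"
    and "Digraph_Component.connected T"
    and "feasible M X Y \<alpha> T"
    and "r \<longlonglongrightarrow> 0"
    and "\<delta> > 0"
    and "liminf (\<lambda>n. ereal (real n powr (2 * real k - 1 - \<delta>) * r n ^ (4 * (k - 1)))) > 0"
  shows "AE \<omega> in M.
           (\<lambda>n. real (induced_count (random_sector_digraph \<alpha> X Y n (r n) \<omega>) T)
                  / (real n ^ k * r n ^ (2 * (k - 1))))
             \<longlonglongrightarrow> mu_const \<alpha> f T"
proof -
  obtain B where B: "\<And>x. f x \<le> B"
    using assms(4) unfolding bounded_iff by (metis abs_le_D1 rangeI real_norm_def)
  obtain D :: real where D: "1 \<le> D" "\<And>\<alpha> (A :: nat set) x y r a b. finite A \<Longrightarrow> card A = card (verts T) \<Longrightarrow> 0 \<le> r \<Longrightarrow>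
      digraph_iso (sector_digraph \<alpha> A x y r) T \<Longrightarrow> a \<in> A \<Longrightarrow> b \<in> A \<Longrightarrow> dist (x a) (x b) \<le> D * r"
    using digraph_iso_sector_digraph_dist[OF assms(10,12)] by metis
  interpret random_sector_model M f X Y by fact
  interpret sector_subgraph_model M f X Y \<alpha> B D T k
  proof (intro sector_subgraph_model.intro sector_subgraph_model_axioms.intro)
    show "1 \<le> k" "0 < D" using assms(9) D(1) by simp_all
    show "dist (x a) (x b) \<le> D * r" if "finite A" "card A = k" "0 \<le> r"
      "digraph_iso (sector_digraph \<alpha> A x y r) T" "a \<in> A" "b \<in> A"
      for A x y r and a b :: nat
      by (rule D(2)[of A r \<alpha> x y]) (simp_all add: that assms(11))
  qed (fact assms B)+
  \<comment> \<open>The number of index sets contributes \<open>1 / fact k\<close>, which cancels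
    the factorial in the limit of the rescaled copy probability.\<close>
  have mean: "(\<lambda>n. real (n choose k) / real n ^ k * (copy_prob (r n) / r n ^ (2 * (k - 1)))) \<longlonglongrightarrow>
      1 / fact k * (fact k * mu_const \<alpha> f T)"
    unfolding copy_prob_def
    using binomial_over_power_tendsto prob_iso_tendsto[OF assms(14) assms(8)]
    by (rule tendsto_mult) auto
  have "AE \<omega> in M. (\<lambda>n. centred r n \<omega>) \<longlonglongrightarrow> 0"
    by (rule AE_centred_tendsto_0) (fact assms)+
  with AE_inj_X show ?thesis
  proof eventually_elim
    fix \<omega> assume \<omega>: "inj (\<lambda>i. X i \<omega>)" "(\<lambda>n. centred r n \<omega>) \<longlonglongrightarrow> 0"
    show "(\<lambda>n. real (induced_count (random_sector_digraph \<alpha> X Y n (r n) \<omega>) T)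
        / (real n ^ k * r n ^ (2 * (k - 1)))) \<longlonglongrightarrow> mu_const \<alpha> f T"
      unfolding induced_count_eq[OF \<omega>(1)] using tendsto_add[OF \<omega>(2) mean] by simp
  qed
qed

end
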